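(* Let $n, s, k, d_1,\dots,d_s$ be positive integers with $1\leqslant s\leqslant n-2$, $\prod_{i=1}^s d_i=2$ and $1\leqslant k\leqslant n-s-1$. Let $X\subset\mathbb{P}^n$ be a smooth complete intersection of multi-degree $\underline{d}=(d_1,\dots,d_s)$ over $\mathbb{C}$. Then: (i) if $\left\lfloor\frac{n-s}{2}\right\rfloor<k\leqslant n-s-1$, the Fano scheme $F_k(X)$ is empty; (ii) if $1\leqslant k\leqslant\left\lfloor\frac{n-s}{2}\right\rfloor$, the single component or both components of $F_k(X)$ (that is, each irreducible component of $F_k(X)$) are rationally connected.
   Context: We work over the complex field $\mathbb{C}$. A complete intersection $X\subset\mathbb{P}^n$ of multi-degree $(d_1,\dots,d_s)$ is a closed subscheme of dimension $n-s$ defined by the vanishing of $s$ nonzero homogeneous polynomials of degrees $d_1,\dots,d_s$. The Fano scheme $F_k(X)\subset\mathbb{G}(k,n)$ is the scheme parameterizing the $k$-dimensional (projective) linear subspaces of $\mathbb{P}^n$ contained in $X$, where $\mathbb{G}(k,n)$ is the Grassmannian of $k$-planes in $\mathbb{P}^n$. Known fact referred to in (ii): for $X$ as in the statement and $1\leqslant k\leqslant\lfloor\frac{n-s}{2}\rfloor$, $F_k(X)$ is non-empty, smooth and equidimensional of dimension $(k+1)\left(n-s-\frac{3k}{2}\right)$; it is irreducible unless $n-s$ is even and $k=\frac{n-s}{2}$, in which case it consists of two disjoint irreducible components. A smooth projective variety is rationally connected if there is a rational curve passing through two general points of it. *)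

theory Defs
  imports
    "HOL-Analysis.Abstract_Topology"
    "HOL-Library.Poly_Mapping"
    "HOL-Library.Function_Algebras"
    "HOL-Library.Extended_Nat"
    "Jordan_Normal_Form.Determinant"
begin

section \<open>Complex vector spaces of coordinate functions\<close>

interpretation cvec: vector_space "\<lambda>(c::complex) (v::'v \<Rightarrow> complex) i. c * v i"
  by unfold_locales (auto simp: fun_eq_iff algebra_simps)

text \<open>The space with coordinates indexed by \<open>I\<close>: functions vanishing outside \<open>I\<close>.\<close>

definition coord_space :: "'v set \<Rightarrow> ('v \<Rightarrow> complex) set" where
  "coord_space I = {v. \<forall>i. i \<notin> I \<longrightarrow> v i = 0}"


section \<open>Homogeneous polynomials\<close>

text \<open>A monomial is a finitely supported exponent function, a polynomial a finitely supported
  family of coefficients; the type class instances of \<open>Poly_Mapping\<close> make this the polynomial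
  ring.\<close>

type_synonym 'v cpoly = "('v \<Rightarrow>\<^sub>0 nat) \<Rightarrow>\<^sub>0 complex"

definition poly_eval :: "'v cpoly \<Rightarrow> ('v \<Rightarrow> complex) \<Rightarrow> complex" where
  "poly_eval p v = (\<Sum>m\<in>Poly_Mapping.keys p. Poly_Mapping.lookup p m * (\<Prod>i\<in>Poly_Mapping.keys m. v i ^ Poly_Mapping.lookup m i))"

text \<open>Homogeneous polynomials of degree \<open>d\<close> in the variables \<open>I\<close>; 0 is one of every degree.\<close>

definition is_form :: "'v set \<Rightarrow> nat \<Rightarrow> 'v cpoly \<Rightarrow> bool" where
  "is_form I d p \<longleftrightarrow> (\<forall>m\<in>Poly_Mapping.keys p. Poly_Mapping.keys m \<subseteq> I \<and> (\<Sum>i\<in>Poly_Mapping.keys m. Poly_Mapping.lookup m i) = d)"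

text \<open>Formal partial derivative. The truncated subtraction is harmless: a monomial without
  variable \<open>i\<close> gets coefficient 0.\<close>

definition partial_deriv :: "'v \<Rightarrow> 'v cpoly \<Rightarrow> 'v cpoly" where
  "partial_deriv i p =
    (\<Sum>m\<in>Poly_Mapping.keys p. Poly_Mapping.single (m - Poly_Mapping.single i 1) (of_nat (Poly_Mapping.lookup m i) * Poly_Mapping.lookup p m))"

definition gradient :: "'v set \<Rightarrow> 'v cpoly \<Rightarrow> ('v \<Rightarrow> complex) \<Rightarrow> ('v \<Rightarrow> complex)" where
  "gradient I p v = (\<lambda>i. if i \<in> I then poly_eval (partial_deriv i p) v else 0)"


section \<open>Projective space and its Zariski topology\<close>

definition proj_space :: "'v set \<Rightarrow> ('v \<Rightarrow> complex) set set" where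
  "proj_space I = {l. cvec.subspace l \<and> l \<subseteq> coord_space I \<and> cvec.dim l = 1}"

text \<open>\<open>\<P>\<^sup>n\<close> is \<open>proj_space {..n}\<close>.\<close>

definition zero_locus :: "'v set \<Rightarrow> 'v cpoly set \<Rightarrow> ('v \<Rightarrow> complex) set set" where
  "zero_locus I F = {l \<in> proj_space I. \<forall>p\<in>F. \<forall>v\<in>l. poly_eval p v = 0}"

text \<open>The complements of projective hypersurfaces are a basis of the open sets.\<close>

definition zariski :: "'v set \<Rightarrow> ('v \<Rightarrow> complex) set topology" where
  "zariski I = topology_generated_by
     {proj_space I - zero_locus I {p} | p d. is_form I d p}"

definition irreducible_in :: "'a topology \<Rightarrow> 'a set \<Rightarrow> bool" where
  "irreducible_in T S \<longleftrightarrow> S \<subseteq> topspace T \<and> S \<noteq> {} \<and>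
     (\<forall>A B. closedin T A \<and> closedin T B \<and> S \<subseteq> A \<union> B \<longrightarrow> S \<subseteq> A \<or> S \<subseteq> B)"

definition irreducible_components :: "'a topology \<Rightarrow> 'a set set" where
  "irreducible_components T =
     {Z. irreducible_in T Z \<and> (\<forall>Z'. irreducible_in T Z' \<and> Z \<subseteq> Z' \<longrightarrow> Z' = Z)}"

text \<open>Supremum of the lengths of chains of irreducible closed subsets. By convention of
  \<^typ>\<open>enat\<close>, the empty space gets dimension 0 rather than \<open>-\<infinity>\<close>.\<close>

definition krull_dim :: "'a topology \<Rightarrow> enat" where
  "krull_dim T = (SUP m \<in> {m. \<exists>C :: nat \<Rightarrow> 'a set.
       (\<forall>i\<le>m. closedin T (C i) \<and> irreducible_in T (C i)) \<and> (\<forall>i<m. C i \<subset> C (Suc i))}. enat m)"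


section \<open>Smooth complete intersections\<close>

text \<open>The scheme is given by its equations \<open>f 1, \<dots>, f s\<close>. Reducedness is not assumed; since the
  smoothness below is a condition on the equations, it is smoothness of the scheme they define and
  not of the underlying reduced variety.\<close>

definition complete_intersection :: "nat \<Rightarrow> nat \<Rightarrow> (nat \<Rightarrow> nat) \<Rightarrow> (nat \<Rightarrow> nat cpoly) \<Rightarrow> bool" where
  "complete_intersection n s d f \<longleftrightarrow>
     (\<forall>i\<in>{1..s}. is_form {..n} (d i) (f i) \<and> f i \<noteq> 0) \<and>
     krull_dim (subtopology (zariski {..n}) (zero_locus {..n} (f ` {1..s}))) = enat (n - s)"

text \<open>Jacobian criterion on the affine cone minus its vertex: the Jacobian matrix has rank
  \<open>s\<close>, the codimension, at every point. The rank is the dimension of the row space.\<close>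

definition smooth_complete_intersection ::
    "nat \<Rightarrow> nat \<Rightarrow> (nat \<Rightarrow> nat) \<Rightarrow> (nat \<Rightarrow> nat cpoly) \<Rightarrow> bool" where
  "smooth_complete_intersection n s d f \<longleftrightarrow>
     complete_intersection n s d f \<and>
     (\<forall>l\<in>zero_locus {..n} (f ` {1..s}). \<forall>v\<in>l. v \<noteq> 0 \<longrightarrow>
        cvec.dim ((\<lambda>i. gradient {..n} (f i) v) ` {1..s}) = s)"


section \<open>Grassmannians and Fano schemes\<close>

definition grassmannian :: "nat \<Rightarrow> nat \<Rightarrow> (nat \<Rightarrow> complex) set set" where
  "grassmannian k n = {W. cvec.subspace W \<and> W \<subseteq> coord_space {..n} \<and> cvec.dim W = k + 1}"

definition pluecker_index :: "nat \<Rightarrow> nat \<Rightarrow> nat set set" where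
  "pluecker_index k n = {J. J \<subseteq> {..n} \<and> card J = k + 1}"

text \<open>Coordinates of \<open>w 0 \<and> \<dots> \<and> w k\<close>: the maximal minors of the matrix with rows \<open>w a\<close>.\<close>

definition pluecker_coords ::
    "nat \<Rightarrow> nat \<Rightarrow> (nat \<Rightarrow> nat \<Rightarrow> complex) \<Rightarrow> (nat set \<Rightarrow> complex)" where
  "pluecker_coords k n w = (\<lambda>J. if J \<in> pluecker_index k n
     then det (mat (k + 1) (k + 1) (\<lambda>(a, b). w a (sorted_list_of_set J ! b))) else 0)"

definition pluecker :: "nat \<Rightarrow> nat \<Rightarrow> (nat \<Rightarrow> complex) set \<Rightarrow> (nat set \<Rightarrow> complex) set" where
  "pluecker k n W = cvec.span {pluecker_coords k n w | w. \<forall>a\<le>k. w a \<in> W}"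

definition grassmannian_topology :: "nat \<Rightarrow> nat \<Rightarrow> (nat \<Rightarrow> complex) set topology" where
  "grassmannian_topology k n =
     pullback_topology (grassmannian k n) (pluecker k n) (zariski (pluecker_index k n))"

text \<open>The closed points of the Fano scheme of a closed subset \<open>X\<close> of \<open>\<P>\<^sup>n\<close>: a \<open>k\<close>-plane, given by
  its cone \<open>W\<close>, lies in \<open>X\<close> if all its points do. As linear spaces are reduced, this agrees with
  containment in a scheme with underlying set \<open>X\<close>.\<close>

definition fano :: "nat \<Rightarrow> nat \<Rightarrow> (nat \<Rightarrow> complex) set set \<Rightarrow> (nat \<Rightarrow> complex) set set" where
  "fano k n X = {W \<in> grassmannian k n. \<forall>l\<in>proj_space {..n}. l \<subseteq> W \<longrightarrow> l \<in> X}"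


section \<open>Rational connectedness\<close>

text \<open>Morphisms from a locally closed subset \<open>A\<close> of one projective space to another: locally given
  by forms of equal degree without common zero.\<close>

definition regular_map ::
    "'v set \<Rightarrow> ('v \<Rightarrow> complex) set set \<Rightarrow> 'w set \<Rightarrow>
     (('v \<Rightarrow> complex) set \<Rightarrow> ('w \<Rightarrow> complex) set) \<Rightarrow> bool" where
  "regular_map I A J \<phi> \<longleftrightarrow> \<phi> \<in> A \<rightarrow> proj_space J \<and>
     (\<forall>p\<in>A. \<exists>U d F. openin (subtopology (zariski I) A) U \<and> p \<in> U \<and>
        (\<forall>j\<in>J. is_form I d (F j)) \<and>
        (\<forall>q\<in>U. \<forall>v\<in>q. v \<noteq> 0 \<longrightarrow>
           (\<lambda>j. if j \<in> J then poly_eval (F j) v else 0) \<in> \<phi> q - {0}))"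

text \<open>A rational curve is the image of a nonconstant morphism from \<open>\<P>\<^sup>1\<close>.\<close>

definition rational_curve :: "'v set \<Rightarrow> ('v \<Rightarrow> complex) set set \<Rightarrow> bool" where
  "rational_curve I C \<longleftrightarrow> (\<exists>\<phi>. regular_map {..1::nat} (proj_space {..1}) I \<phi> \<and>
     \<phi> ` proj_space {..1} = C \<and> \<not> (\<exists>c. C = {c}))"

text \<open>The Zariski topology on a product of projective spaces is induced by the Segre embedding.\<close>

definition segre ::
    "('v \<Rightarrow> complex) set \<times> ('w \<Rightarrow> complex) set \<Rightarrow> ('v \<times> 'w \<Rightarrow> complex) set" where
  "segre = (\<lambda>(p, q). cvec.span {\<lambda>(i, j). v i * w j | v w. v \<in> p \<and> w \<in> q})"

definition product_zariski ::
    "'v set \<Rightarrow> 'w set \<Rightarrow> (('v \<Rightarrow> complex) set \<times> ('w \<Rightarrow> complex) set) topology" where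
  "product_zariski I J =
     pullback_topology (proj_space I \<times> proj_space J) segre (zariski (I \<times> J))"

text \<open>For a projective variety \<open>Z\<close>; ``two general points'' are the points of a dense open subset of
  \<open>Z \<times> Z\<close>.\<close>

definition rationally_connected :: "'v set \<Rightarrow> ('v \<Rightarrow> complex) set set \<Rightarrow> bool" where
  "rationally_connected I Z \<longleftrightarrow>
     (\<exists>U. openin (subtopology (product_zariski I I) (Z \<times> Z)) U \<and>
          subtopology (product_zariski I I) (Z \<times> Z) closure_of U = Z \<times> Z \<and>
          (\<forall>(p, q)\<in>U. \<exists>C. rational_curve I C \<and> C \<subseteq> Z \<and> p \<in> C \<and> q \<in> C))"

end

theory Submission
  imports Defs
begin

text \<open>
  Since the degrees multiply to 2, \<open>X\<close> is cut out by one quadric and \<open>s - 1\<close> hyperplanes: it is the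
  quadric of isotropic lines of a symmetric bilinear form \<open>B\<close> on the common kernel \<open>L\<close> of the linear
  equations, and a \<open>k\<close>-plane in \<open>X\<close> is a totally isotropic subspace of \<open>L\<close> of dimension \<open>r = k + 1\<close>.
  The Jacobian criterion says that \<open>B\<close> is nondegenerate on \<open>L\<close> and, if \<open>X\<close> has a point, that the
  linear equations are independent (\<open>coordinate_quadric_of_complete_intersection\<close>).

  Part (i) is the bound \<open>2 r \<le> dim L \<le> n - s + 2\<close>: a basis of an isotropic subspace and a dual family
  in \<open>L\<close> are together linearly independent (\<open>dim_isotropic_le\<close>).

  Part (ii) rests on explicit curves. Two isotropic subspaces \<open>W\<close>, \<open>W'\<close> of dimension \<open>r\<close> have bases
  which agree on \<open>W \<inter> W'\<close>, are orthogonal on a further part, and are dual to each other on the rest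
  (\<open>normal_pair\<close>). From them one writes down, for \<open>(s, t) \<noteq> (0, 0)\<close>, a basis of an isotropic subspace
  of dimension \<open>r\<close> whose members are binary forms in \<open>s\<close>, \<open>t\<close>, and which spans \<open>W\<close> at \<open>(1, 0)\<close> and
  \<open>W'\<close> at \<open>(0, 1)\<close>. The dual part is treated two vectors at a time; a single vector left over needs a
  conic through an anisotropic vector, and such a vector exists if \<open>2 r < dim L\<close>. So \<open>W\<close> and \<open>W'\<close> are
  joined if \<open>2 r < dim L\<close> or \<open>r - dim (W \<inter> W')\<close> is even (\<open>isotropic_joined\<close>). Because every member of
  the family has full dimension, its Pluecker coordinates are binary forms of equal degree without
  common zero, that is, a morphism from the projective line with no base points to remove.

  The components come out of the same curves: a set is irreducible as soon as any two of its points
  lie on such a curve inside it (\<open>irreducible_if_curve_within\<close>). If \<open>2 r < dim L\<close>, this makes the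
  whole Fano scheme irreducible. If \<open>2 r = dim L\<close>, the relation ``\<open>r - dim (W \<inter> W')\<close> is even'' is an
  equivalence (\<open>isotropic_parity\<close>) with open classes (\<open>opposite_neighbourhood\<close>), so the classes are
  closed as well, a curve stays in one class, and the components are the classes. Either way any two
  points of a component \<open>Z\<close> are joined inside \<open>Z\<close>, and the dense open set of pairs can be taken to be
  all of \<open>Z \<times> Z\<close>. A rational curve has to be nonconstant, so a pair \<open>(p, p)\<close> also needs a second point
  of \<open>Z\<close>; it exists because \<open>r \<ge> 2\<close> (\<open>isotropic_partner\<close>).
\<close>

section \<open>Families of vectors and bilinear forms\<close>

text \<open>Bases are used as indexed families, because subspaces are paired with each other basis vector by
  basis vector, and because rows of a matrix are indexed.\<close>

locale vector_families = vector_space scale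
  for scale :: "'a::field \<Rightarrow> 'b::ab_group_add \<Rightarrow> 'b" (infixr \<open>*s\<close> 75)
begin

definition indep_on :: "'i set \<Rightarrow> ('i \<Rightarrow> 'b) \<Rightarrow> bool" where
  "indep_on I w \<longleftrightarrow> (\<forall>c. (\<Sum>a\<in>I. c a *s w a) = 0 \<longrightarrow> (\<forall>a\<in>I. c a = 0))"

lemma indep_onI:
  "(\<And>c a. (\<Sum>a\<in>I. c a *s w a) = 0 \<Longrightarrow> a \<in> I \<Longrightarrow> c a = 0) \<Longrightarrow> indep_on I w"
  unfolding indep_on_def by blast

lemma indep_onD: "indep_on I w \<Longrightarrow> (\<Sum>a\<in>I. c a *s w a) = 0 \<Longrightarrow> a \<in> I \<Longrightarrow> c a = 0"
  unfolding indep_on_def by blast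

lemma indep_on_subset:
  assumes "indep_on I w" "J \<subseteq> I" "finite I"
  shows "indep_on J w"
proof (rule indep_onI)
  fix c a assume c: "(\<Sum>a\<in>J. c a *s w a) = 0" "a \<in> J"
  have "(\<Sum>a\<in>I. (if a \<in> J then c a else 0) *s w a) = (\<Sum>a\<in>J. c a *s w a)"
    using assms by (intro sum.mono_neutral_cong_right) auto
  then show "c a = 0"
    using indep_onD[OF assms(1), of "\<lambda>a. if a \<in> J then c a else 0" a] c assms(2) by auto
qed

lemma indep_on_cong: "(\<And>a. a \<in> I \<Longrightarrow> w a = w' a) \<Longrightarrow> indep_on I w \<longleftrightarrow> indep_on I w'"
  unfolding indep_on_def by (simp cong: sum.cong)

lemma indep_on_comp:
  assumes "inj_on h J" "indep_on (h ` J) w"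
  shows "indep_on J (w \<circ> h)"
proof (rule indep_onI)
  fix c a assume c: "(\<Sum>a\<in>J. c a *s (w \<circ> h) a) = 0" "a \<in> J"
  have "(\<Sum>b\<in>h ` J. c (the_inv_into J h b) *s w b) = (\<Sum>a\<in>J. c a *s (w \<circ> h) a)"
    by (simp add: sum.reindex[OF assms(1)] the_inv_into_f_f[OF assms(1)])
  then have "c (the_inv_into J h (h a)) = 0"
    using indep_onD[OF assms(2), of "\<lambda>b. c (the_inv_into J h b)" "h a"] c by simp
  then show "c a = 0" using c by (simp add: the_inv_into_f_f[OF assms(1)])
qed

lemma span_family:
  assumes "finite I"
  shows "span (w ` I) = range (\<lambda>c. \<Sum>a\<in>I. c a *s w a)"
proof
  have "subspace (range (\<lambda>c. \<Sum>a\<in>I. c a *s w a))"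
  proof (rule subspaceI)
    show "0 \<in> range (\<lambda>c. \<Sum>a\<in>I. c a *s w a)"
      by (rule range_eqI[of _ _ "\<lambda>_. 0"]) simp
    fix x y :: 'b and k assume "x \<in> range (\<lambda>c. \<Sum>a\<in>I. c a *s w a)"
    then obtain c where c: "x = (\<Sum>a\<in>I. c a *s w a)" by blast
    show "k *s x \<in> range (\<lambda>c. \<Sum>a\<in>I. c a *s w a)"
      by (rule range_eqI[of _ _ "\<lambda>a. k * c a"]) (simp add: c scale_sum_right)
    assume "y \<in> range (\<lambda>c. \<Sum>a\<in>I. c a *s w a)"
    then obtain d where d: "y = (\<Sum>a\<in>I. d a *s w a)" by blast
    show "x + y \<in> range (\<lambda>c. \<Sum>a\<in>I. c a *s w a)"
      by (rule range_eqI[of _ _ "\<lambda>a. c a + d a"]) (simp add: c d scale_left_distrib sum.distrib)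
  qed
  moreover have "w ` I \<subseteq> range (\<lambda>c. \<Sum>a\<in>I. c a *s w a)"
  proof safe
    fix b assume "b \<in> I"
    have "(\<Sum>a\<in>I. (if a = b then 1 else 0) *s w a) = (\<Sum>a\<in>I. if a = b then w a else 0)"
      by (intro sum.cong) auto
    also have "\<dots> = w b"
      using assms \<open>b \<in> I\<close> by simp
    finally show "w b \<in> range (\<lambda>c. \<Sum>a\<in>I. c a *s w a)"
      by (intro range_eqI[of _ _ "\<lambda>a. if a = b then 1 else 0"]) simp
  qed
  ultimately show "span (w ` I) \<subseteq> range (\<lambda>c. \<Sum>a\<in>I. c a *s w a)"
    by (rule span_minimal[rotated])
  show "range (\<lambda>c. \<Sum>a\<in>I. c a *s w a) \<subseteq> span (w ` I)"
    by (auto intro: span_sum span_scale span_base)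
qed

lemma in_span_familyE:
  assumes "v \<in> span (w ` I)" "finite I"
  obtains c where "v = (\<Sum>a\<in>I. c a *s w a)"
  using assms by (auto simp: span_family[OF assms(2)])

lemma indep_on_iff:
  assumes "finite I"
  shows "indep_on I w \<longleftrightarrow> inj_on w I \<and> independent (w ` I)"
proof (intro iffI conjI)
  assume w: "indep_on I w"
  show inj: "inj_on w I"
  proof (rule inj_onI, rule ccontr)
    fix a b assume ab: "a \<in> I" "b \<in> I" "w a = w b" "a \<noteq> b"
    let ?c = "\<lambda>i. if i = a then 1 else if i = b then -1 else (0::'a)"
    have "(\<Sum>i\<in>I. ?c i *s w i) = (\<Sum>i\<in>{a,b}. ?c i *s w i)"
      using assms ab by (intro sum.mono_neutral_right) auto
    also have "\<dots> = 0" using ab by simp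
    finally have "?c a = 0" using indep_onD[OF w, of ?c a] ab by blast
    then show False by simp
  qed
  show "independent (w ` I)"
  proof (rule independent_if_scalars_zero)
    fix f x assume "(\<Sum>x\<in>w ` I. f x *s x) = 0" "x \<in> w ` I"
    then show "f x = 0"
      using indep_onD[OF w, of "f \<circ> w"] by (auto simp: sum.reindex[OF inj])
  qed (use assms in simp)
next
  assume w: "inj_on w I \<and> independent (w ` I)"
  then have inj: "inj_on w I" by simp
  show "indep_on I w"
  proof (rule indep_onI)
    fix c a assume c: "(\<Sum>a\<in>I. c a *s w a) = 0" "a \<in> I"
    have "(\<Sum>v\<in>w ` I. c (the_inv_into I w v) *s v) = (\<Sum>a\<in>I. c a *s w a)"
      by (simp add: sum.reindex[OF inj] the_inv_into_f_f[OF inj])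
    then have "c (the_inv_into I w (w a)) = 0"
      using w c assms by (intro independentD[of "w ` I" "w ` I" "\<lambda>v. c (the_inv_into I w v)"]) auto
    then show "c a = 0" using c by (simp add: the_inv_into_f_f[OF inj])
  qed
qed

lemma dim_span_indep_on: "finite I \<Longrightarrow> indep_on I w \<Longrightarrow> dim (span (w ` I)) = card I"
  by (metis indep_on_iff card_image dim_span_eq_card_independent)

lemma card_indep_on_le:
  assumes "finite I" "indep_on I w" "finite T" "w ` I \<subseteq> span T"
  shows "card I \<le> card T"
  using assms independent_span_bound[of T "w ` I"] by (auto simp: indep_on_iff card_image)

lemma span_eq_of_indep_on:
  assumes I: "finite I" "indep_on I w" and V: "w ` I \<subseteq> V" "subspace V" "dim V = card I"
    and T: "finite T" "V \<subseteq> span T"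
  shows "span (w ` I) = V"
proof
  show "span (w ` I) \<subseteq> V" using V span_minimal by blast
  show "V \<subseteq> span (w ` I)"
  proof
    fix v assume "v \<in> V"
    obtain B where B: "B \<subseteq> V" "independent B" "V \<subseteq> span B" "card B = dim V"
      using basis_exists by blast
    have "finite B" using independent_span_bound[OF T(1) B(2)] B(1) T(2) by blast
    show "v \<in> span (w ` I)"
    proof (rule ccontr)
      assume nv: "v \<notin> span (w ` I)"
      have ind: "independent (insert v (w ` I))"
        using nv I indep_on_iff independent_insertI by blast
      have "card (insert v (w ` I)) = Suc (card I)"
        using nv I indep_on_iff card_image span_base
        by (metis card_insert_disjoint finite_imageI)
      moreover have "card (insert v (w ` I)) \<le> card B"
        using independent_span_bound[OF \<open>finite B\<close> ind] B V \<open>v \<in> V\<close> by blast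
      ultimately show False using B V by simp
    qed
  qed
qed

lemma extend_family:
  assumes w0: "indep_on {..<k::nat} w0" "w0 ` {..<k} \<subseteq> V" and V: "subspace V"
    and T: "finite T" "V \<subseteq> span T"
  obtains q w where "k \<le> q" "\<And>a. a < k \<Longrightarrow> w a = w0 a"
    "indep_on {..<q} w" "span (w ` {..<q}) = V"
proof -
  have w0': "inj_on w0 {..<k}" "independent (w0 ` {..<k})"
    using w0(1) by (simp_all add: indep_on_iff)
  obtain B where B: "w0 ` {..<k} \<subseteq> B" "B \<subseteq> V" "independent B" "V \<subseteq> span B"
    using maximal_independent_subset_extend[OF w0(2) w0'(2)] by blast
  have fB: "finite B" using independent_span_bound[OF T(1) B(3)] B(2) T(2) by blast
  define m where "m = card (B - w0 ` {..<k})"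
  obtain h where h: "bij_betw h {0..<m} (B - w0 ` {..<k})"
    using ex_bij_betw_nat_finite[of "B - w0 ` {..<k}"] fB unfolding m_def by blast
  define w where "w a = (if a < k then w0 a else h (a - k))" for a
  have "bij_betw (\<lambda>a. a - k) {k..<k+m} {0..<m}"
    by (rule bij_betw_byWitness[of _ "\<lambda>a. a + k"]) auto
  then have "bij_betw (h \<circ> (\<lambda>a. a - k)) {k..<k+m} (B - w0 ` {..<k})"
    using h by (rule bij_betw_trans)
  then have "bij_betw w {k..<k+m} (B - w0 ` {..<k})"
    by (rule bij_betw_cong[THEN iffD1, rotated]) (auto simp: w_def)
  moreover have "bij_betw w {..<k} (w0 ` {..<k})"
    using w0'(1) by (auto simp: bij_betw_def w_def inj_on_def)
  ultimately have "bij_betw w ({..<k} \<union> {k..<k+m}) (w0 ` {..<k} \<union> (B - w0 ` {..<k}))"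
    by (intro bij_betw_combine) auto
  moreover have "{..<k} \<union> {k..<k+m} = {..<k+m}" by auto
  moreover have "w0 ` {..<k} \<union> (B - w0 ` {..<k}) = B" using B(1) by auto
  ultimately have bij: "bij_betw w {..<k+m} B" by simp
  have "indep_on {..<k+m} w"
    using bij B(3) by (simp add: indep_on_iff bij_betw_def)
  moreover have "span (w ` {..<k+m}) = V"
    using bij B V by (metis bij_betw_imp_surj_on span_subspace)
  ultimately show ?thesis
    by (intro that[of "k+m" w]) (auto simp: w_def)
qed

lemma basis_family:
  assumes "subspace V" "dim V = r" "0 < r"
  obtains w where "indep_on {..<r::nat} w" "span (w ` {..<r}) = V"
proof -
  obtain B where B: "B \<subseteq> V" "independent B" "V \<subseteq> span B" "card B = r"
    using basis_exists assms(2) by metis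
  then have "finite B" using assms(3) card_ge_0_finite by metis
  then obtain h where h: "bij_betw h {0..<r} B"
    using ex_bij_betw_nat_finite B(4) by blast
  then have "indep_on {..<r} h" "span (h ` {..<r}) = V"
    using B assms(1) span_subspace
    by (auto simp: indep_on_iff bij_betw_def lessThan_atLeast0)
  then show ?thesis using that by blast
qed

lemma indep_on_notin_span:
  assumes "indep_on I w" "finite I" "J \<subseteq> I" "i \<in> I" "i \<notin> J"
  shows "w i \<notin> span (w ` J)"
proof
  assume "w i \<in> span (w ` J)"
  moreover have "finite J" using assms(2,3) by (rule finite_subset[rotated])
  ultimately obtain c where c: "w i = (\<Sum>a\<in>J. c a *s w a)" by (rule in_span_familyE)
  let ?c = "\<lambda>a. if a = i then - 1 else c a"
  have "indep_on (insert i J) w"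
    using assms by (intro indep_on_subset[OF assms(1)]) auto
  moreover have "(\<Sum>a\<in>insert i J. ?c a *s w a) = 0"
  proof -
    have "(\<Sum>a\<in>J. ?c a *s w a) = w i"
      unfolding c using assms(5) by (intro sum.cong) auto
    then show ?thesis using \<open>finite J\<close> assms(5) by simp
  qed
  ultimately have "?c i = 0" by (rule indep_onD) simp
  then show False by simp
qed

lemma dim_insert_subspace:
  assumes M: "subspace M" "M \<subseteq> span T" "finite T" and u: "u \<notin> M"
  shows "dim (span (insert u M)) = Suc (dim M)"
proof -
  obtain C where C: "C \<subseteq> M" "independent C" "M \<subseteq> span C" "card C = dim M"
    using basis_exists by blast
  have "C \<subseteq> span T" using C(1) M(2) by (rule subset_trans)
  then have fC: "finite C" using independent_span_bound[OF M(3) C(2)] by simp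
  have sC: "span C = M" using C(1,3) M(1) by (rule span_subspace)
  have "span (insert u M) = span (insert u C)"
    unfolding sC[symmetric] span_eq
    using span_mono[of C "insert u C"] span_superset[of C] by (auto simp: span_base)
  moreover have "independent (insert u C)" using u C(2) sC by (intro independent_insertI) simp_all
  moreover have "u \<notin> C" using u C(1) by blast
  ultimately show ?thesis using fC C(4) by (simp add: dim_eq_card_independent)
qed

lemma indep_on_if_dim:
  assumes "finite I" "dim (w ` I) = card I"
  shows "indep_on I w"
proof -
  obtain C where C: "C \<subseteq> w ` I" "independent C" "w ` I \<subseteq> span C"
    by (rule maximal_independent_subset)
  have card: "card C = card I" using basis_card_eq_dim[OF C(1,3,2)] assms(2) by simp
  have fin: "finite (w ` I)" using assms(1) by simp
  have le: "card (w ` I) \<le> card I" using assms(1) by (rule card_image_le)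
  have "C = w ` I" using card_mono[OF fin C(1)] card le by (intro card_subset_eq[OF fin C(1)]) simp
  then have "inj_on w I" using card assms(1) by (intro eq_card_imp_inj_on) simp_all
  then show ?thesis using C(2) \<open>C = w ` I\<close> assms(1) by (simp add: indep_on_iff)
qed

end

locale bilinear_form = vector_families scale
  for scale :: "'a::field_char_0 \<Rightarrow> 'b::ab_group_add \<Rightarrow> 'b" (infixr \<open>*s\<close> 75) +
  fixes B :: "'b \<Rightarrow> 'b \<Rightarrow> 'a"
  assumes B_add_left: "B (x + y) z = B x z + B y z"
    and B_scale_left: "B (c *s x) z = c * B x z"
    and B_sym: "B x y = B y x"
begin

lemma B_add_right: "B z (x + y) = B z x + B z y"
  using B_add_left B_sym by metis

lemma B_scale_right: "B z (c *s x) = c * B z x"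
  using B_scale_left B_sym by metis

lemma B_zero_left [simp]: "B 0 z = 0"
  using B_scale_left[of 0 0 z] by simp

lemma B_zero_right [simp]: "B z 0 = 0"
  using B_zero_left B_sym by metis

lemma B_diff_left: "B (x - y) z = B x z - B y z"
  using B_add_left[of x "(-1) *s y" z] B_scale_left[of "-1" y z] by simp

lemma B_diff_right: "B z (x - y) = B z x - B z y"
  using B_diff_left B_sym by metis

lemma B_sum_left: "B (\<Sum>a\<in>I. f a) z = (\<Sum>a\<in>I. B (f a) z)"
  by (induction I rule: infinite_finite_induct) (auto simp: B_add_left)

lemma B_sum_right: "B z (\<Sum>a\<in>I. f a) = (\<Sum>a\<in>I. B z (f a))"
  by (induction I rule: infinite_finite_induct) (auto simp: B_add_right)

lemmas B_simps = B_add_left B_add_right B_diff_left B_diff_right B_scale_left B_scale_right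
  B_sum_left B_sum_right

lemma subspace_perp: "subspace {v. B v x = 0}"
  by (rule subspaceI) (auto simp: B_add_left B_scale_left)

lemma perp_span:
  assumes "\<And>v. v \<in> S \<Longrightarrow> B v x = 0" "v \<in> span S"
  shows "B v x = 0"
  using span_minimal[of S "{v. B v x = 0}"] assms subspace_perp by blast

lemma perp_span2:
  assumes "\<And>v w. v \<in> S \<Longrightarrow> w \<in> T \<Longrightarrow> B v w = 0" "v \<in> span S" "w \<in> span T"
  shows "B v w = 0"
proof (rule perp_span[OF _ assms(2)])
  fix x assume "x \<in> S"
  then have "B w x = 0"
    by (intro perp_span[OF _ assms(3)]) (metis assms(1) B_sym)
  then show "B x w = 0" by (metis B_sym)
qed

text \<open>Induction on the family, by a Gram--Schmidt step: remove from the new vector its components along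
  the old ones, pair the nonzero remainder with some vector of \<open>M\<close>, and correct the old dual vectors.
  Only nondegeneracy on the side of the family is assumed, so that \<open>M\<close> may be an isotropic subspace.\<close>

lemma dual_family:
  assumes "finite I" "indep_on I w" "subspace M"
    and "\<And>v. v \<in> span (w ` I) \<Longrightarrow> v \<noteq> 0 \<Longrightarrow> \<exists>y\<in>M. B v y \<noteq> 0"
  shows "\<exists>x. (\<forall>a\<in>I. x a \<in> M) \<and> (\<forall>a\<in>I. \<forall>b\<in>I. B (w a) (x b) = (if a = b then 1 else 0))"
  using assms
proof (induction I rule: finite_induct)
  case empty
  then show ?case by simp
next
  case (insert i I)
  have "indep_on I w" using insert.prems(1) insert.hyps by (auto intro: indep_on_subset[OF insert.prems(1)])
  have sub: "span (w ` I) \<subseteq> span (w ` insert i I)" by (intro span_mono) auto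
  have "\<exists>x. (\<forall>a\<in>I. x a \<in> M) \<and> (\<forall>a\<in>I. \<forall>b\<in>I. B (w a) (x b) = (if a = b then 1 else 0))"
    by (rule insert.IH[OF \<open>indep_on I w\<close> insert.prems(2)]) (use insert.prems(3) sub in blast)
  then obtain x where xM: "\<And>a. a \<in> I \<Longrightarrow> x a \<in> M"
    and x: "\<And>a b. a \<in> I \<Longrightarrow> b \<in> I \<Longrightarrow> B (w a) (x b) = (if a = b then 1 else 0)"
    by blast
  define w' where "w' = w i - (\<Sum>a\<in>I. B (w i) (x a) *s w a)"
  have "w' \<in> span (w ` insert i I)"
    unfolding w'_def by (intro span_diff span_sum span_scale span_base) auto
  moreover have "w' \<noteq> 0"
  proof
    assume "w' = 0"
    let ?c = "\<lambda>a. if a = i then 1 else - B (w i) (x a)"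
    have "(\<Sum>a\<in>insert i I. ?c a *s w a) = w i + (\<Sum>a\<in>I. ?c a *s w a)"
      using insert.hyps by simp
    also have "(\<Sum>a\<in>I. ?c a *s w a) = - (\<Sum>a\<in>I. B (w i) (x a) *s w a)"
      unfolding sum_negf[symmetric] using insert.hyps by (intro sum.cong) auto
    finally have "(\<Sum>a\<in>insert i I. ?c a *s w a) = 0"
      using \<open>w' = 0\<close> by (simp add: w'_def)
    from indep_onD[OF insert.prems(1) this, of i] show False by simp
  qed
  ultimately obtain y0 where y0: "y0 \<in> M" "B w' y0 \<noteq> 0" using insert.prems(3) by blast
  define y1 where "y1 = (1 / B w' y0) *s y0"
  define y where "y = y1 - (\<Sum>a\<in>I. B (w a) y1 *s x a)"
  define x' where "x' b = (if b = i then y else x b - B (w i) (x b) *s y)" for b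
  have y1: "y1 \<in> M" "B w' y1 = 1"
    using y0 insert.prems(2) by (auto simp: y1_def B_simps subspace_scale)
  have yM: "y \<in> M"
    unfolding y_def using y1 xM insert.prems(2)
    by (intro subspace_diff subspace_sum subspace_scale)
  have sums: "(\<Sum>a\<in>I. f a * B (w j) (x a)) = f j" "(\<Sum>a\<in>I. f a * B (w a) (x j)) = f j"
    if "j \<in> I" for f j
  proof -
    have "(\<Sum>a\<in>I. f a * B (w j) (x a)) = (\<Sum>a\<in>I. if j = a then f a else 0)"
      by (intro sum.cong) (auto simp: x that)
    then show "(\<Sum>a\<in>I. f a * B (w j) (x a)) = f j" using insert.hyps that by simp
    have "(\<Sum>a\<in>I. f a * B (w a) (x j)) = (\<Sum>a\<in>I. if j = a then f a else 0)"
      by (intro sum.cong) (auto simp: x that)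
    then show "(\<Sum>a\<in>I. f a * B (w a) (x j)) = f j" using insert.hyps that by simp
  qed
  have wy: "B (w j) y = 0" if "j \<in> I" for j
    by (simp add: y_def B_simps sums that)
  have w'x: "B w' (x b) = 0" if "b \<in> I" for b
    by (simp add: w'_def B_simps sums that)
  have "B w' y = 1"
    by (simp add: y_def B_simps w'x y1)
  then have wiy: "B (w i) y = 1"
    by (simp add: w'_def B_simps wy)
  have "\<forall>a\<in>insert i I. x' a \<in> M"
    using xM yM insert.prems(2) by (auto simp: x'_def intro!: subspace_diff subspace_scale)
  moreover have "\<forall>a\<in>insert i I. \<forall>b\<in>insert i I. B (w a) (x' b) = (if a = b then 1 else 0)"
    using insert.hyps by (auto simp: x'_def B_simps wy wiy x)
  ultimately show ?case by blast
qed

text \<open>Pairing a linear relation with the \<open>w a\<close> isolates the coefficients of the \<open>x a\<close>.\<close>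

lemma indep_on_dual_union:
  assumes "finite I" "finite J" "indep_on J v"
    and "\<And>a b. a \<in> I \<Longrightarrow> b \<in> I \<Longrightarrow> B (w a) (x b) = (if a = b then 1 else 0)"
    and "\<And>a b. a \<in> I \<Longrightarrow> b \<in> J \<Longrightarrow> B (w a) (v b) = 0"
  shows "indep_on (I <+> J) (case_sum x v)"
proof (rule indep_onI)
  fix c a assume c: "(\<Sum>a\<in>I <+> J. c a *s case_sum x v a) = 0" and "a \<in> I <+> J"
  from c have c: "(\<Sum>a\<in>I. c (Inl a) *s x a) + (\<Sum>a\<in>J. c (Inr a) *s v a) = 0"
    using assms by (simp add: sum.Plus)
  have I: "c (Inl b) = 0" if "b \<in> I" for b
  proof -
    have "B (w b) ((\<Sum>a\<in>I. c (Inl a) *s x a) + (\<Sum>a\<in>J. c (Inr a) *s v a))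
        = (\<Sum>a\<in>I. if b = a then c (Inl a) else 0)"
      using that by (simp add: B_simps assms if_distrib[of "\<lambda>t. _ * t"] cong: sum.cong if_cong)
    then show ?thesis using c that assms(1) by simp
  qed
  then have "(\<Sum>a\<in>J. c (Inr a) *s v a) = 0" using c by simp
  then show "c a = 0"
    using I indep_onD[OF assms(3), of "\<lambda>a. c (Inr a)"] \<open>a \<in> I <+> J\<close> by auto
qed

end

text \<open>The finite set \<open>T\<close> serves only to make \<open>L\<close> finite-dimensional inside an ambient space that need
  not be.\<close>

locale quadratic_space = bilinear_form scale B
  for scale :: "'a::field_char_0 \<Rightarrow> 'b::ab_group_add \<Rightarrow> 'b" (infixr \<open>*s\<close> 75)
    and B :: "'b \<Rightarrow> 'b \<Rightarrow> 'a" +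
  fixes L T :: "'b set"
  assumes subspace_L: "subspace L"
    and finite_T: "finite T" and L_span: "L \<subseteq> span T"
    and nondegenerate: "x \<in> L \<Longrightarrow> x \<noteq> 0 \<Longrightarrow> \<exists>y\<in>L. B x y \<noteq> 0"
begin

lemma separate_point:
  assumes S: "S \<subseteq> L" and y: "y \<in> L" "y \<notin> span S"
  obtains x where "x \<in> L" "\<And>v. v \<in> span S \<Longrightarrow> B v x = 0" "B y x = 1"
proof -
  obtain C where C: "C \<subseteq> S" "independent C" "S \<subseteq> span C"
    using maximal_independent_subset by metis
  have fC: "finite C" using independent_span_bound[OF finite_T C(2)] C(1) S L_span by blast
  have CS: "span C = span S"
    by (metis C(1,3) span_eq span_superset subset_trans)
  have ind: "indep_on (insert y C) (\<lambda>v. v)"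
    using independent_insertI[of y C] C y CS fC by (simp add: indep_on_iff)
  have sub: "span (insert y C) \<subseteq> L"
    using y S C subspace_L by (intro span_minimal) auto
  have "\<exists>x. (\<forall>a\<in>insert y C. x a \<in> L) \<and>
      (\<forall>a\<in>insert y C. \<forall>b\<in>insert y C. B a (x b) = (if a = b then 1 else 0))"
    using dual_family[OF _ ind subspace_L] fC sub nondegenerate by (simp add: subset_iff)
  then obtain x where x: "\<And>a. a \<in> insert y C \<Longrightarrow> x a \<in> L"
    "\<And>a b. a \<in> insert y C \<Longrightarrow> b \<in> insert y C \<Longrightarrow> B a (x b) = (if a = b then 1 else 0)"
    by blast
  have "y \<notin> C" using y CS span_base by blast
  have "B c (x y) = 0" if "c \<in> C" for c
    using that x(2)[of c y] \<open>y \<notin> C\<close> by auto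
  then have "B v (x y) = 0" if "v \<in> span S" for v
    using that perp_span unfolding CS[symmetric] by blast
  then show ?thesis using that[of "x y"] x by auto
qed

section \<open>Isotropic subspaces\<close>

lemma finite_basis_L:
  obtains C where "finite C" "C \<subseteq> L" "L \<subseteq> span C" "card C = dim L"
  by (metis basis_exists L_span finite_T independent_span_bound subset_trans)

lemma dual_family_L:
  assumes "finite I" "indep_on I w" "w ` I \<subseteq> L"
  obtains x where "\<And>a. a \<in> I \<Longrightarrow> x a \<in> L"
    "\<And>a b. a \<in> I \<Longrightarrow> b \<in> I \<Longrightarrow> B (w a) (x b) = (if a = b then 1 else 0)"
proof -
  have "span (w ` I) \<subseteq> L" using assms(3) subspace_L by (rule span_minimal)
  then have "\<exists>x. (\<forall>a\<in>I. x a \<in> L) \<and> (\<forall>a\<in>I. \<forall>b\<in>I. B (w a) (x b) = (if a = b then 1 else 0))"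
    using nondegenerate by (intro dual_family[OF assms(1,2) subspace_L]) blast
  then show ?thesis using that by blast
qed

text \<open>A family dual to \<open>w\<close> is independent of everything orthogonal to \<open>w\<close>. With \<open>v = w\<close> this bounds the
  dimension of an isotropic subspace; for the dot product it bounds the dimension of a common kernel.\<close>

lemma card_orthogonal_le:
  assumes "finite I" "finite J" "indep_on I w" "indep_on J v" "w ` I \<subseteq> L" "v ` J \<subseteq> L"
    and "\<And>a b. a \<in> I \<Longrightarrow> b \<in> J \<Longrightarrow> B (w a) (v b) = 0"
  shows "card I + card J \<le> dim L"
proof -
  obtain x where x: "\<And>a. a \<in> I \<Longrightarrow> x a \<in> L"
    "\<And>a b. a \<in> I \<Longrightarrow> b \<in> I \<Longrightarrow> B (w a) (x b) = (if a = b then 1 else 0)"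
    using dual_family_L[OF assms(1,3,5)] by blast
  obtain C where C: "finite C" "C \<subseteq> L" "L \<subseteq> span C" "card C = dim L"
    using finite_basis_L .
  have "indep_on (I <+> J) (case_sum x v)"
    by (rule indep_on_dual_union[OF assms(1,2,4) x(2) assms(7)])
  moreover have "case_sum x v ` (I <+> J) \<subseteq> span C"
    using x(1) assms(6) C(3) by (auto 0 4)
  ultimately have "card (I <+> J) \<le> card C"
    using assms(1,2) C(1) by (intro card_indep_on_le) auto
  then show ?thesis using assms(1,2) C(4) by (simp add: card_Plus)
qed

definition isotropic :: "'b set \<Rightarrow> bool" where
  "isotropic W \<longleftrightarrow> subspace W \<and> W \<subseteq> L \<and> (\<forall>x\<in>W. \<forall>y\<in>W. B x y = 0)"

lemma isotropicD:
  "isotropic W \<Longrightarrow> subspace W" "isotropic W \<Longrightarrow> W \<subseteq> L"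
  "isotropic W \<Longrightarrow> x \<in> W \<Longrightarrow> y \<in> W \<Longrightarrow> B x y = 0"
  by (auto simp: isotropic_def)

lemma isotropic_span:
  assumes "S \<subseteq> L" "\<And>x y. x \<in> S \<Longrightarrow> y \<in> S \<Longrightarrow> B x y = 0"
  shows "isotropic (span S)"
  using assms perp_span2[of S S] span_minimal[OF assms(1) subspace_L] subspace_span
  unfolding isotropic_def by blast

lemma isotropic_basis:
  assumes "isotropic W" "dim W = r" "0 < r"
  obtains w where "indep_on {..<r} w" "span (w ` {..<r}) = W" "\<And>a. a < r \<Longrightarrow> w a \<in> W"
    "\<And>a. a < r \<Longrightarrow> w a \<in> L"
proof -
  obtain w where w: "indep_on {..<r} w" "span (w ` {..<r}) = W"
    using basis_family[OF isotropicD(1)[OF assms(1)] assms(2,3)] .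
  then have "w a \<in> W" if "a < r" for a using that by (auto intro: span_base)
  then show ?thesis using that w isotropicD(2)[OF assms(1)] by blast
qed

lemma dim_isotropic_le:
  assumes "isotropic W"
  shows "2 * dim W \<le> dim L"
proof (cases "dim W = 0")
  case False
  then have "0 < dim W" by simp
  then obtain w where w: "indep_on {..<dim W} w" "\<And>a. a < dim W \<Longrightarrow> w a \<in> W"
     "\<And>a. a < dim W \<Longrightarrow> w a \<in> L"
    by (rule isotropic_basis[OF assms refl]) blast
  then show ?thesis
    using card_orthogonal_le[of "{..<dim W}" "{..<dim W}" w w] isotropicD(3)[OF assms]
    by (simp add: image_subset_iff mult_2)
qed simp

text \<open>Otherwise \<open>W\<close> and \<open>x\<close> would span \<open>r + 1\<close> dimensions orthogonal to \<open>W\<close>, which is one too many.\<close>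

lemma perp_maximal_isotropic:
  assumes "isotropic W" "2 * dim W = dim L" "0 < dim W" "x \<in> L" "\<And>w. w \<in> W \<Longrightarrow> B w x = 0"
  shows "x \<in> W"
proof (rule ccontr)
  assume x: "x \<notin> W"
  let ?r = "dim W"
  obtain w where w: "indep_on {..<?r} w" "span (w ` {..<?r}) = W" "\<And>a. a < ?r \<Longrightarrow> w a \<in> W"
     "\<And>a. a < ?r \<Longrightarrow> w a \<in> L"
    by (rule isotropic_basis[OF assms(1) refl assms(3)]) blast
  have w': "inj_on w {..<?r}" "independent (w ` {..<?r})"
    using w(1) by (simp_all add: indep_on_iff)
  let ?J = "insert x (w ` {..<?r})"
  have "indep_on ?J (\<lambda>v. v)"
    using w' x w(2) by (simp add: indep_on_iff independent_insertI)
  moreover have "B (w a) v = 0" if "a < ?r" "v \<in> ?J" for a v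
    using that assms(5) w(3) isotropicD(3)[OF assms(1)] by auto
  ultimately have "card {..<?r} + card ?J \<le> dim L"
    using w assms(4) by (intro card_orthogonal_le[of _ _ w "\<lambda>v. v"]) auto
  moreover have "x \<notin> w ` {..<?r}" using x w(3) by auto
  ultimately show False using assms(2) w'(1) by (simp add: card_image)
qed

text \<open>Subtracting half of its own Gram matrix makes a dual family isotropic without disturbing the
  duality, since the \<open>w a\<close> are isotropic.\<close>

lemma hyperbolic_dual:
  assumes "indep_on {..<r::nat} w" "\<And>a. a < r \<Longrightarrow> w a \<in> L"
    and w: "\<And>a b. a < r \<Longrightarrow> b < r \<Longrightarrow> B (w a) (w b) = 0"
  obtains x where "\<And>a. a < r \<Longrightarrow> x a \<in> L"
    "\<And>a b. a < r \<Longrightarrow> b < r \<Longrightarrow> B (w a) (x b) = (if a = b then 1 else 0)"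
    "\<And>a b. a < r \<Longrightarrow> b < r \<Longrightarrow> B (x a) (x b) = 0"
    "indep_on {..<r} x"
proof -
  obtain y where yL: "\<And>a. a < r \<Longrightarrow> y a \<in> L"
    and y: "\<And>a b. a < r \<Longrightarrow> b < r \<Longrightarrow> B (w a) (y b) = (if a = b then 1 else 0)"
    using dual_family_L[OF finite_lessThan assms(1)] assms(2) by (auto simp: image_subset_iff)
  have y': "B (y b) (w a) = (if a = b then 1 else 0)" if "a < r" "b < r" for a b
    using y that B_sym by metis
  define x where "x a = y a - (\<Sum>b<r. (B (y a) (y b) / 2) *s w b)" for a
  have delta: "(\<Sum>c<r. f c * (if a = c then 1 else 0)) = f a" if "a < r" for f :: "nat \<Rightarrow> 'a" and a
    using that by (simp add: if_distrib[of "\<lambda>t. _ * t"] cong: if_cong)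
  have wx: "B (w a) (x b) = (if a = b then 1 else 0)" if "a < r" "b < r" for a b
    using that by (simp add: x_def B_simps y w)
  have xx: "B (x a) (x b) = 0" if "a < r" "b < r" for a b
  proof -
    have "B (x a) (x b) = B (y a) (x b) - (\<Sum>c<r. B (y a) (y c) / 2 * B (w c) (x b))"
      by (simp add: x_def[of a] B_diff_left B_sum_left B_scale_left)
    also have "(\<Sum>c<r. B (y a) (y c) / 2 * B (w c) (x b)) = B (y a) (y b) / 2"
    proof -
      have "(\<Sum>c<r. B (y a) (y c) / 2 * B (w c) (x b)) = (\<Sum>c<r. if c = b then B (y a) (y c) / 2 else 0)"
        using that by (intro sum.cong) (auto simp: wx)
      then show ?thesis using that by simp
    qed
    also have "B (y a) (x b) = B (y a) (y b) - (\<Sum>c<r. B (y b) (y c) / 2 * B (y a) (w c))"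
      by (simp add: x_def B_diff_right B_sum_right B_scale_right)
    also have "(\<Sum>c<r. B (y b) (y c) / 2 * B (y a) (w c)) = B (y b) (y a) / 2"
    proof -
      have "(\<Sum>c<r. B (y b) (y c) / 2 * B (y a) (w c)) = (\<Sum>c<r. if c = a then B (y b) (y c) / 2 else 0)"
        using that by (intro sum.cong) (auto simp: y')
      then show ?thesis using that by simp
    qed
    finally show ?thesis by (simp add: B_sym[of "y b" "y a"])
  qed
  have "indep_on {..<r} x"
  proof (rule indep_onI)
    fix c a assume c: "(\<Sum>a<r. c a *s x a) = 0" and a: "a \<in> {..<r}"
    have "B (w a) (\<Sum>a<r. c a *s x a) = c a"
      using a by (simp add: B_simps wx delta)
    then show "c a = 0" using c by simp
  qed
  moreover have "x a \<in> L" if "a < r" for a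
    unfolding x_def using that yL assms(2) subspace_L
    by (intro subspace_diff subspace_sum subspace_scale) auto
  ultimately show ?thesis using that wx xx by blast
qed

text \<open>Adapted bases of two isotropic subspaces: the indices below \<open>k\<close> give a common basis of the
  intersection, those from \<open>k\<close> to \<open>l\<close> the rest of the vectors orthogonal to the other subspace, and
  on those from \<open>l\<close> on the two bases are dual to each other.\<close>

definition normal_pair :: "nat \<Rightarrow> nat \<Rightarrow> nat \<Rightarrow> (nat \<Rightarrow> 'b) \<Rightarrow> (nat \<Rightarrow> 'b) \<Rightarrow> bool" where
  "normal_pair k l r w w' \<longleftrightarrow> k \<le> l \<and> l \<le> r \<and> indep_on {..<r} w \<and> indep_on {..<r} w' \<and>
     isotropic (span (w ` {..<r})) \<and> isotropic (span (w' ` {..<r})) \<and>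
     (\<forall>a<k. w a = w' a) \<and>
     (\<forall>a<r. \<forall>b<r. B (w a) (w' b) = (if a = b \<and> l \<le> a then 1 else 0)) \<and>
     span (w ` {..<r}) \<inter> span (w' ` {..<r}) = span (w ` {..<k})"

text \<open>Extend a basis of \<open>W \<inter> W'\<close> to one of \<open>N = W \<inter> W'\<^sup>\<bottom>\<close> and then of \<open>W\<close>. The last part pairs
  without kernel with \<open>W'\<close>, so it has a dual family there, which complements \<open>N' = W' \<inter> W\<^sup>\<bottom>\<close>.
  In particular \<open>N\<close> and \<open>N'\<close> have the same dimension, and the indices match.\<close>

lemma normal_pair_exists:
  assumes W: "isotropic W" "dim W = r" and W': "isotropic W'" "dim W' = r"
  obtains k l w w' where "normal_pair k l r w w'" "span (w ` {..<r}) = W" "span (w' ` {..<r}) = W'"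
proof -
  have sub: "subspace W" "subspace W'" using W W' isotropicD(1) by auto
  have TW: "W \<subseteq> span T" "W' \<subseteq> span T"
    using W(1) W'(1) isotropicD(2) L_span by blast+
  define N where "N = W \<inter> (\<Inter>y\<in>W'. {x. B x y = 0})"
  define N' where "N' = W' \<inter> (\<Inter>x\<in>W. {y. B y x = 0})"
  have N: "subspace N" "N \<subseteq> W" "subspace N'" "N' \<subseteq> W'"
    unfolding N_def N'_def using sub subspace_perp by (auto intro!: subspace_inter subspace_Int)
  have K: "subspace (W \<inter> W')" "W \<inter> W' \<subseteq> span T" "W \<inter> W' \<subseteq> N" "W \<inter> W' \<subseteq> N'"
    using sub TW W(1) W'(1) by (auto intro: subspace_inter simp: N_def N'_def isotropic_def)
  have "indep_on {..<0::nat} (\<lambda>_. 0)" by (rule indep_onI) simp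
  then obtain k :: nat and v where v: "indep_on {..<k} v" "span (v ` {..<k}) = W \<inter> W'"
    using extend_family[of 0 "\<lambda>_. 0" "W \<inter> W'" T] K(1,2) finite_T by (metis image_empty empty_subsetI lessThan_0)
  have vK: "v ` {..<k} \<subseteq> W \<inter> W'" using v(2) span_superset[of "v ` {..<k}"] by simp
  have vN: "v ` {..<k} \<subseteq> N" "v ` {..<k} \<subseteq> N'" using subset_trans[OF vK K(3)] subset_trans[OF vK K(4)] by simp_all
  have NT: "N \<subseteq> span T" "N' \<subseteq> span T" using subset_trans[OF N(2) TW(1)] subset_trans[OF N(4) TW(2)] by simp_all
  obtain l :: nat and p where p: "k \<le> l" "\<And>a. a < k \<Longrightarrow> p a = v a" "indep_on {..<l} p" "span (p ` {..<l}) = N"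
    by (rule extend_family[OF v(1) vN(1) N(1) finite_T NT(1)]) blast
  have pW: "p ` {..<l} \<subseteq> W" using p(4) N(2) span_superset[of "p ` {..<l}"] by simp
  obtain q :: nat and w where w: "l \<le> q" "\<And>a. a < l \<Longrightarrow> w a = p a" "indep_on {..<q} w" "span (w ` {..<q}) = W"
    by (rule extend_family[OF p(3) pW sub(1) finite_T TW(1)]) blast
  have "q = r" using dim_span_indep_on[OF _ w(3)] w(4) W(2) by simp
  note w = w[unfolded this]
  obtain l' :: nat and p' where p': "k \<le> l'" "\<And>a. a < k \<Longrightarrow> p' a = v a" "indep_on {..<l'} p'" "span (p' ` {..<l'}) = N'"
    by (rule extend_family[OF v(1) vN(2) N(3) finite_T NT(2)]) blast
  have wW: "w a \<in> W" if "a < r" for a using that w(4) span_base[of "w a" "w ` {..<r}"] by simp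
  have wN: "w a \<in> N" if "a < l" for a using that w(2) p(4) span_base[of "p a" "p ` {..<l}"] by simp
  have p'N: "p' a \<in> N'" if "a < l'" for a using that p'(4) span_base[of "p' a" "p' ` {..<l'}"] by simp
  \<comment> \<open>the remaining basis vectors of \<open>W\<close> pair perfectly with a complement of \<open>N'\<close>\<close>
  have "\<exists>f. (\<forall>a\<in>{l..<r}. f a \<in> W') \<and>
      (\<forall>a\<in>{l..<r}. \<forall>b\<in>{l..<r}. B (w a) (f b) = (if a = b then 1 else 0))"
  proof (rule dual_family[OF _ _ sub(2)])
    show "indep_on {l..<r} w" using w(3) by (rule indep_on_subset) auto
    fix u assume u: "u \<in> span (w ` {l..<r})" "u \<noteq> 0"
    show "\<exists>y\<in>W'. B u y \<noteq> 0"
    proof (rule ccontr)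
      assume "\<not> (\<exists>y\<in>W'. B u y \<noteq> 0)"
      moreover have "u \<in> W"
        using u(1) span_minimal[OF _ sub(1), of "w ` {l..<r}"] wW by (auto simp: image_subset_iff)
      ultimately have "u \<in> span (p ` {..<l})" unfolding p(4) N_def by blast
      then obtain c where c: "u = (\<Sum>a<l. c a *s p a)" by (rule in_span_familyE) simp
      obtain d where d: "u = (\<Sum>a\<in>{l..<r}. d a *s w a)" using u(1) by (rule in_span_familyE) simp
      let ?e = "\<lambda>a. if a < l then c a else - d a"
      have "(\<Sum>a<r. ?e a *s w a) = (\<Sum>a<l. ?e a *s w a) + (\<Sum>a\<in>{l..<r}. ?e a *s w a)"
        using w(1) by (subst sum.union_disjoint[symmetric]) (auto intro!: sum.cong)
      also have "(\<Sum>a<l. ?e a *s w a) = u" unfolding c by (intro sum.cong) (auto simp: w(2))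
      also have "(\<Sum>a\<in>{l..<r}. ?e a *s w a) = - u"
        unfolding d sum_negf[symmetric] by (intro sum.cong) auto
      finally have "?e a = 0" if "a < r" for a
        using indep_onD[OF w(3), of ?e a] that by auto
      then have "c a = 0" if "a < l" for a using that w(1) by (metis order_less_le_trans)
      then have "u = 0" unfolding c by (intro sum.neutral) simp
      with u(2) show False ..
    qed
  qed simp
  then obtain f where fW: "\<And>a. a \<in> {l..<r} \<Longrightarrow> f a \<in> W'" and
    f: "\<And>a b. a \<in> {l..<r} \<Longrightarrow> b \<in> {l..<r} \<Longrightarrow> B (w a) (f b) = (if a = b then 1 else 0)"
    by blast
  have wp': "B (w a) (p' b) = 0" if "a < r" "b < l'" for a b
    using p'N[OF that(2)] wW[OF that(1)] by (auto simp: N'_def B_sym)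
  have ind: "indep_on ({l..<r} <+> {..<l'}) (case_sum f p')"
    by (rule indep_on_dual_union[of _ _ _ w]) (use f p'(3) wp' in auto)
  have img: "case_sum f p' ` ({l..<r} <+> {..<l'}) = f ` {l..<r} \<union> p' ` {..<l'}"
    by (simp add: Plus_def image_Un image_image)
  have spn: "span (f ` {l..<r} \<union> p' ` {..<l'}) = W'"
  proof
    show "span (f ` {l..<r} \<union> p' ` {..<l'}) \<subseteq> W'"
      using fW p'N N(4) sub(2) by (intro span_minimal) auto
    show "W' \<subseteq> span (f ` {l..<r} \<union> p' ` {..<l'})"
    proof
      fix y assume y: "y \<in> W'"
      define g where "g = (\<Sum>a\<in>{l..<r}. B (w a) y *s f a)"
      have g: "g \<in> W'" unfolding g_def using fW sub(2) by (intro subspace_sum subspace_scale)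
      have "B (w b) (y - g) = 0" if "b < r" for b
      proof (cases "b < l")
        case True
        then show ?thesis using wN y g sub(2) by (auto simp: N_def subspace_diff)
      next
        case False
        have "B (w b) g = (\<Sum>a\<in>{l..<r}. if b = a then B (w a) y else 0)"
          unfolding g_def B_sum_right B_scale_right using that False
          by (intro sum.cong) (auto simp: f)
        then show ?thesis using that False by (simp add: B_diff_right)
      qed
      then have "B x (y - g) = 0" if "x \<in> W" for x
        using that perp_span[of "w ` {..<r}" "y - g" x] w(4) by auto
      then have "y - g \<in> N'" using y g sub(2) by (auto simp: N'_def subspace_diff B_sym)
      then have "y - g \<in> span (f ` {l..<r} \<union> p' ` {..<l'})"
        using p'(4) span_mono[of "p' ` {..<l'}" "f ` {l..<r} \<union> p' ` {..<l'}"] by blast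
      moreover have "g \<in> span (f ` {l..<r} \<union> p' ` {..<l'})"
        unfolding g_def by (intro span_sum span_scale span_base) auto
      ultimately have "(y - g) + g \<in> span (f ` {l..<r} \<union> p' ` {..<l'})" by (rule span_add)
      then show "y \<in> span (f ` {l..<r} \<union> p' ` {..<l'})" by simp
    qed
  qed
  \<comment> \<open>both subspaces have dimension \<open>r\<close>, so the two kernels of the pairing have the same dimension\<close>
  have "dim W' = card ({l..<r} <+> {..<l'})"
    using dim_span_indep_on[OF _ ind] unfolding img spn by simp
  then have l': "l' = l" using W'(2) w(1) by (simp add: card_Plus)
  define h :: "nat \<Rightarrow> nat + nat" where "h a = (if a < l then Inr a else Inl a)" for a
  define w' where "w' = case_sum f p' \<circ> h"
  have w'_eq: "w' a = (if a < l then p' a else f a)" for a by (simp add: w'_def h_def)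
  have "{..<r} = {l..<r} \<union> {..<l}" using w(1) by auto
  moreover have "h ` {l..<r} = Inl ` {l..<r}" "h ` {..<l} = Inr ` {..<l}"
    by (auto simp: h_def)
  ultimately have h: "h ` {..<r} = {l..<r} <+> {..<l'}"
    by (simp only: l' Plus_def image_Un)
  have inj: "inj_on h {..<r}" by (rule inj_onI) (simp add: h_def split: if_splits)
  have ind': "indep_on {..<r} w'"
    unfolding w'_def by (rule indep_on_comp) (use h inj ind in simp_all)
  have spn': "span (w' ` {..<r}) = W'"
    unfolding w'_def image_comp[symmetric] h img by (rule spn)
  have wk: "w a = v a" if "a < k" for a using that w(2) p(1,2) by simp
  have "normal_pair k l r w w'"
    unfolding normal_pair_def w(4) spn'
  proof (intro conjI allI impI)
    show "k \<le> l" "l \<le> r" by fact+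
    show "w a = w' a" if "a < k" for a
      using that wk p(1) p'(2) by (simp add: w'_eq)
    show "B (w a) (w' b) = (if a = b \<and> l \<le> a then 1 else 0)" if "a < r" "b < r" for a b
    proof (cases "b < l")
      case True
      then show ?thesis using wp' that by (simp add: w'_eq l')
    next
      case False
      then show ?thesis using that wN[of a] fW[of b] f[of a b] by (cases "a < l") (auto simp: w'_eq N_def)
    qed
    have "w ` {..<k} = v ` {..<k}" using wk by (intro image_cong) auto
    then show "W \<inter> W' = span (w ` {..<k})" using v(2) by simp
  qed (fact W(1) W'(1) w(3) ind')+
  then show ?thesis using that w(4) spn' by blast
qed

section \<open>Curves of isotropic subspaces\<close>

text \<open>A family of vectors, the one with index \<open>a\<close> being a binary form of degree \<open>\<delta> a\<close> in \<open>(s, t)\<close> with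
  coefficient vectors \<open>A a j\<close>.\<close>

definition pencil :: "(nat \<Rightarrow> nat) \<Rightarrow> (nat \<Rightarrow> nat \<Rightarrow> 'b) \<Rightarrow> 'a \<Rightarrow> 'a \<Rightarrow> nat \<Rightarrow> 'b" where
  "pencil \<delta> A s t a = (\<Sum>j\<le>\<delta> a. (s ^ (\<delta> a - j) * t ^ j) *s A a j)"

definition isotropic_curve :: "nat \<Rightarrow> (nat \<Rightarrow> nat) \<Rightarrow> (nat \<Rightarrow> nat \<Rightarrow> 'b) \<Rightarrow> bool" where
  "isotropic_curve r \<delta> A \<longleftrightarrow> (\<forall>s t. (s, t) \<noteq> (0, 0) \<longrightarrow>
     indep_on {..<r} (pencil \<delta> A s t) \<and> isotropic (span (pencil \<delta> A s t ` {..<r})))"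

definition joined :: "nat \<Rightarrow> 'b set \<Rightarrow> 'b set \<Rightarrow> bool" where
  "joined r W W' \<longleftrightarrow> (\<exists>\<delta> A. isotropic_curve r \<delta> A \<and>
     span (pencil \<delta> A 1 0 ` {..<r}) = W \<and> span (pencil \<delta> A 0 1 ` {..<r}) = W')"

lemma span_eq_isotropic:
  assumes "indep_on {..<r::nat} u" "\<And>a. a < r \<Longrightarrow> u a \<in> W" "isotropic W" "dim W = r"
  shows "span (u ` {..<r}) = W"
proof -
  have "W \<subseteq> span T" using isotropicD(2)[OF assms(3)] L_span by (rule subset_trans)
  then show ?thesis
    using assms isotropicD(1) finite_T by (intro span_eq_of_indep_on) auto
qed

text \<open>The curve. Basis vectors of the intersection stay fixed, and on the orthogonal part \<open>w a\<close> moves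
  linearly to \<open>w' a\<close>. On the dual part, \<open>s w a + t w' a\<close> would not be isotropic, but the two vectors
  \<open>s w a + t w' (a + 1)\<close> and \<open>s w (a + 1) - t w' a\<close> are orthogonal to each other: their two
  products cancel. If the number of dual indices is odd, the last one, \<open>m\<close>, moves along the conic
  \<open>s\<^sup>2 w m + s t z + t\<^sup>2 \<lambda> w' m\<close>, isotropic for \<open>\<lambda> = - B z z / 2\<close>. As \<open>z\<close> need not be orthogonal
  to the \<open>w' a\<close> of the orthogonal part, these are corrected by a multiple of \<open>w m\<close>. The case \<open>m = r\<close>
  is the one without conic.\<close>

lemma joined_normal_pair:
  assumes np: "normal_pair k l r w w'"
    and m: "l \<le> m" "m \<le> r" "r \<le> m + 1" "even (m - l)"
    and z: "z \<in> L" "\<And>a. a < r \<Longrightarrow> B z (w a) = 0" "\<And>a. l \<le> a \<Longrightarrow> a < r \<Longrightarrow> B z (w' a) = 0"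
      "m < r \<Longrightarrow> B z z \<noteq> 0"
  shows "joined r (span (w ` {..<r})) (span (w' ` {..<r}))"
proof -
  let ?W = "span (w ` {..<r})" and ?W' = "span (w' ` {..<r})"
  have kl: "k \<le> l" "l \<le> r" and ind: "indep_on {..<r} w" "indep_on {..<r} w'"
    and iso: "isotropic ?W" "isotropic ?W'" and wk: "\<And>a. a < k \<Longrightarrow> w' a = w a"
    and ww': "\<And>a b. a < r \<Longrightarrow> b < r \<Longrightarrow> B (w a) (w' b) = (if a = b \<and> l \<le> a then 1 else 0)"
    and K: "?W \<inter> ?W' = span (w ` {..<k})"
    using np unfolding normal_pair_def by auto
  have wW: "w a \<in> ?W" and w'W: "w' a \<in> ?W'" if "a < r" for a using that by (auto intro: span_base)
  have wL: "w a \<in> L" and w'L: "w' a \<in> L" if "a < r" for a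
    using wW[OF that] w'W[OF that] iso isotropicD(2) by blast+
  have ww: "B (w a) (w b) = 0" and w'w': "B (w' a) (w' b) = 0" if "a < r" "b < r" for a b
    using isotropicD(3)[OF iso(1) wW wW] isotropicD(3)[OF iso(2) w'W w'W] that by auto
  have w'w: "B (w' b) (w a) = (if a = b \<and> l \<le> a then 1 else 0)" if "a < r" "b < r" for a b
    using ww'[OF that] by (simp add: B_sym)
  have zw: "B (w a) z = 0" if "a < r" for a using z(2)[OF that] by (simp add: B_sym)
  have zw': "B (w' a) z = 0" if "l \<le> a" "a < r" for a using z(3)[OF that] by (simp add: B_sym)
  define lam where "lam = - B z z / 2"
  have lam: "B z z = - 2 * lam" by (simp add: lam_def)
  have lam0: "lam \<noteq> 0" if "m < r" using z(4)[OF that] by (simp add: lam_def)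
  \<comment> \<open>the multiple of \<open>w m\<close> that restores orthogonality to the conic; for \<open>m = r\<close> there is no conic and \<open>w m\<close> is meaningless\<close>
  define \<mu> where "\<mu> a = (if m < r then B z (w' a) / lam else 0)" for a
  have \<mu>: "B z (w' a) = \<mu> a * lam" "B (w' a) z = \<mu> a * lam" if "m < r" for a
    using lam0[OF that] that B_sym[of z "w' a"] by (simp_all add: \<mu>_def)
  have \<mu>m: "\<mu> a *s w m = 0" if "\<not> m < r" for a using that by (simp add: \<mu>_def)
  \<comment> \<open>\<open>\<sigma>\<close> exchanges the two members of each pair of dual indices, and \<open>\<epsilon>\<close> is the sign\<close>
  define \<sigma> where "\<sigma> a = (if even (a - l) then a + 1 else a - 1)" for a
  define \<epsilon> :: "nat \<Rightarrow> 'a" where "\<epsilon> a = (if even (a - l) then 1 else - 1)" for a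
  have \<sigma>: "l \<le> \<sigma> a" "\<sigma> a < m" "\<sigma> (\<sigma> a) = a" "\<epsilon> (\<sigma> a) = - \<epsilon> a" "\<sigma> a \<noteq> a" if "l \<le> a" "a < m" for a
  proof -
    obtain i where i: "a = l + i" using \<open>l \<le> a\<close> le_Suc_ex by blast
    obtain j where j: "m = l + 2 * j" using m(1,4) by (metis evenE le_add_diff_inverse)
    have "even i \<Longrightarrow> i + 1 < 2 * j" using that i j by presburger
    then show "l \<le> \<sigma> a" "\<sigma> a < m" "\<sigma> (\<sigma> a) = a" "\<epsilon> (\<sigma> a) = - \<epsilon> a" "\<sigma> a \<noteq> a"
      using that i j by (auto simp: \<sigma>_def \<epsilon>_def Suc_diff_le elim!: oddE)
  qed
  have \<epsilon>0: "\<epsilon> a \<noteq> 0" for a by (simp add: \<epsilon>_def)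
  define \<delta> where "\<delta> a = (if a < k then 0 else if a < m then 1 else 2::nat)" for a
  define A where "A a j = (if a < k then w a
     else if a < l then (if j = 0 then w a - \<mu> a *s w m else w' a)
     else if a < m then (if j = 0 then w a else \<epsilon> a *s w' (\<sigma> a))
     else (if j = 0 then w a else if j = 1 then z else lam *s w' a))" for a and j :: nat
  let ?u = "pencil \<delta> A"
  have u1: "?u s t a = w a" if "a < k" for s t a
    using that by (simp add: pencil_def \<delta>_def A_def)
  have u2: "?u s t a = s *s (w a - \<mu> a *s w m) + t *s w' a" if "k \<le> a" "a < l" for s t a
    using that m by (simp add: pencil_def \<delta>_def A_def)
  have u3: "?u s t a = s *s w a + t *s (\<epsilon> a *s w' (\<sigma> a))" if "l \<le> a" "a < m" for s t a
    using that kl by (simp add: pencil_def \<delta>_def A_def)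
  have u4: "?u s t m = s^2 *s w m + (s * t) *s z + t^2 *s (lam *s w' m)" for s t
    using m kl by (simp add: pencil_def \<delta>_def A_def numeral_2_eq_2 atMost_Suc add_ac)
  have cases: "a < k \<or> k \<le> a \<and> a < l \<or> l \<le> a \<and> a < m \<or> a = m \<and> m < r" if "a < r" for a
    using that m by linarith
  have ltr: "a < k \<Longrightarrow> a < r" "a < l \<Longrightarrow> a < r" "a < m \<Longrightarrow> a < r" for a
    using kl m by auto
  have uL: "?u s t a \<in> L" if "a < r" for s t a
  proof -
    have "\<mu> a *s w m \<in> L"
      using \<mu>m[of a] wL[of m] subspace_L by (cases "m < r") (auto intro: subspace_scale subspace_0)
    then show ?thesis
      using cases[OF that] wL w'L z(1) \<sigma>(2) ltr subspace_L
      by (elim disjE conjE) (auto simp: u1 u2 u3 u4 intro!: subspace_add subspace_diff subspace_scale)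
  qed
  have mu0: "\<mu> a = 0" if "\<not> m < r" for a using that by (simp add: \<mu>_def)
  have wu: "B (w a) (?u s t b) = 0" if a: "a < l" and b: "b < r" for a b s t
    using cases[OF b]
  proof (elim disjE conjE)
    assume b: "b < k"
    then show ?thesis using a ltr kl by (simp add: u1 ww)
  next
    assume b: "k \<le> b" "b < l"
    then show ?thesis using a ltr(2) by (cases "m < r") (simp_all add: u2 B_simps ww ww' mu0)
  next
    assume b: "l \<le> b" "b < m"
    then show ?thesis using a ltr(2,3) \<sigma>[OF b] by (simp add: u3 B_simps ww ww')
  next
    assume b: "b = m" "m < r"
    then show ?thesis using a ltr(2) by (simp add: u4 B_simps ww ww' zw)
  qed
  have wu3: "B (w a) (?u s t b) = (if a = \<sigma> b then t * \<epsilon> b else 0)" if "a < r" "l \<le> b" "b < m" for a b s t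
    using that \<sigma>[of b] ltr(3) by (simp add: u3 B_simps ww ww')
  have wu4: "B (w a) (?u s t m) = (if a = m then t^2 * lam else 0)" if "a < r" "m < r" for a s t
    using that m(1) by (simp add: u4 B_simps ww ww' zw)
  have w'u: "B (w' a) (?u s t b) = (if b = m then s * t * (\<mu> a * lam) else 0)"
    if a: "a < l" and b: "b < r" for a b s t
    using cases[OF b]
  proof (elim disjE conjE)
    assume b: "b < k"
    then have "b \<noteq> m" "b < l" using kl m(1) by auto
    then show ?thesis using a b ltr by (simp add: u1 w'w)
  next
    assume b: "k \<le> b" "b < l"
    then have "b \<noteq> m" using m(1) by auto
    then show ?thesis using a b ltr(2) m(1)
      by (cases "m < r") (simp_all add: u2 B_simps w'w w'w' mu0)
  next
    assume b: "l \<le> b" "b < m"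
    then show ?thesis using a ltr(2,3) \<sigma>[OF b] by (simp add: u3 B_simps w'w w'w')
  next
    assume b: "b = m" "m < r"
    then show ?thesis using a ltr(2) m(1) by (simp add: u4 B_simps w'w w'w' \<mu>)
  qed
  have w'u3: "B (w' a) (?u s t b) = (if a = b then s else 0)" if "l \<le> a" "a < r" "l \<le> b" "b < m" for a b s t
    using that \<sigma>[of b] ltr(3) by (auto simp: u3 B_simps w'w' w'w)
  have w'u4: "B (w' a) (?u s t m) = (if a = m then s^2 else 0)" if "l \<le> a" "a < r" "m < r" for a s t
    using that m(1) by (simp add: u4 B_simps w'w' w'w zw')
  have uu: "B (?u s t a) (?u s t b) = 0" if ab: "a < r" "b < r" and "a \<le> b" for a b s t
    using cases[OF ab(1)]
  proof (elim disjE conjE)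
    assume "a < k" then show ?thesis using wu[of a b] ab kl by (simp add: u1)
  next
    assume a: "k \<le> a" "a < l"
    have wm: "\<mu> a * B (w m) (?u s t b) = (if b = m then \<mu> a * (t^2 * lam) else 0)"
    proof (cases "m < r")
      case True
      then show ?thesis using cases[OF ab(2)] wu3[of m b s t] wu4[of m s t] \<sigma>(2)[of b] a \<open>a \<le> b\<close> ab(2) m
        by (auto simp: u2 B_simps ww ww')
    qed (use ab m in \<open>auto simp: \<mu>_def\<close>)
    show ?thesis
      using a wu[of a b s t] w'u[of a b s t] wm ab
      by (simp add: u2 B_add_left B_diff_left B_scale_left power2_eq_square)
  next
    assume a: "l \<le> a" "a < m"
    show ?thesis
    proof (cases "b < m")
      case True
      then have "l \<le> b" using a \<open>a \<le> b\<close> by simp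
      then show ?thesis
        using a True ltr wu3[of a b s t] w'u3[of "\<sigma> a" b s t] \<sigma>[OF a] \<sigma>[of b]
        by (auto simp: u3[OF a] B_add_left B_scale_left)
    next
      case False
      then have "b = m" "m < r" using ab m by auto
      then show ?thesis
        using a ltr wu4[of a s t] w'u4[of "\<sigma> a" s t] \<sigma>[OF a]
        by (simp add: u3[OF a] B_add_left B_scale_left)
    qed
  next
    assume a: "a = m" "m < r"
    then have b: "b = m" using \<open>a \<le> b\<close> ab m by auto
    have "B z (?u s t m) = s * t * (- 2 * lam)"
      using a m z(2)[of m] z(3)[of m] by (simp add: u4 B_simps lam)
    then show ?thesis
      unfolding a b u4[of s t, THEN arg_cong[of _ _ "\<lambda>x. B x (?u s t m)"]]
      using a wu4[of m s t] w'u4[of m s t] m by (simp add: B_add_left B_scale_left power2_eq_square)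
  qed
  have uu': "B (?u s t a) (?u s t b) = 0" if ab: "a < r" "b < r" for a b s t
    using uu[OF ab] uu[OF ab(2,1)] B_sym[of "?u s t a" "?u s t b"] by (cases "a \<le> b") auto
  have uind: "indep_on {..<r} (?u s t)" if st: "(s, t) \<noteq> (0, 0)" for s t
  proof (rule indep_onI)
    fix c a assume c: "(\<Sum>a<r. c a *s ?u s t a) = 0" and a: "a \<in> {..<r}"
    have pair: "(\<Sum>a<r. c a * B x (?u s t a)) = 0" for x
      using arg_cong[OF c, of "B x"] by (simp add: B_sum_right B_scale_right)
    show "c a = 0"
    proof (cases "t = 0")
      case False
      \<comment> \<open>for \<open>t \<noteq> 0\<close>, pairing with the \<open>w\<close> isolates the coefficients of the dual part\<close>
      have c3: "c b = 0" if "l \<le> b" "b < m" for b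
      proof -
        have "(\<Sum>a<r. c a * B (w (\<sigma> b)) (?u s t a)) = (\<Sum>a<r. if a = b then c b * (t * \<epsilon> b) else 0)"
        proof (rule sum.cong)
          fix a assume "a \<in> {..<r}"
          then have "a < r" by simp
          from cases[OF this] show "c a * B (w (\<sigma> b)) (?u s t a) = (if a = b then c b * (t * \<epsilon> b) else 0)"
          proof (elim disjE conjE)
            assume "l \<le> a" "a < m"
            then show ?thesis using wu3[of "\<sigma> b" a s t] \<sigma>[OF that] \<sigma>[of a] ltr(3)[of "\<sigma> b"] by auto
          qed (use that \<sigma>[OF that] ltr kl m wu4[of "\<sigma> b" s t] \<open>a < r\<close> in
             \<open>auto simp: u1 u2 B_simps ww ww' \<mu>m \<mu>_def\<close>)
        qed simp
        then show ?thesis using pair[of "w (\<sigma> b)"] False \<epsilon>0 that ltr(3)[of b] by simp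
      qed
      have c4: "c m = 0" if "m < r"
      proof -
        have "(\<Sum>a<r. c a * B (w m) (?u s t a)) = (\<Sum>a<r. if a = m then c m * (t^2 * lam) else 0)"
        proof (rule sum.cong)
          fix a assume "a \<in> {..<r}"
          then have "a < r" by simp
          from cases[OF this] show "c a * B (w m) (?u s t a) = (if a = m then c m * (t^2 * lam) else 0)"
            using wu4[of m s t] wu3[of m a s t] \<sigma>(2)[of a] that kl m \<open>a < r\<close>
            by (elim disjE conjE) (auto simp: u1 u2 B_simps ww ww')
        qed simp
        then show ?thesis using pair[of "w m"] False lam0 that by simp
      qed
      have c34: "c b = 0" if "l \<le> b" "b < r" for b
        using c3[of b] c4 cases[OF that(2)] that kl by auto
      have split: "(\<Sum>a<l. F a) = (\<Sum>a<k. F a) + (\<Sum>a\<in>{k..<l}. F a)" for F :: "nat \<Rightarrow> 'b"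
        using sum.atLeastLessThan_concat[of 0 k l F] kl by (simp add: lessThan_atLeast0)
      define g where "g = (\<Sum>a\<in>{k..<l}. c a *s (t *s w' a))"
      have "(\<Sum>a<r. c a *s ?u s t a) = (\<Sum>a<l. c a *s ?u s t a)"
        using kl c34 by (intro sum.mono_neutral_right) auto
      also have "\<dots> = (\<Sum>a<k. c a *s w a) + (\<Sum>a\<in>{k..<l}. c a *s (s *s (w a - \<mu> a *s w m) + t *s w' a))"
        unfolding split by (intro arg_cong2[of _ _ _ _ "(+)"] sum.cong) (auto simp: u1 u2)
      also have "\<dots> = (\<Sum>a<k. c a *s w a) + (\<Sum>a\<in>{k..<l}. c a *s (s *s (w a - \<mu> a *s w m))) + g"
        by (simp add: g_def scale_right_distrib sum.distrib add.assoc)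
      finally have "(\<Sum>a<k. c a *s w a) + (\<Sum>a\<in>{k..<l}. c a *s (s *s (w a - \<mu> a *s w m))) + g = 0"
        by (simp only: c)
      from minus_unique[OF this] have g: "g = - ((\<Sum>a<k. c a *s w a) + (\<Sum>a\<in>{k..<l}. c a *s (s *s (w a - \<mu> a *s w m))))"
        by (rule sym)
      have "\<mu> a *s w m \<in> ?W" for a
        using \<mu>m[of a] wW[of m] by (cases "m < r") (auto intro: span_scale span_zero)
      then have "w a - \<mu> a *s w m \<in> ?W" if "a < l" for a
        using wW[OF ltr(2)[OF that]] by (rule span_diff[rotated])
      then have "g \<in> ?W" unfolding g using wW kl
        by (intro span_neg span_add span_sum span_scale) auto
      \<comment> \<open>so \<open>g\<close> lies in the intersection, while it is a combination of the \<open>w' a\<close> with \<open>k \<le> a\<close>\<close>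
      moreover have "g \<in> ?W'" unfolding g_def using w'W kl
        by (intro span_sum span_scale) auto
      ultimately have "g \<in> span (w ` {..<k})" using K by blast
      then obtain d where d: "g = (\<Sum>a<k. d a *s w a)" by (rule in_span_familyE) simp
      define e where "e a = (if a < k then - d a else if a < l then c a * t else 0)" for a
      have "(\<Sum>a<r. e a *s w' a) = (\<Sum>a<l. e a *s w' a)"
        using kl by (intro sum.mono_neutral_right) (auto simp: e_def)
      also have "\<dots> = (\<Sum>a<k. e a *s w' a) + (\<Sum>a\<in>{k..<l}. e a *s w' a)"
        by (rule split)
      also have "(\<Sum>a<k. e a *s w' a) = - g"
        unfolding d sum_negf[symmetric] by (intro sum.cong) (auto simp: wk e_def)
      also have "(\<Sum>a\<in>{k..<l}. e a *s w' a) = g"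
        unfolding g_def using kl by (intro sum.cong) (auto simp: e_def)
      finally have "(\<Sum>a<r. e a *s w' a) = 0" by simp
      from indep_onD[OF ind(2) this] have e: "e b = 0" if "b < r" for b using that by blast
      have c2: "c b = 0" if "k \<le> b" "b < l" for b using e[of b] that kl False by (simp add: e_def)
      have "(\<Sum>a<r. c a *s w a) = (\<Sum>a<k. c a *s w a)"
        using kl c2 c34 by (intro sum.mono_neutral_right) (auto simp: not_less, meson leI)
      also have "\<dots> = (\<Sum>a<k. c a *s ?u s t a)" by (intro sum.cong) (auto simp: u1)
      also have "\<dots> = (\<Sum>a<r. c a *s ?u s t a)"
        using kl c2 c34 by (intro sum.mono_neutral_left) (auto simp: not_less, meson leI)
      finally show ?thesis using indep_onD[OF ind(1)] c a by simp
    next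
      case True
      then have s: "s \<noteq> 0" using st by simp
      \<comment> \<open>for \<open>t = 0\<close> the family is triangular over the basis \<open>w\<close>\<close>
      define M where "M = (\<Sum>a\<in>{k..<l}. c a * s * \<mu> a)"
      let ?e = "\<lambda>a. (if a < k then c a else if a < m then s * c a else s^2 * c a - M)"
      have "(\<Sum>a<r. c a *s ?u s t a) = (\<Sum>a<r. (if a < k then c a else if a < m then s * c a else s^2 * c a) *s w a
           - (if a \<in> {k..<l} then (c a * s * \<mu> a) *s w m else 0))"
        by (intro sum.cong refl, drule lessThan_iff[THEN iffD1], drule cases)
          (use kl m in \<open>auto simp: u1 u2 u3 u4 True algebra_simps\<close>)
      also have "\<dots> = (\<Sum>a<r. (if a < k then c a else if a < m then s * c a else s^2 * c a) *s w a) - M *s w m"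
      proof -
        have "(\<Sum>a<r. if a \<in> {k..<l} then (c a * s * \<mu> a) *s w m else 0) = (\<Sum>a\<in>{k..<l}. (c a * s * \<mu> a) *s w m)"
          using kl by (intro sum.mono_neutral_cong_right) auto
        then show ?thesis unfolding sum_subtractf by (simp only: M_def scale_sum_left)
      qed
      also have "\<dots> = (\<Sum>a<r. ?e a *s w a)"
      proof (cases "m < r")
        case True
        have "(\<Sum>a<r. ?e a *s w a) = (\<Sum>a<r. (if a < k then c a else if a < m then s * c a else s^2 * c a) *s w a
           - (if a = m then M *s w m else 0))"
          using kl m by (intro sum.cong) (auto simp: scale_left_diff_distrib)
        then show ?thesis using True by (simp add: sum_subtractf)
      next
        case False
        then have "M = 0" by (simp add: M_def \<mu>_def)
        then show ?thesis by (simp cong: if_cong)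
      qed
      finally have "(\<Sum>a<r. ?e a *s w a) = 0" using c by simp
      from indep_onD[OF ind(1) this] have e: "?e b = 0" if "b < r" for b using that by blast
      have c0: "c b = 0" if "b < m" for b using e[of b] that s m by (auto split: if_splits)
      then have "M = 0" using m by (simp add: M_def)
      then show ?thesis using c0[of a] e[of a] a s by (auto split: if_splits)
    qed
  qed
  have dims: "dim ?W = r" "dim ?W' = r"
    using dim_span_indep_on[OF _ ind(1)] dim_span_indep_on[OF _ ind(2)] by auto
  have "isotropic_curve r \<delta> A"
    unfolding isotropic_curve_def using uind uL uu' by (auto intro!: isotropic_span)
  moreover have "span (?u 1 0 ` {..<r}) = ?W"
  proof (rule span_eq_isotropic[OF uind _ iso(1) dims(1)])
    have "\<mu> a *s w m \<in> ?W" for a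
      using \<mu>m[of a] wW[of m] by (cases "m < r") (auto intro: span_scale span_zero)
    then show "?u 1 0 a \<in> ?W" if "a < r" for a
      using cases[OF that] wW that by (elim disjE conjE) (auto simp: u1 u2 u3 u4 intro!: span_diff)
  qed simp
  moreover have "span (?u 0 1 ` {..<r}) = ?W'"
  proof (rule span_eq_isotropic[OF uind _ iso(2) dims(2)])
    show "?u 0 1 a \<in> ?W'" if "a < r" for a
      using cases[OF that] w'W that ltr wk[of a] \<sigma>(2)[of a] w'W[of a]
      by (elim disjE conjE) (auto simp: u1 u2 u3 u4 intro!: span_scale)
  qed simp
  ultimately show ?thesis unfolding joined_def by blast
qed

section \<open>Joining isotropic subspaces\<close>

text \<open>Complete the dual vectors in \<open>W'\<close> to a family \<open>y\<close> dual to all of \<open>w\<close>. The span of \<open>w\<close> and \<open>y\<close> is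
  nondegenerate of dimension \<open>2 r < dim L\<close>, so its orthogonal complement is nonzero and nondegenerate
  too, and such a space contains an anisotropic vector by polarization.\<close>

lemma anisotropic_vector_exists:
  assumes np: "normal_pair k l r w w'" and r: "2 * r < dim L"
  obtains z where "z \<in> L" "\<And>a. a < r \<Longrightarrow> B z (w a) = 0"
    "\<And>a. l \<le> a \<Longrightarrow> a < r \<Longrightarrow> B z (w' a) = 0" "B z z \<noteq> 0"
proof -
  let ?W = "span (w ` {..<r})" and ?W' = "span (w' ` {..<r})"
  have ind: "indep_on {..<r} w"
    and iso: "isotropic ?W" "isotropic ?W'"
    and ww': "\<And>a b. a < r \<Longrightarrow> b < r \<Longrightarrow> B (w a) (w' b) = (if a = b \<and> l \<le> a then 1 else 0)"
    using np unfolding normal_pair_def by auto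
  have wW: "w a \<in> ?W" and w'W: "w' a \<in> ?W'" if "a < r" for a using that by (auto intro: span_base)
  have wL: "w a \<in> L" and w'L: "w' a \<in> L" if "a < r" for a
    using wW[OF that] w'W[OF that] iso isotropicD(2) by blast+
  have ww: "B (w a) (w b) = 0" if "a < r" "b < r" for a b
    using isotropicD(3)[OF iso(1) wW wW] that by auto
  obtain x where x: "\<And>a. a \<in> {..<r} \<Longrightarrow> x a \<in> L"
    "\<And>a b. a \<in> {..<r} \<Longrightarrow> b \<in> {..<r} \<Longrightarrow> B (w a) (x b) = (if a = b then 1 else 0)"
    using wL by (elim dual_family_L[OF finite_lessThan ind, rotated]) auto
  define y where "y a = (if l \<le> a then w' a else x a)" for a
  have yL: "y a \<in> L" if "a < r" for a using that w'L x(1) by (simp add: y_def)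
  have wy: "B (w a) (y b) = (if a = b then 1 else 0)" if "a < r" "b < r" for a b
    using that ww' x(2) by (auto simp: y_def)
  have yw: "B (y b) (w a) = (if a = b then 1 else 0)" if "a < r" "b < r" for a b
    using wy[OF that] by (simp add: B_sym)
  let ?S = "w ` {..<r} \<union> y ` {..<r}"
  \<comment> \<open>orthogonal projection to the complement of the nondegenerate span of \<open>w\<close> and \<open>y\<close>\<close>
  have proj: "\<exists>p\<in>L. (\<forall>a<r. B (w a) p = 0 \<and> B (y a) p = 0) \<and> q - p \<in> span ?S" if q: "q \<in> L" for q
  proof -
    define q' where "q' = q - (\<Sum>a<r. B (w a) q *s y a)"
    define p where "p = q' - (\<Sum>a<r. B (y a) q' *s w a)"
    have delta: "(\<Sum>a<r. f a * (if b = a then 1 else 0)) = f b"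
      "(\<Sum>a<r. f a * (if a = b then 1 else 0)) = f b" if "b < r" for f :: "nat \<Rightarrow> 'a" and b
      using that by (simp_all add: if_distrib[of "\<lambda>t. _ * t"] cong: if_cong)
    have wq': "B (w b) q' = 0" if "b < r" for b
      using that by (simp add: q'_def B_diff_right B_sum_right B_scale_right wy delta)
    have "B (w b) p = 0" "B (y b) p = 0" if "b < r" for b
      using that by (simp_all add: p_def B_diff_right B_sum_right B_scale_right wq' ww yw delta)
    moreover have "p \<in> L"
      unfolding p_def q'_def using q yL wL subspace_L
      by (intro subspace_diff subspace_sum subspace_scale) auto
    moreover have "q - p = (\<Sum>a<r. B (w a) q *s y a) + (\<Sum>a<r. B (y a) q' *s w a)"
      by (simp add: p_def q'_def)
    then have "q - p \<in> span ?S"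
      by (auto intro!: span_add span_sum span_scale intro: span_base)
    ultimately show ?thesis by blast
  qed
  have "card ?S < dim L"
    using card_Un_le[of "w ` {..<r}" "y ` {..<r}"] card_image_le[of "{..<r}" w]
      card_image_le[of "{..<r}" y] r by simp
  moreover have "finite ?S" by simp
  ultimately have "\<not> L \<subseteq> span ?S" using dim_le_card[of L ?S] by auto
  then obtain v where v: "v \<in> L" "v \<notin> span ?S" by blast
  from proj[OF v(1)] obtain p where p: "p \<in> L" "\<forall>a<r. B (w a) p = 0 \<and> B (y a) p = 0" "v - p \<in> span ?S"
    by blast
  have "p \<noteq> 0" using p(3) v(2) by auto
  then obtain q where q: "q \<in> L" "B p q \<noteq> 0" using nondegenerate p(1) by blast
  from proj[OF q(1)] obtain p' where p': "p' \<in> L" "\<forall>a<r. B (w a) p' = 0 \<and> B (y a) p' = 0" "q - p' \<in> span ?S"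
    by blast
  have "B (q - p') p = 0" by (rule perp_span[OF _ p'(3)]) (use p(2) in auto)
  then have pp': "B p p' \<noteq> 0" using q(2) by (simp add: B_diff_right B_sym[of _ p])
  note result = that
  have good: thesis if z: "z \<in> L" "\<forall>a<r. B (w a) z = 0 \<and> B (y a) z = 0" "B z z \<noteq> 0" for z
  proof (rule result)
    show "B z (w a) = 0" if "a < r" for a using z(2) that by (simp add: B_sym[of z])
    show "B z (w' a) = 0" if "l \<le> a" "a < r" for a
    proof -
      have "B z (y a) = 0" using z(2) that by (simp add: B_sym[of z])
      then show ?thesis using that by (simp add: y_def)
    qed
  qed fact+
  have "B (p + p') (p + p') = B p p + 2 * B p p' + B p' p'"
    by (simp add: B_add_left B_add_right B_sym[of p' p])
  then have "B p p \<noteq> 0 \<or> B p' p' \<noteq> 0 \<or> B (p + p') (p + p') \<noteq> 0"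
    using pp' by auto
  then show thesis
    using good[of p] good[of p'] good[of "p + p'"] p p' subspace_L
    by (auto simp: B_add_right subspace_add)
qed

lemma normal_pair_dim_Int:
  "normal_pair k l r w w' \<Longrightarrow> dim (span (w ` {..<r}) \<inter> span (w' ` {..<r})) = k"
  using indep_on_subset[of "{..<r}" w "{..<k}"] dim_span_indep_on[of "{..<k}" w]
  by (auto simp: normal_pair_def)

text \<open>A maximal isotropic subspace is its own orthogonal complement, so the orthogonal part is empty.\<close>

lemma normal_pair_maximal:
  assumes np: "normal_pair k l r w w'" and r: "2 * r = dim L" "0 < r"
  shows "l = k"
proof (rule ccontr)
  let ?W = "span (w ` {..<r})" and ?W' = "span (w' ` {..<r})"
  have kl: "k \<le> l" "l \<le> r" and ind: "indep_on {..<r} w" "indep_on {..<r} w'"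
    and iso: "isotropic ?W" "isotropic ?W'"
    and ww': "\<And>a b. a < r \<Longrightarrow> b < r \<Longrightarrow> B (w a) (w' b) = (if a = b \<and> l \<le> a then 1 else 0)"
    and K: "?W \<inter> ?W' = span (w ` {..<k})"
    using np unfolding normal_pair_def by auto
  assume "l \<noteq> k"
  then have k: "k < l" "k < r" using kl by auto
  have wW: "w k \<in> ?W" using k by (auto intro: span_base)
  have wk: "B (w' b) (w k) = 0" if "b < r" for b using ww'[of k b] k that by (simp add: B_sym)
  have "B u (w k) = 0" if "u \<in> ?W'" for u
    by (rule perp_span[OF _ that]) (use wk in auto)
  moreover have "w k \<in> L" "dim ?W' = r"
    using wW isotropicD(2)[OF iso(1)] dim_span_indep_on[OF _ ind(2)] by auto
  ultimately have "w k \<in> ?W'"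
    using r by (intro perp_maximal_isotropic[OF iso(2)]) simp_all
  then have "w k \<in> span (w ` {..<k})" using wW K by blast
  moreover have "w k \<notin> span (w ` {..<k})"
    using k by (intro indep_on_notin_span[OF ind(1), of "{..<k}" k]) auto
  ultimately show False by blast
qed

text \<open>The number of dual indices is \<open>r - l\<close>. If it is odd, then \<open>2 r = dim L\<close> is impossible by the
  hypothesis, since there \<open>l = k = dim (W \<inter> W')\<close>; so the anisotropic vector for the conic exists.\<close>

theorem isotropic_joined:
  assumes W: "isotropic W" "dim W = r" and W': "isotropic W'" "dim W' = r" and r: "0 < r"
    and par: "2 * r < dim L \<or> even (r - dim (W \<inter> W'))"
  shows "joined r W W'"
proof -
  obtain k l w w' where np: "normal_pair k l r w w'"
    and sp: "span (w ` {..<r}) = W" "span (w' ` {..<r}) = W'"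
    by (rule normal_pair_exists[OF W W']) blast
  have lr: "l \<le> r" using np by (simp add: normal_pair_def)
  show ?thesis
  proof (cases "even (r - l)")
    case True
    then have "joined r (span (w ` {..<r})) (span (w' ` {..<r}))"
      using lr subspace_0[OF subspace_L] by (intro joined_normal_pair[OF np, of r 0]) auto
    then show ?thesis by (simp add: sp)
  next
    case False
    have "2 * r < dim L"
    proof (rule ccontr)
      assume "\<not> 2 * r < dim L"
      then have "2 * r = dim L" "even (r - dim (W \<inter> W'))"
        using par dim_isotropic_le[OF W(1)] W(2) by auto
      then show False
        using normal_pair_maximal[OF np _ r] normal_pair_dim_Int[OF np] False by (simp add: sp)
    qed
    then obtain z where "z \<in> L" "\<And>a. a < r \<Longrightarrow> B z (w a) = 0"
      "\<And>a. l \<le> a \<Longrightarrow> a < r \<Longrightarrow> B z (w' a) = 0" "B z z \<noteq> 0"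
      by (rule anisotropic_vector_exists[OF np]) blast
    moreover have "l \<le> r - 1" "even (r - 1 - l)"
      using False lr by (cases "l = r"; simp; presburger)+
    ultimately have "joined r (span (w ` {..<r})) (span (w' ` {..<r}))"
      by (intro joined_normal_pair[OF np, of "r - 1" z]) auto
    then show ?thesis by (simp add: sp)
  qed
qed

text \<open>Replace two basis vectors by their isotropic dual vectors; exchanging two of them keeps the parity.\<close>

lemma isotropic_partner:
  assumes W: "isotropic W" "dim W = r" and r: "2 \<le> r"
  obtains W' where "isotropic W'" "dim W' = r" "W' \<noteq> W" "even (r - dim (W \<inter> W'))"
proof -
  obtain w where w: "indep_on {..<r} w" "span (w ` {..<r}) = W" "\<And>a. a < r \<Longrightarrow> w a \<in> W"
     "\<And>a. a < r \<Longrightarrow> w a \<in> L"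
    using r by (elim isotropic_basis[OF W, rotated]) auto
  have ww: "B (w a) (w b) = 0" if "a < r" "b < r" for a b
    using isotropicD(3)[OF W(1)] w(3) that by blast
  obtain x where x: "\<And>a. a < r \<Longrightarrow> x a \<in> L"
    "\<And>a b. a < r \<Longrightarrow> b < r \<Longrightarrow> B (w a) (x b) = (if a = b then 1 else 0)"
    "\<And>a b. a < r \<Longrightarrow> b < r \<Longrightarrow> B (x a) (x b) = 0"
    "indep_on {..<r} x"
    by (rule hyperbolic_dual[OF w(1,4) ww]) auto
  have xw: "B (x b) (w a) = (if a = b then 1 else 0)" if "a < r" "b < r" for a b
    using x(2)[OF that] by (simp add: B_sym)
  define v where "v a = (if a < 2 then x a else w a)" for a
  have v0: "c a = 0" if "a < 2" "(\<Sum>b<r. c b *s v b) \<in> W" for c a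
  proof -
    have "(\<Sum>b<r. c b * B (w a) (v b)) = (\<Sum>b<r. if a = b then c b else 0)"
      using that(1) r by (intro sum.cong) (auto simp: v_def x(2) ww)
    then have "B (w a) (\<Sum>b<r. c b *s v b) = c a"
      using that(1) r by (simp add: B_sum_right B_scale_right)
    then show ?thesis using isotropicD(3)[OF W(1) w(3) that(2)] that(1) r by simp
  qed
  have split: "(\<Sum>b<r. c b *s v b) = (\<Sum>b\<in>{2..<r}. c b *s w b)" if "\<And>a. a < 2 \<Longrightarrow> c a = 0" for c
    using that by (intro sum.mono_neutral_cong_right) (auto simp: v_def)
  have ind2: "indep_on {2..<r} w" using w(1) by (rule indep_on_subset) auto
  have ind: "indep_on {..<r} v"
  proof (rule indep_onI)
    fix c a assume c: "(\<Sum>b<r. c b *s v b) = 0" and a: "a \<in> {..<r}"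
    have c0: "c b = 0" if "b < 2" for b
      using that by (rule v0) (simp add: c subspace_0 isotropicD(1)[OF W(1)])
    then have "(\<Sum>b\<in>{2..<r}. c b *s w b) = 0" using c split by simp
    then show "c a = 0" using c0 a indep_onD[OF ind2, of c a] by (cases "a < 2") auto
  qed
  have iso: "isotropic (span (v ` {..<r}))"
    by (rule isotropic_span) (use x w r in \<open>auto simp: v_def xw ww\<close>)
  have Int: "W \<inter> span (v ` {..<r}) = span (w ` {2..<r})"
  proof
    show "W \<inter> span (v ` {..<r}) \<subseteq> span (w ` {2..<r})"
    proof
      fix u assume u: "u \<in> W \<inter> span (v ` {..<r})"
      then obtain c where c: "u = (\<Sum>b<r. c b *s v b)" by (elim IntE in_span_familyE) simp
      have "c a = 0" if "a < 2" for a using that u by (intro v0) (auto simp: c)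
      then have "u = (\<Sum>b\<in>{2..<r}. c b *s w b)" unfolding c by (rule split)
      then show "u \<in> span (w ` {2..<r})" by (auto intro!: span_sum span_scale intro: span_base)
    qed
    show "span (w ` {2..<r}) \<subseteq> W \<inter> span (v ` {..<r})"
    proof (rule span_minimal)
      have "w a \<in> span (v ` {..<r})" if "a \<in> {2..<r}" for a
        using that by (intro span_base image_eqI[of _ _ a]) (auto simp: v_def)
      then show "w ` {2..<r} \<subseteq> W \<inter> span (v ` {..<r})" using w(3) by auto
    qed (use isotropicD(1)[OF W(1)] subspace_inter in auto)
  qed
  then have d: "dim (W \<inter> span (v ` {..<r})) = r - 2"
    using dim_span_indep_on[OF _ ind2] by simp
  moreover have "span (v ` {..<r}) \<noteq> W" using d W(2) r by auto
  ultimately show thesis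
    using that[OF iso] dim_span_indep_on[OF _ ind] r by auto
qed

section \<open>The parity of maximal isotropic subspaces\<close>

text \<open>Neighbouring maximal isotropic subspaces \<open>V = H + e\<close> and \<open>V' = H + f\<close>. The image of
  \<open>U \<inter> H\<^sup>\<bottom>\<close> in the hyperbolic plane \<open>H\<^sup>\<bottom> / H\<close> is one of its two isotropic lines. So exactly one of \<open>V\<close>
  and \<open>V'\<close> has a vector of \<open>U\<close> outside \<open>H\<close>, and this adds 1 to the dimension of its intersection
  with \<open>U\<close>.\<close>

lemma isotropic_flip:
  assumes U: "isotropic U" "2 * dim U = dim L" "0 < dim U"
    and V: "isotropic (span (insert e S))" "2 * dim (span (insert e S)) = dim L"
    and V': "isotropic (span (insert f S))" "2 * dim (span (insert f S)) = dim L"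
    and ef: "B e f = 1"
  shows "odd (dim (U \<inter> span (insert e S)) + dim (U \<inter> span (insert f S)))"
proof -
  let ?H = "span S" and ?V = "span (insert e S)" and ?V' = "span (insert f S)"
  have sU: "subspace U" using isotropicD(1)[OF U(1)] .
  have H: "?H \<subseteq> ?V" "?H \<subseteq> ?V'" by (intro span_mono subset_insertI)+
  have ein: "e \<in> ?V" "f \<in> ?V'" by (auto intro: span_base)
  have perp: "B e h = 0" "B f h = 0" "B h e = 0" "B h f = 0" "B e e = 0" "B f f = 0"
    if "h \<in> ?H" for h
    using isotropicD(3)[OF V(1)] isotropicD(3)[OF V'(1)] H ein that by blast+
  have HH: "B h h' = 0" if "h \<in> ?H" "h' \<in> ?H" for h h'
    using isotropicD(3)[OF V(1)] H that by blast
  have fe: "B f e = 1" using ef by (simp add: B_sym)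
  have UT: "U \<inter> ?H \<subseteq> span T" using isotropicD(2)[OF U(1)] L_span by blast
  have step: "dim (U \<inter> span (insert g S)) = dim (U \<inter> ?H) + (if U \<inter> span (insert g S) \<subseteq> ?H then 0 else 1)" for g
  proof (cases "U \<inter> span (insert g S) \<subseteq> ?H")
    case True
    moreover have "?H \<subseteq> span (insert g S)" by (intro span_mono subset_insertI)+
    ultimately have "U \<inter> span (insert g S) = U \<inter> ?H" by blast
    then show ?thesis using True by simp
  next
    case False
    then obtain u where u: "u \<in> U" "u \<in> span (insert g S)" "u \<notin> ?H" by blast
    from u(2) obtain b where b: "u - b *s g \<in> ?H" by (auto simp: span_insert)
    have "b \<noteq> 0" using b u(3) by auto
    have "U \<inter> span (insert g S) = span (insert u (U \<inter> ?H))"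
    proof
      show "U \<inter> span (insert g S) \<subseteq> span (insert u (U \<inter> ?H))"
      proof
        fix y assume y: "y \<in> U \<inter> span (insert g S)"
        then obtain a where a: "y - a *s g \<in> ?H" by (auto simp: span_insert)
        have eq: "y - (a / b) *s u = (y - a *s g) - (a / b) *s (u - b *s g)"
          using \<open>b \<noteq> 0\<close> by (simp add: scale_right_diff_distrib)
        have "y - (a / b) *s u \<in> ?H" unfolding eq by (intro span_diff span_scale a b)
        moreover have "y - (a / b) *s u \<in> U"
          using y u(1) sU by (auto intro: subspace_diff subspace_scale)
        ultimately have "y - (a / b) *s u \<in> span (U \<inter> ?H)" by (auto intro: span_base)
        then show "y \<in> span (insert u (U \<inter> ?H))" by (auto simp: span_insert)
      qed
      have "?H \<subseteq> span (insert g S)" by (intro span_mono subset_insertI)+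
      then show "span (insert u (U \<inter> ?H)) \<subseteq> U \<inter> span (insert g S)"
        using u sU by (intro span_minimal subspace_inter) auto
    qed
    moreover have "u \<notin> U \<inter> ?H" using u by blast
    ultimately show ?thesis
      using dim_insert_subspace[OF subspace_inter[OF sU subspace_span] UT finite_T] False by simp
  qed
  \<comment> \<open>vectors of \<open>U\<close> with components along \<open>e\<close> and along \<open>f\<close> would not be orthogonal\<close>
  have notboth: "U \<inter> ?V \<subseteq> ?H \<or> U \<inter> ?V' \<subseteq> ?H"
  proof (rule ccontr)
    assume "\<not> ?thesis"
    then have n: "\<not> U \<inter> ?V \<subseteq> ?H" "\<not> U \<inter> ?V' \<subseteq> ?H" by simp_all
    from n(1) obtain u where u: "u \<in> U" "u \<in> ?V" "u \<notin> ?H" by blast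
    from n(2) obtain u' where u': "u' \<in> U" "u' \<in> ?V'" "u' \<notin> ?H" by blast
    from u(2) obtain a where a: "u - a *s e \<in> ?H" by (auto simp: span_insert)
    from u'(2) obtain b where b: "u' - b *s f \<in> ?H" by (auto simp: span_insert)
    have "a \<noteq> 0" "b \<noteq> 0" using a b u(3) u'(3) by auto
    have "B (u - a *s e) (u' - b *s f) = 0" "B (u - a *s e) f = 0" "B e (u' - b *s f) = 0"
      using HH[OF a b] perp[OF a] perp[OF b] by auto
    then have "B u u' = a * b"
      by (simp add: B_diff_left B_diff_right B_scale_left B_scale_right ef)
    then show False using isotropicD(3)[OF U(1) u(1) u'(1)] \<open>a \<noteq> 0\<close> \<open>b \<noteq> 0\<close> by simp
  qed
  \<comment> \<open>separating \<open>e\<close> from \<open>U + H\<close> would produce a vector of \<open>U\<close> in \<open>V'\<close> but outside \<open>H\<close>\<close>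
  have some: "\<not> (U \<inter> ?V \<subseteq> ?H \<and> U \<inter> ?V' \<subseteq> ?H)"
  proof
    assume sub: "U \<inter> ?V \<subseteq> ?H \<and> U \<inter> ?V' \<subseteq> ?H"
    have "e \<notin> span (U \<union> S)"
    proof
      assume "e \<in> span (U \<union> S)"
      then obtain u h where uh: "e = u + h" "u \<in> span U" "h \<in> ?H" by (auto simp: span_Un)
      have uU: "u \<in> U" using uh(2) sU by (metis span_eq_iff)
      have "u = e - h" by (simp add: uh(1))
      then have "u \<in> ?V" using ein(1) uh(3) H(1) by (auto intro!: span_diff)
      then have "u \<in> ?H" using sub uU by blast
      then have "e \<in> ?H" unfolding uh(1) using uh(3) by (rule span_add)
      then show False using perp(4) ef by simp
    qed
    moreover have "insert e S \<subseteq> L"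
      using subset_trans[OF span_superset isotropicD(2)[OF V(1)]] .
    moreover have "U \<union> S \<subseteq> L" "e \<in> L" using isotropicD(2)[OF U(1)] calculation(2) by simp_all
    ultimately obtain x where x: "x \<in> L" "\<And>v. v \<in> span (U \<union> S) \<Longrightarrow> B v x = 0" "B e x = 1"
      using separate_point[of "U \<union> S" e] by metis
    have Us: "U \<subseteq> span (U \<union> S)" "?H \<subseteq> span (U \<union> S)"
      using span_superset[of "U \<union> S"] span_mono[of S "U \<union> S"] by auto
    have xU: "x \<in> U" using x(1,2) Us(1) by (intro perp_maximal_isotropic[OF U]) blast+
    have xH: "B h x = 0" if "h \<in> ?H" for h using x(2) Us(2) that by blast
    have xf: "B x e = 1" using x(3) by (simp add: B_sym)
    have "0 \<in> ?H" by (rule span_zero)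
    note ee = perp(5)[OF this] perp(6)[OF this]
    define g where "g = x - B f x *s e - f"
    have ge: "B e g = 0" "B f g = 0"
      by (simp_all add: g_def B_diff_right B_scale_right x(3) ee ef fe)
    have gH: "B h g = 0" if "h \<in> ?H" for h
      using perp[OF that] xH[OF that] by (simp add: g_def B_diff_right B_scale_right)
    have gL: "g \<in> L" unfolding g_def
      using x(1) ein isotropicD(2)[OF V(1)] isotropicD(2)[OF V'(1)] subspace_L
      by (intro subspace_diff subspace_scale) auto
    have dpos: "0 < dim ?V" "0 < dim ?V'" using U(2,3) V(2) V'(2) by linarith+
    have "g \<in> ?V"
    proof (rule perp_maximal_isotropic[OF V dpos(1) gL])
      show "B w g = 0" if "w \<in> ?V" for w
        by (rule perp_span[of "insert e S"]) (use that ge gH span_base in auto)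
    qed
    have "g \<in> ?V'"
    proof (rule perp_maximal_isotropic[OF V' dpos(2) gL])
      show "B w g = 0" if "w \<in> ?V'" for w
        by (rule perp_span[of "insert f S"]) (use that ge gH span_base in auto)
    qed
    have "B g g = 0" using isotropicD(3)[OF V(1) \<open>g \<in> ?V\<close> \<open>g \<in> ?V\<close>] .
    have x_eq: "x = g + B f x *s e + f" by (simp add: g_def)
    have "B x x = 0" using isotropicD(3)[OF U(1) xU xU] .
    moreover have "B x x = B x g + B f x * B x e + B x f"
      by (subst (2) x_eq) (simp only: B_add_right B_scale_right)
    moreover have "B x g = 0"
      by (subst x_eq) (simp add: B_add_left B_scale_left ge \<open>B g g = 0\<close>)
    ultimately have "B f x = 0" using xf by (simp add: B_sym[of x f])
    then have "x = g + f" using x_eq by simp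
    then have "x \<in> ?V'" using \<open>g \<in> ?V'\<close> ein(2) by (auto intro: span_add)
    then have "x \<in> ?H" using sub xU by blast
    then show False using perp(1) x(3) by simp
  qed
  show ?thesis using step[of e] step[of f] notboth some by auto
qed

text \<open>One reaches \<open>V'\<close> from \<open>V\<close> in \<open>r - dim (V \<inter> V')\<close> exchanges of one basis vector in the normal form,
  and each of them changes the parity of the dimension of the intersection with \<open>U\<close>.\<close>

theorem isotropic_parity:
  assumes U: "isotropic U" "dim U = r" and V: "isotropic V" "dim V = r"
    and V': "isotropic V'" "dim V' = r" and r: "2 * r = dim L" "0 < r"
  shows "even (dim (U \<inter> V) + dim (U \<inter> V') + (r - dim (V \<inter> V')))"
proof -
  obtain k l w w' where np: "normal_pair k l r w w'"
    and sp: "span (w ` {..<r}) = V" "span (w' ` {..<r}) = V'"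
    by (rule normal_pair_exists[OF V V']) blast
  note lk = normal_pair_maximal[OF np r]
  have kr: "k \<le> r" and ind: "indep_on {..<r} w" "indep_on {..<r} w'"
    and wk: "\<And>a. a < k \<Longrightarrow> w' a = w a"
    and ww': "\<And>a b. a < r \<Longrightarrow> b < r \<Longrightarrow> B (w a) (w' b) = (if a = b \<and> k \<le> a then 1 else 0)"
    using np lk unfolding normal_pair_def by auto
  have dk: "dim (V \<inter> V') = k" using normal_pair_dim_Int[OF np] by (simp add: sp)
  have wV: "w a \<in> V" "w' a \<in> V'" if "a < r" for a
    using that sp span_base[of "w a" "w ` {..<r}"] span_base[of "w' a" "w' ` {..<r}"] by auto
  have wL: "w a \<in> L" "w' a \<in> L" if "a < r" for a
    using wV[OF that] isotropicD(2) V(1) V'(1) by blast+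
  have ww: "B (w a) (w b) = 0" "B (w' a) (w' b) = 0" if "a < r" "b < r" for a b
    using isotropicD(3)[OF V(1)] isotropicD(3)[OF V'(1)] wV that by blast+
  have w'w: "B (w' b) (w a) = (if a = b \<and> k \<le> a then 1 else 0)" if "a < r" "b < r" for a b
    using ww'[OF that] by (simp add: B_sym)
  \<comment> \<open>exchange the basis vectors one at a time\<close>
  define v where "v j a = (if a < j then w' a else w a)" for j a :: nat
  have vL: "v j a \<in> L" if "a < r" for j a using wL[OF that] by (simp add: v_def)
  have vv: "B (v j a) (v j b) = 0" if "a < r" "b < r" "k \<le> j" for j a b
    using that ww ww' w'w by (auto simp: v_def)
  have vind: "indep_on {..<r} (v j)" if j: "k \<le> j" "j \<le> r" for j
  proof (rule indep_onI)
    fix c a assume c: "(\<Sum>a<r. c a *s v j a) = 0" and a: "a \<in> {..<r}"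
    have c0: "c b = 0" if b: "k \<le> b" "b < j" for b
    proof -
      have "(\<Sum>a<r. c a * B (w b) (v j a)) = (\<Sum>a<r. if b = a then c a else 0)"
        using b j by (intro sum.cong) (auto simp: v_def ww ww')
      then have "B (w b) (\<Sum>a<r. c a *s v j a) = c b"
        using b j by (simp add: B_sum_right B_scale_right)
      then show ?thesis using c by simp
    qed
    have "(\<Sum>a<r. c a *s w a) = (\<Sum>a<r. c a *s v j a)"
    proof (rule sum.cong)
      fix a assume "a \<in> {..<r}"
      show "c a *s w a = c a *s v j a"
        using c0[of a] wk[of a] by (cases "a < k"; cases "a < j") (auto simp: v_def)
    qed simp
    then show "c a = 0" using indep_onD[OF ind(1)] c a by simp
  qed
  have viso: "isotropic (span (v j ` {..<r}))" "dim (span (v j ` {..<r})) = r" if "k \<le> j" "j \<le> r" for j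
    using that vv vL dim_span_indep_on[OF _ vind] by (auto intro!: isotropic_span)
  have main: "even (dim (U \<inter> V) + dim (U \<inter> span (v j ` {..<r})) + (j - k))" if "k \<le> j" "j \<le> r" for j
    using that
  proof (induction j rule: dec_induct)
    case base
    have "v k ` {..<r} = w ` {..<r}" by (intro image_cong) (auto simp: v_def wk)
    then show ?case by (simp add: sp)
  next
    case (step j)
    let ?S = "v j ` ({..<r} - {j})"
    have "{..<r} = insert j ({..<r} - {j})" using step by auto
    then have "v i ` {..<r} = insert (v i j) (v i ` ({..<r} - {j}))" for i by (metis image_insert)
    moreover have "v (Suc j) ` ({..<r} - {j}) = ?S" by (intro image_cong) (auto simp: v_def)
    ultimately have img: "v j ` {..<r} = insert (w j) ?S" "v (Suc j) ` {..<r} = insert (w' j) ?S"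
      by (simp_all add: v_def)
    have flip: "odd (dim (U \<inter> span (insert (w j) ?S)) + dim (U \<inter> span (insert (w' j) ?S)))"
      using viso[of j] viso[of "Suc j"] step(1,2,4) U r ww'[of j j] unfolding img
      by (intro isotropic_flip) auto
    have arith: "even (x + z + Suc c)" if "even (x + y + c)" "odd (y + z)" for x y z c :: nat
      using that by auto
    have "j \<le> r" using step(4) by simp
    from arith[OF step(3)[OF this, unfolded img] flip]
    show ?case unfolding img Suc_diff_le[OF step(1)] .
  qed
  have "v r ` {..<r} = w' ` {..<r}" by (intro image_cong) (auto simp: v_def)
  then show ?thesis using main[OF kr order_refl] by (simp add: sp dk)
qed

lemma isotropic_opposite:
  assumes W: "isotropic W" "dim W = r" and r: "0 < r"
  obtains w x where "indep_on {..<r} w" "span (w ` {..<r}) = W"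
    "isotropic (span (x ` {..<r}))" "dim (span (x ` {..<r})) = r"
    "\<And>a b. a < r \<Longrightarrow> b < r \<Longrightarrow> B (w a) (x b) = (if a = b then 1 else 0)"
proof -
  obtain w where w: "indep_on {..<r} w" "span (w ` {..<r}) = W" "\<And>a. a < r \<Longrightarrow> w a \<in> W"
     "\<And>a. a < r \<Longrightarrow> w a \<in> L"
    by (rule isotropic_basis[OF W r]) blast
  have ww: "B (w a) (w b) = 0" if "a < r" "b < r" for a b
    using isotropicD(3)[OF W(1)] w(3) that by blast
  obtain x where x: "\<And>a. a < r \<Longrightarrow> x a \<in> L"
    "\<And>a b. a < r \<Longrightarrow> b < r \<Longrightarrow> B (w a) (x b) = (if a = b then 1 else 0)"
    "\<And>a b. a < r \<Longrightarrow> b < r \<Longrightarrow> B (x a) (x b) = 0"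
    "indep_on {..<r} x"
    by (rule hyperbolic_dual[OF w(1,4) ww]) auto
  have "isotropic (span (x ` {..<r}))" using x by (intro isotropic_span) auto
  then show thesis using that[OF w(1,2) _ _ x(2)] dim_span_indep_on[OF _ x(4)] by simp
qed

end

section \<open>Forms and their values\<close>

abbreviation mono_deg :: "('v \<Rightarrow>\<^sub>0 nat) \<Rightarrow> nat" where
  "mono_deg m \<equiv> \<Sum>i\<in>Poly_Mapping.keys m. Poly_Mapping.lookup m i"

abbreviation mono_eval :: "('v \<Rightarrow>\<^sub>0 nat) \<Rightarrow> ('v \<Rightarrow> complex) \<Rightarrow> complex" where
  "mono_eval m v \<equiv> \<Prod>i\<in>Poly_Mapping.keys m. v i ^ Poly_Mapping.lookup m i"

lemma mono_deg_superset:
  "finite K \<Longrightarrow> Poly_Mapping.keys m \<subseteq> K \<Longrightarrow> mono_deg m = (\<Sum>i\<in>K. Poly_Mapping.lookup m i)"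
  by (rule sum.mono_neutral_left) (auto simp: in_keys_iff)

lemma mono_eval_superset:
  "finite K \<Longrightarrow> Poly_Mapping.keys m \<subseteq> K \<Longrightarrow> mono_eval m v = (\<Prod>i\<in>K. v i ^ Poly_Mapping.lookup m i)"
  by (rule prod.mono_neutral_left) (auto simp: in_keys_iff)

lemma mono_deg_add: "mono_deg (m + m') = mono_deg m + mono_deg m'"
proof -
  let ?K = "Poly_Mapping.keys m \<union> Poly_Mapping.keys m'"
  have "mono_deg (m + m') = (\<Sum>i\<in>?K. Poly_Mapping.lookup (m + m') i)"
    by (intro mono_deg_superset keys_add) simp
  also have "\<dots> = (\<Sum>i\<in>?K. Poly_Mapping.lookup m i) + (\<Sum>i\<in>?K. Poly_Mapping.lookup m' i)"
    by (simp add: lookup_add sum.distrib)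
  also have "\<dots> = mono_deg m + mono_deg m'"
    by (intro arg_cong2[of _ _ _ _ "(+)"] mono_deg_superset[symmetric]) auto
  finally show ?thesis .
qed

lemma mono_eval_add: "mono_eval (m + m') v = mono_eval m v * mono_eval m' v"
proof -
  let ?K = "Poly_Mapping.keys m \<union> Poly_Mapping.keys m'"
  have "mono_eval (m + m') v = (\<Prod>i\<in>?K. v i ^ Poly_Mapping.lookup (m + m') i)"
    by (intro mono_eval_superset keys_add) simp
  also have "\<dots> = (\<Prod>i\<in>?K. v i ^ Poly_Mapping.lookup m i) * (\<Prod>i\<in>?K. v i ^ Poly_Mapping.lookup m' i)"
    by (simp add: lookup_add power_add prod.distrib)
  also have "\<dots> = mono_eval m v * mono_eval m' v"
    by (intro arg_cong2[of _ _ _ _ "(*)"] mono_eval_superset[symmetric]) auto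
  finally show ?thesis .
qed

lemma poly_eval_superset:
  "finite K \<Longrightarrow> Poly_Mapping.keys p \<subseteq> K \<Longrightarrow>
    poly_eval p v = (\<Sum>m\<in>K. Poly_Mapping.lookup p m * mono_eval m v)"
  unfolding poly_eval_def by (rule sum.mono_neutral_left) (auto simp: in_keys_iff)

lemma poly_eval_zero [simp]: "poly_eval 0 v = 0"
  by (simp add: poly_eval_def)

lemma poly_eval_single: "poly_eval (Poly_Mapping.single m c) v = c * mono_eval m v"
  by (simp add: poly_eval_def)

lemma poly_eval_add: "poly_eval (p + q) v = poly_eval p v + poly_eval q v"
proof -
  let ?K = "Poly_Mapping.keys p \<union> Poly_Mapping.keys q"
  have "poly_eval (p + q) v = (\<Sum>m\<in>?K. Poly_Mapping.lookup (p + q) m * mono_eval m v)"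
    by (intro poly_eval_superset keys_add) simp
  also have "\<dots> = (\<Sum>m\<in>?K. Poly_Mapping.lookup p m * mono_eval m v) + (\<Sum>m\<in>?K. Poly_Mapping.lookup q m * mono_eval m v)"
    by (simp add: lookup_add distrib_right sum.distrib)
  also have "\<dots> = poly_eval p v + poly_eval q v"
    by (intro arg_cong2[of _ _ _ _ "(+)"] poly_eval_superset[symmetric]) auto
  finally show ?thesis .
qed

lemma poly_eval_sum: "poly_eval (\<Sum>a\<in>A. f a) v = (\<Sum>a\<in>A. poly_eval (f a) v)"
  by (induction A rule: infinite_finite_induct) (auto simp: poly_eval_add)

lemma sum_of_monomials:
  "p = (\<Sum>m\<in>Poly_Mapping.keys p. Poly_Mapping.single m (Poly_Mapping.lookup p m))"
proof (rule poly_mapping_eqI)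
  fix k
  have "Poly_Mapping.lookup (\<Sum>m\<in>Poly_Mapping.keys p. Poly_Mapping.single m (Poly_Mapping.lookup p m)) k
      = (\<Sum>m\<in>Poly_Mapping.keys p. if m = k then Poly_Mapping.lookup p m else 0)"
    unfolding lookup_sum by (intro sum.cong) (auto simp: lookup_single when_def)
  then show "Poly_Mapping.lookup p k = Poly_Mapping.lookup (\<Sum>m\<in>Poly_Mapping.keys p. Poly_Mapping.single m (Poly_Mapping.lookup p m)) k"
    by (simp add: in_keys_iff)
qed

lemma poly_eval_mult: "poly_eval (p * q) v = poly_eval p v * poly_eval q v"
proof -
  have "p * q = (\<Sum>m\<in>Poly_Mapping.keys p. Poly_Mapping.single m (Poly_Mapping.lookup p m)) *
      (\<Sum>m\<in>Poly_Mapping.keys q. Poly_Mapping.single m (Poly_Mapping.lookup q m))"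
    by (simp only: sum_of_monomials[symmetric])
  also have "\<dots> = (\<Sum>m\<in>Poly_Mapping.keys p. \<Sum>m'\<in>Poly_Mapping.keys q.
      Poly_Mapping.single (m + m') (Poly_Mapping.lookup p m * Poly_Mapping.lookup q m'))"
    by (simp only: sum_product mult_single)
  finally have "poly_eval (p * q) v = (\<Sum>m\<in>Poly_Mapping.keys p. \<Sum>m'\<in>Poly_Mapping.keys q.
      (Poly_Mapping.lookup p m * mono_eval m v) * (Poly_Mapping.lookup q m' * mono_eval m' v))"
    by (simp only: poly_eval_sum poly_eval_single mono_eval_add mult_ac)
  then show ?thesis by (simp only: poly_eval_def sum_product)
qed

lemma is_form_zero: "is_form I d 0"
  by (simp add: is_form_def)

lemma is_form_add: "is_form I d p \<Longrightarrow> is_form I d q \<Longrightarrow> is_form I d (p + q)"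
  using keys_add[of p q] unfolding is_form_def by blast

lemma is_form_mult: "is_form I d p \<Longrightarrow> is_form I e q \<Longrightarrow> is_form I (d + e) (p * q)"
  unfolding is_form_def
proof
  fix m assume p: "\<forall>m\<in>Poly_Mapping.keys p. Poly_Mapping.keys m \<subseteq> I \<and> mono_deg m = d"
    and q: "\<forall>m\<in>Poly_Mapping.keys q. Poly_Mapping.keys m \<subseteq> I \<and> mono_deg m = e"
    and "m \<in> Poly_Mapping.keys (p * q)"
  then obtain a b where m: "m = a + b" "a \<in> Poly_Mapping.keys p" "b \<in> Poly_Mapping.keys q"
    using keys_mult[of p q] by blast
  then have "Poly_Mapping.keys a \<union> Poly_Mapping.keys b \<subseteq> I" "mono_deg a = d" "mono_deg b = e"
    using p q by auto
  then show "Poly_Mapping.keys m \<subseteq> I \<and> mono_deg m = d + e"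
    unfolding m(1) mono_deg_add using keys_add[of a b] by auto
qed

lemma is_form_single: "Poly_Mapping.keys m \<subseteq> I \<Longrightarrow> mono_deg m = d \<Longrightarrow> is_form I d (Poly_Mapping.single m c)"
  by (simp add: is_form_def)

text \<open>Forms are built from their values: closure of this predicate under sums and products replaces
  computations in the polynomial ring.\<close>

definition form_fun :: "'v set \<Rightarrow> nat \<Rightarrow> (('v \<Rightarrow> complex) \<Rightarrow> complex) \<Rightarrow> bool" where
  "form_fun I d g \<longleftrightarrow> (\<exists>p. is_form I d p \<and> (\<forall>v. poly_eval p v = g v))"

lemma form_fun_zero: "form_fun I d (\<lambda>_. 0)"
  unfolding form_fun_def using is_form_zero poly_eval_zero by blast

lemma form_fun_const: "form_fun I 0 (\<lambda>_. c)"
  unfolding form_fun_def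
  by (rule exI[of _ "Poly_Mapping.single 0 c"]) (simp add: is_form_single poly_eval_single)

lemma form_fun_var: "i \<in> I \<Longrightarrow> form_fun I 1 (\<lambda>v. v i)"
  unfolding form_fun_def
  by (rule exI[of _ "Poly_Mapping.single (Poly_Mapping.single i 1) 1"])
    (simp add: is_form_single poly_eval_single)

lemma form_fun_add: "form_fun I d g \<Longrightarrow> form_fun I d h \<Longrightarrow> form_fun I d (\<lambda>v. g v + h v)"
  unfolding form_fun_def using is_form_add poly_eval_add by metis

lemma form_fun_mult: "form_fun I d g \<Longrightarrow> form_fun I e h \<Longrightarrow> form_fun I (d + e) (\<lambda>v. g v * h v)"
  unfolding form_fun_def using is_form_mult poly_eval_mult by metis

lemma form_fun_sum: "(\<And>a. a \<in> A \<Longrightarrow> form_fun I d (g a)) \<Longrightarrow> form_fun I d (\<lambda>v. \<Sum>a\<in>A. g a v)"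
  by (induction A rule: infinite_finite_induct) (auto intro: form_fun_zero form_fun_add)

lemma form_fun_prod:
  "finite A \<Longrightarrow> (\<And>a. a \<in> A \<Longrightarrow> form_fun I (d a) (g a)) \<Longrightarrow> form_fun I (\<Sum>a\<in>A. d a) (\<lambda>v. \<Prod>a\<in>A. g a v)"
  by (induction A rule: finite_induct) (auto intro: form_fun_const form_fun_mult)

lemma form_fun_scale: "form_fun I d g \<Longrightarrow> form_fun I d (\<lambda>v. c * g v)"
  using form_fun_mult[OF form_fun_const] by fastforce

lemma form_fun_power: "form_fun I d g \<Longrightarrow> form_fun I (n * d) (\<lambda>v. g v ^ n)"
  by (induction n) (auto intro: form_fun_const form_fun_mult)

lemma poly_eval_polynomial_path:
  "\<exists>Q. \<forall>\<tau>. poly_eval p (\<lambda>j. poly (q j) \<tau>) = poly Q \<tau>"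
proof
  show "\<forall>\<tau>. poly_eval p (\<lambda>j. poly (q j) \<tau>) = poly (\<Sum>m\<in>Poly_Mapping.keys p.
      smult (Poly_Mapping.lookup p m) (\<Prod>i\<in>Poly_Mapping.keys m. q i ^ Poly_Mapping.lookup m i)) \<tau>"
    by (simp add: poly_eval_def poly_sum poly_prod)
qed

section \<open>Linear and quadratic forms\<close>

lemma mono_deg_Suc:
  assumes "mono_deg m = Suc d"
  obtains i m' where "i \<in> Poly_Mapping.keys m" "m = Poly_Mapping.single i 1 + m'" "mono_deg m' = d"
    "Poly_Mapping.keys m' \<subseteq> Poly_Mapping.keys m"
proof -
  have "Poly_Mapping.keys m \<noteq> {}" using assms by auto
  then obtain i where i: "i \<in> Poly_Mapping.keys m" by blast
  then have "Poly_Mapping.lookup m i > 0" by (simp add: in_keys_iff)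
  then have m: "m = Poly_Mapping.single i 1 + (m - Poly_Mapping.single i 1)"
    by (intro poly_mapping_eqI) (auto simp: lookup_add lookup_minus lookup_single when_def)
  define m' where "m' = m - Poly_Mapping.single i 1"
  have m': "m = Poly_Mapping.single i 1 + m'" using m by (simp only: m'_def)
  have "mono_deg (Poly_Mapping.single i 1 + m') = 1 + mono_deg m'"
    by (simp only: mono_deg_add) simp
  then have "mono_deg m' = d" unfolding m'[symmetric] using assms by simp
  moreover have "Poly_Mapping.keys m' \<subseteq> Poly_Mapping.keys m"
    unfolding m'_def by (auto simp: in_keys_iff lookup_minus)
  ultimately show ?thesis using that[OF i m'] by blast
qed

lemma mono_deg_0: "mono_deg m = 0 \<Longrightarrow> m = 0"
  by (metis finite_keys sum_eq_0_iff in_keys_iff keys_eq_empty all_not_in_conv)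

lemma poly_eval_partial_deriv:
  "poly_eval (partial_deriv i p) v = (\<Sum>m\<in>Poly_Mapping.keys p. Poly_Mapping.lookup p m *
     (of_nat (Poly_Mapping.lookup m i) * mono_eval (m - Poly_Mapping.single i 1) v))"
  by (simp add: partial_deriv_def poly_eval_sum poly_eval_single mult_ac)

lemma gradient_pairing:
  "(\<Sum>i\<in>I. gradient I p x i * y i) = (\<Sum>m\<in>Poly_Mapping.keys p. Poly_Mapping.lookup p m *
     (\<Sum>i\<in>I. of_nat (Poly_Mapping.lookup m i) * mono_eval (m - Poly_Mapping.single i 1) x * y i))"
proof -
  have "(\<Sum>i\<in>I. gradient I p x i * y i) = (\<Sum>i\<in>I. \<Sum>m\<in>Poly_Mapping.keys p. Poly_Mapping.lookup p m *
     (of_nat (Poly_Mapping.lookup m i) * mono_eval (m - Poly_Mapping.single i 1) x * y i))"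
    by (intro sum.cong) (simp_all add: gradient_def poly_eval_partial_deriv sum_distrib_right sum_distrib_left mult_ac)
  then show ?thesis by (simp add: sum.swap[of _ _ I] sum_distrib_left)
qed

lemma linear_form:
  assumes p: "is_form I 1 p" and I: "finite I"
  shows "gradient I p x = gradient I p 0" "poly_eval p y = (\<Sum>i\<in>I. gradient I p 0 i * y i)"
proof -
  have ex: "\<exists>a\<in>I. m = Poly_Mapping.single a 1" if "m \<in> Poly_Mapping.keys p" for m
  proof -
    have "Poly_Mapping.keys m \<subseteq> I" "mono_deg m = Suc 0" using p that by (auto simp: is_form_def)
    then show ?thesis by (metis mono_deg_Suc mono_deg_0 add.right_neutral subsetD)
  qed
  have one: "of_nat (Poly_Mapping.lookup m i) * mono_eval (m - Poly_Mapping.single i 1) u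
      = of_nat (Poly_Mapping.lookup m i)" if "m \<in> Poly_Mapping.keys p" for m i u
    using ex[OF that] by (auto simp: lookup_single when_def)
  have "poly_eval (partial_deriv i p) u = (\<Sum>m\<in>Poly_Mapping.keys p.
      Poly_Mapping.lookup p m * of_nat (Poly_Mapping.lookup m i))" for i u
    unfolding poly_eval_partial_deriv by (intro sum.cong refl arg_cong2[of _ _ _ _ "(*)"] one)
  then show "gradient I p x = gradient I p 0"
    by (simp add: gradient_def fun_eq_iff)
  have "(\<Sum>i\<in>I. of_nat (Poly_Mapping.lookup m i) * mono_eval (m - Poly_Mapping.single i 1) 0 * y i)
      = mono_eval m y" if "m \<in> Poly_Mapping.keys p" for m
  proof -
    from ex[OF that] obtain a where a: "a \<in> I" "m = Poly_Mapping.single a 1" by blast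
    have "(\<Sum>i\<in>I. of_nat (Poly_Mapping.lookup m i) * mono_eval (m - Poly_Mapping.single i 1) 0 * y i)
        = (\<Sum>i\<in>I. if i = a then y i else 0)"
      by (intro sum.cong) (auto simp: one[OF that] a(2) lookup_single when_def)
    then show ?thesis using a I by simp
  qed
  then show "poly_eval p y = (\<Sum>i\<in>I. gradient I p 0 i * y i)"
    unfolding gradient_pairing by (simp add: poly_eval_def)
qed

text \<open>A monomial of degree 2 is a product of two variables, \<open>\<alpha> m\<close> and \<open>\<beta> m\<close>, possibly equal. In these
  terms the pairing of the gradient with a vector is visibly the polar form: symmetric, bilinear, and
  twice the quadratic form on the diagonal.\<close>

lemma quadratic_form:
  assumes p: "is_form I 2 p" and I: "finite I"
  obtains \<alpha> \<beta> where
    "\<And>x y. (\<Sum>i\<in>I. gradient I p x i * y i) = (\<Sum>m\<in>Poly_Mapping.keys p. Poly_Mapping.lookup p m *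
       (x (\<beta> m) * y (\<alpha> m) + x (\<alpha> m) * y (\<beta> m)))"
    "\<And>v. poly_eval p v = (\<Sum>m\<in>Poly_Mapping.keys p. Poly_Mapping.lookup p m * (v (\<alpha> m) * v (\<beta> m)))"
proof -
  have "\<exists>a b. a \<in> I \<and> b \<in> I \<and> m = Poly_Mapping.single a 1 + Poly_Mapping.single b 1"
    if "m \<in> Poly_Mapping.keys p" for m
  proof -
    have m: "Poly_Mapping.keys m \<subseteq> I" "mono_deg m = Suc (Suc 0)"
      using p that by (auto simp: is_form_def numeral_2_eq_2)
    obtain a m' where a: "a \<in> Poly_Mapping.keys m" "m = Poly_Mapping.single a 1 + m'"
      "mono_deg m' = Suc 0" "Poly_Mapping.keys m' \<subseteq> Poly_Mapping.keys m"
      using mono_deg_Suc[OF m(2)] by blast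
    obtain b m'' where b: "b \<in> Poly_Mapping.keys m'" "m' = Poly_Mapping.single b 1 + m''"
      "mono_deg m'' = 0"
      using mono_deg_Suc[OF a(3)] by blast
    have "m'' = 0" using b(3) by (rule mono_deg_0)
    then show ?thesis using a b m(1) by auto
  qed
  then obtain \<alpha> \<beta> where ab: "\<And>m. m \<in> Poly_Mapping.keys p \<Longrightarrow> \<alpha> m \<in> I \<and> \<beta> m \<in> I \<and>
      m = Poly_Mapping.single (\<alpha> m) 1 + Poly_Mapping.single (\<beta> m) 1"
    by metis
  have ev: "mono_eval m v = v (\<alpha> m) * v (\<beta> m)" if "m \<in> Poly_Mapping.keys p" for m v
  proof -
    have "mono_eval m v = mono_eval (Poly_Mapping.single (\<alpha> m) 1 + Poly_Mapping.single (\<beta> m) 1) v"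
      using ab[OF that] by simp
    then show ?thesis unfolding mono_eval_add by simp
  qed
  have pair: "(\<Sum>i\<in>I. of_nat (Poly_Mapping.lookup m i) * mono_eval (m - Poly_Mapping.single i 1) x * y i)
      = x (\<beta> m) * y (\<alpha> m) + x (\<alpha> m) * y (\<beta> m)" if "m \<in> Poly_Mapping.keys p" for m x y
  proof -
    let ?a = "\<alpha> m" and ?b = "\<beta> m"
    have m: "m = Poly_Mapping.single ?a 1 + Poly_Mapping.single ?b 1" and abI: "?a \<in> I" "?b \<in> I"
      using ab[OF that] by auto
    have l: "Poly_Mapping.lookup m i = (if i = ?a then 1 else 0) + (if i = ?b then 1 else 0)" for i
      by (subst m) (auto simp: lookup_add lookup_single when_def)
    have "m - Poly_Mapping.single ?a 1 = Poly_Mapping.single ?b 1"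
      "m - Poly_Mapping.single ?b 1 = Poly_Mapping.single ?a 1"
      by (subst m, simp)+
    then have "of_nat (Poly_Mapping.lookup m i) * mono_eval (m - Poly_Mapping.single i 1) x * y i
        = (if i = ?a then x ?b * y i else 0) + (if i = ?b then x ?a * y i else 0)" for i
      by (auto simp: l)
    then show ?thesis using I abI by (simp add: sum.distrib)
  qed
  show ?thesis
  proof (rule that[of \<beta> \<alpha>])
    show "(\<Sum>i\<in>I. gradient I p x i * y i) = (\<Sum>m\<in>Poly_Mapping.keys p. Poly_Mapping.lookup p m *
       (x (\<beta> m) * y (\<alpha> m) + x (\<alpha> m) * y (\<beta> m)))" for x y
      unfolding gradient_pairing by (intro sum.cong refl arg_cong2[of _ _ _ _ "(*)"] pair)
    show "poly_eval p v = (\<Sum>m\<in>Poly_Mapping.keys p. Poly_Mapping.lookup p m * (v (\<alpha> m) * v (\<beta> m)))" for v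
      unfolding poly_eval_def by (intro sum.cong) (simp_all add: ev)
  qed
qed

section \<open>Coordinate spaces\<close>

interpretation cvec: vector_families "\<lambda>(c::complex) (v::'v \<Rightarrow> complex) i. c * v i"
  by unfold_locales

lemma sum_fun_apply: "(\<Sum>a\<in>A. f a) i = (\<Sum>a\<in>A. f a i)"
  by (induction A rule: infinite_finite_induct) auto

text \<open>The standard pairing on the coordinates \<open>I\<close>. As it is nondegenerate there, the lemmas on quadratic
  spaces also give dual families and dimension bounds for systems of linear equations.\<close>

definition dot :: "'v set \<Rightarrow> ('v \<Rightarrow> complex) \<Rightarrow> ('v \<Rightarrow> complex) \<Rightarrow> complex" where
  "dot I x y = (\<Sum>i\<in>I. x i * y i)"

definition unit_vec :: "'v \<Rightarrow> 'v \<Rightarrow> complex" where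
  "unit_vec i = (\<lambda>j. if j = i then 1 else 0)"

lemma subspace_coord_space: "cvec.subspace (coord_space I)"
  by (rule cvec.subspaceI) (auto simp: coord_space_def)

lemma coord_space_span:
  assumes "finite I"
  shows "coord_space I \<subseteq> cvec.span (unit_vec ` I)"
proof
  fix v assume "v \<in> coord_space I"
  then have "v = (\<Sum>i\<in>I. (\<lambda>j. v i * unit_vec i j))"
    using assms by (auto simp: fun_eq_iff sum_fun_apply unit_vec_def coord_space_def
      if_distrib[of "\<lambda>t. _ * t"] cong: if_cong)
  moreover have "(\<Sum>i\<in>I. (\<lambda>j. v i * unit_vec i j)) \<in> cvec.span (unit_vec ` I)"
    by (intro cvec.span_sum cvec.span_scale cvec.span_base) auto
  ultimately show "v \<in> cvec.span (unit_vec ` I)" by simp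
qed

lemma bilinear_form_dot: "bilinear_form (\<lambda>(c::complex) (v::'v \<Rightarrow> complex) i. c * v i) (dot I)"
proof
  fix x y z :: "'v \<Rightarrow> complex" and c
  show "dot I (x + y) z = dot I x z + dot I y z" by (simp add: dot_def distrib_right sum.distrib)
  show "dot I (\<lambda>i. c * x i) z = c * dot I x z" by (simp add: dot_def sum_distrib_left mult.assoc)
  show "dot I x y = dot I y x" by (simp add: dot_def mult.commute)
qed

lemma quadratic_space_dot:
  assumes "finite I"
  shows "quadratic_space (\<lambda>(c::complex) (v::'v \<Rightarrow> complex) i. c * v i) (dot I) (coord_space I) (unit_vec ` I)"
proof -
  interpret bilinear_form "\<lambda>(c::complex) (v::'v \<Rightarrow> complex) i. c * v i" "dot I"
    by (rule bilinear_form_dot)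
  show ?thesis
  proof
    show "cvec.subspace (coord_space I)" by (rule subspace_coord_space)
    show "finite (unit_vec ` I)" using assms by simp
    show "coord_space I \<subseteq> cvec.span (unit_vec ` I)" using assms by (rule coord_space_span)
    fix x :: "'v \<Rightarrow> complex" assume x: "x \<in> coord_space I" "x \<noteq> 0"
    then obtain i where "x i \<noteq> 0" by (auto simp: fun_eq_iff)
    then have "i \<in> I" using x by (auto simp: coord_space_def)
    have "dot I x (unit_vec i) = x i"
      using assms \<open>i \<in> I\<close> by (simp add: dot_def unit_vec_def if_distrib[of "\<lambda>t. _ * t"] cong: if_cong)
    moreover have "unit_vec i \<in> coord_space I"
      using \<open>i \<in> I\<close> by (auto simp: coord_space_def unit_vec_def)
    ultimately show "\<exists>y\<in>coord_space I. dot I x y \<noteq> 0" using \<open>x i \<noteq> 0\<close> by metis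
  qed
qed

lemma line_in_proj_space:
  "x \<in> coord_space I \<Longrightarrow> x \<noteq> 0 \<Longrightarrow> cvec.span {x} \<in> proj_space I"
  using cvec.span_minimal[of "{x}" "coord_space I"] subspace_coord_space[of I]
    cvec.dim_span_eq_card_independent[of "{x}"]
  by (auto simp: proj_space_def)

lemma proj_space_line:
  assumes "l \<in> proj_space I" "x \<in> l" "x \<noteq> 0"
  shows "l = cvec.span {x}"
proof -
  have l: "cvec.subspace l" "cvec.dim l = 1" using assms by (auto simp: proj_space_def)
  obtain w where w: "cvec.indep_on {..<1::nat} w" "cvec.span (w ` {..<1}) = l"
    using cvec.basis_family[OF l] by auto
  have "w ` {..<1} = {w 0}" by auto
  then have l_eq: "l = cvec.span {w 0}" using w(2) by simp
  with assms(2) obtain c where c: "x = (\<lambda>i. c * w 0 i)" by (auto simp: cvec.span_singleton)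
  then have "c \<noteq> 0" using assms(3) by (auto simp: fun_eq_iff)
  then have "w 0 = (\<lambda>i. (1 / c) * x i)" by (simp add: c)
  then have "w 0 \<in> cvec.span {x}" using cvec.span_scale[OF cvec.span_base[of x "{x}"], of "1/c"] by simp
  moreover have "x \<in> cvec.span {w 0}" using assms(2) l_eq by simp
  ultimately show ?thesis unfolding l_eq by (simp add: cvec.span_eq)
qed

lemma proj_space_nonzero:
  assumes "l \<in> proj_space I"
  obtains x where "x \<in> l" "x \<noteq> 0" "x \<in> coord_space I" "l = cvec.span {x}"
proof -
  have l: "cvec.subspace l" "cvec.dim l = 1" "l \<subseteq> coord_space I" using assms by (auto simp: proj_space_def)
  have "l \<noteq> {0}"
  proof
    assume "l = {0}"
    then have "cvec.dim l \<le> card ({}::('a \<Rightarrow> complex) set)" by (intro cvec.dim_le_card) auto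
    then show False using l by simp
  qed
  then obtain x where "x \<in> l" "x \<noteq> 0" using cvec.subspace_0[OF l(1)] by blast
  then show thesis using that l(3) proj_space_line[OF assms] by blast
qed

lemma poly_eval_scale:
  assumes "is_form I d p"
  shows "poly_eval p (\<lambda>i. c * v i) = c ^ d * poly_eval p v"
proof -
  have "(\<Prod>i\<in>Poly_Mapping.keys m. (c * v i) ^ Poly_Mapping.lookup m i) = c ^ d * mono_eval m v"
    if "m \<in> Poly_Mapping.keys p" for m
    using that assms by (simp add: is_form_def power_mult_distrib prod.distrib power_sum[symmetric])
  then show ?thesis
    unfolding poly_eval_def sum_distrib_left by (intro sum.cong) (simp_all add: mult_ac)
qed

lemma in_zero_locus_line:
  assumes "is_form I d p" "x \<in> coord_space I" "x \<noteq> 0"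
  shows "cvec.span {x} \<in> zero_locus I {p} \<longleftrightarrow> poly_eval p x = 0"
  using assms line_in_proj_space[OF assms(2,3)] cvec.span_base[of x "{x}"]
  by (auto simp: zero_locus_def cvec.span_singleton poly_eval_scale)

text \<open>The constant form 1 of degree 0 has no zeros, so the whole space is a basic open set.\<close>

lemma topspace_zariski: "topspace (zariski I) = proj_space I"
proof
  show "topspace (zariski I) \<subseteq> proj_space I" by (auto simp: zariski_def)
  have "zero_locus I {1} = {}"
  proof -
    have "poly_eval (1 :: 'a cpoly) v = 1" for v
      using poly_eval_single[of 0 1 v] by (simp add: single_one)
    then have "\<forall>l\<in>proj_space I. \<exists>v\<in>l. poly_eval (1 :: 'a cpoly) v \<noteq> 0"
      by (metis proj_space_nonzero zero_neq_one)
    then show ?thesis by (auto simp: zero_locus_def)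
  qed
  moreover have "is_form I 0 (1 :: 'a cpoly)" by (simp add: is_form_def)
  ultimately have "proj_space I \<in> {proj_space I - zero_locus I {p} | p d. is_form I d p}"
    by (smt (verit) Diff_empty mem_Collect_eq)
  then show "proj_space I \<subseteq> topspace (zariski I)" by (auto simp: zariski_def)
qed

lemma openin_zariski_basic:
  "is_form I d p \<Longrightarrow> openin (zariski I) (proj_space I - zero_locus I {p})"
  unfolding zariski_def by (rule topology_generated_by_Basis) blast

section \<open>Pluecker coordinates\<close>

lemma pluecker_coords_in: "pluecker_coords k n w \<in> coord_space (pluecker_index k n)"
  by (auto simp: pluecker_coords_def coord_space_def)

text \<open>A choice of \<open>k + 1\<close> columns is either not injective, and the minor vanishes, or a permutation of an
  increasing choice, and the minor is a Pluecker coordinate up to sign.\<close>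

lemma column_selection_form:
  assumes f: "f \<in> {0..<k+1} \<rightarrow> {..n}"
  shows "\<exists>g. form_fun (pluecker_index k n) 1 g \<and>
    (\<forall>v. g (pluecker_coords k n v) = det (mat (k+1) (k+1) (\<lambda>(a, b). v a (f b))))"
proof (cases "inj_on f {0..<k+1}")
  case False
  then obtain i j where ij: "i < k+1" "j < k+1" "i \<noteq> j" "f i = f j"
    by (auto simp: inj_on_def)
  have "det (mat (k+1) (k+1) (\<lambda>(a, b). v a (f b))) = 0" for v :: "nat \<Rightarrow> nat \<Rightarrow> complex"
    using ij by (intro det_identical_columns[of _ "k+1" i j]) (auto intro!: eq_vecI)
  then show ?thesis using form_fun_zero by auto
next
  case True
  let ?N = "k + 1"
  define J where "J = f ` {0..<?N}"
  define ls where "ls = sorted_list_of_set J"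
  have J: "finite J" "card J = ?N" "J \<subseteq> {..n}"
    using True f by (auto simp: J_def card_image)
  then have JI: "J \<in> pluecker_index k n" by (simp add: pluecker_index_def)
  have ls: "length ls = ?N" "set ls = J" "distinct ls"
    using J by (simp_all add: ls_def)
  have "bij_betw (\<lambda>i. ls ! i) {0..<?N} J"
    using bij_betw_nth[OF ls(3), of "{0..<?N}" J] ls by (auto simp: lessThan_atLeast0)
  note bij = this
  have bls: "bij_betw (inv_into {0..<?N} (\<lambda>i. ls ! i)) J {0..<?N}"
    and lsi: "\<And>j. j \<in> J \<Longrightarrow> ls ! (inv_into {0..<?N} (\<lambda>i. ls ! i) j) = j"
    using bij_betw_inv_into[OF bij] bij_betw_inv_into_right[OF bij] by simp_all
  define \<sigma> where "\<sigma> b = (if b < ?N then inv_into {0..<?N} (\<lambda>i. ls ! i) (f b) else b)" for b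
  have "bij_betw f {0..<?N} J" using True by (simp add: J_def bij_betw_def)
  then have "bij_betw (inv_into {0..<?N} (\<lambda>i. ls ! i) \<circ> f) {0..<?N} {0..<?N}"
    using bls by (rule bij_betw_trans)
  then have "bij_betw \<sigma> {0..<?N} {0..<?N}"
    by (rule bij_betw_cong[THEN iffD1, rotated]) (simp add: \<sigma>_def)
  then have perm: "\<sigma> permutes {0..<?N}"
    by (intro bij_imp_permutes) (auto simp: \<sigma>_def)
  have \<sigma>: "ls ! \<sigma> b = f b" "\<sigma> b < ?N" if "b < ?N" for b
    using that lsi[of "f b"] permutes_in_image[OF perm, of b] by (auto simp: \<sigma>_def J_def)
  have "det (mat ?N ?N (\<lambda>(a, b). v a (f b))) = signof \<sigma> * pluecker_coords k n v J" for v
  proof -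
    let ?A = "mat ?N ?N (\<lambda>(a, b). v a (ls ! b))"
    have "transpose_mat (mat ?N ?N (\<lambda>(a, b). v a (f b))) =
        mat ?N ?N (\<lambda>(i, j). transpose_mat ?A $$ (\<sigma> i, j))"
      by (intro eq_matI) (auto simp: \<sigma>[simplified])
    moreover have "det (mat ?N ?N (\<lambda>(i, j). transpose_mat ?A $$ (\<sigma> i, j))) = signof \<sigma> * det (transpose_mat ?A)"
      using perm by (intro det_permute_rows) auto
    ultimately have "det (mat ?N ?N (\<lambda>(a, b). v a (f b))) = signof \<sigma> * det ?A"
      using det_transpose[of "mat ?N ?N (\<lambda>(a, b). v a (f b))" ?N] det_transpose[of ?A ?N] by simp
    then show ?thesis using JI by (simp add: pluecker_coords_def ls_def)
  qed
  then show ?thesis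
    using form_fun_scale[OF form_fun_var[OF JI], of "signof \<sigma>"] by metis
qed

text \<open>The Cauchy--Binet formula, in the weak form that the determinant of the pairings with fixed \<open>\<xi>\<close> is
  some linear form in the Pluecker coordinates: expand the determinant multilinearly in its columns.\<close>

lemma cauchy_binet_form:
  "\<exists>\<psi>. is_form (pluecker_index k n) 1 \<psi> \<and>
    (\<forall>v. poly_eval \<psi> (pluecker_coords k n v) = det (mat (k+1) (k+1) (\<lambda>(a, b). dot {..n} (v a) (\<xi> b))))"
proof -
  let ?N = "k + 1"
  let ?F = "PiE {0..<?N} (\<lambda>_. {..n})"
  have "\<forall>f\<in>?F. \<exists>g. form_fun (pluecker_index k n) 1 g \<and>
    (\<forall>v. g (pluecker_coords k n v) = det (mat (k+1) (k+1) (\<lambda>(a, b). v a (f b))))"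
  proof
    fix f assume "f \<in> ?F"
    then have "f \<in> {0..<?N} \<rightarrow> {..n}" unfolding PiE_def by (rule IntD1)
    then show "\<exists>g. form_fun (pluecker_index k n) 1 g \<and>
        (\<forall>v. g (pluecker_coords k n v) = det (mat (k+1) (k+1) (\<lambda>(a, b). v a (f b))))"
      by (rule column_selection_form)
  qed
  then obtain g where g: "\<And>f. f \<in> ?F \<Longrightarrow> form_fun (pluecker_index k n) 1 (g f)"
    "\<And>f v. f \<in> ?F \<Longrightarrow> g f (pluecker_coords k n v) = det (mat (k+1) (k+1) (\<lambda>(a, b). v a (f b)))"
    by metis
  have expand: "det (mat ?N ?N (\<lambda>(a, b). dot {..n} (v a) (\<xi> b)))
      = (\<Sum>f\<in>?F. (\<Prod>b\<in>{0..<?N}. \<xi> b (f b)) * det (mat ?N ?N (\<lambda>(a, b). v a (f b))))"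
    for v :: "nat \<Rightarrow> nat \<Rightarrow> complex"
  proof -
    let ?P = "{p. p permutes {0..<?N}}"
    have "det (mat ?N ?N (\<lambda>(a, b). dot {..n} (v a) (\<xi> b)))
        = (\<Sum>p\<in>?P. signof p * (\<Prod>j\<in>{0..<?N}. dot {..n} (v (p j)) (\<xi> j)))"
      using permutes_in_image
      by (subst det_col[of _ ?N]) (auto simp: lessThan_atLeast0 intro!: sum.cong prod.cong)
    also have "\<dots> = (\<Sum>p\<in>?P. signof p * (\<Sum>f\<in>?F. \<Prod>j\<in>{0..<?N}. v (p j) (f j) * \<xi> j (f j)))"
      unfolding dot_def by (subst prod_sum_PiE) auto
    also have "\<dots> = (\<Sum>p\<in>?P. \<Sum>f\<in>?F. (\<Prod>b\<in>{0..<?N}. \<xi> b (f b)) * (signof p * (\<Prod>j\<in>{0..<?N}. v (p j) (f j))))"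
      by (simp only: sum_distrib_left prod.distrib mult_ac)
    also have "\<dots> = (\<Sum>f\<in>?F. (\<Prod>b\<in>{0..<?N}. \<xi> b (f b)) * (\<Sum>p\<in>?P. signof p * (\<Prod>j\<in>{0..<?N}. v (p j) (f j))))"
      by (subst sum.swap) (simp only: sum_distrib_left)
    also have "\<dots> = (\<Sum>f\<in>?F. (\<Prod>b\<in>{0..<?N}. \<xi> b (f b)) * det (mat ?N ?N (\<lambda>(a, b). v a (f b))))"
      using permutes_in_image
      by (intro sum.cong refl arg_cong2[of _ _ _ _ "(*)"], subst det_col[of _ ?N])
        (auto simp: lessThan_atLeast0 intro!: sum.cong prod.cong)
    finally show ?thesis .
  qed
  have "form_fun (pluecker_index k n) 1 (\<lambda>y. \<Sum>f\<in>?F. (\<Prod>b\<in>{0..<?N}. \<xi> b (f b)) * g f y)"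
    using g(1) by (intro form_fun_sum form_fun_scale)
  then obtain \<psi> where \<psi>: "is_form (pluecker_index k n) 1 \<psi>"
    "\<And>y. poly_eval \<psi> y = (\<Sum>f\<in>?F. (\<Prod>b\<in>{0..<?N}. \<xi> b (f b)) * g f y)"
    unfolding form_fun_def by blast
  have "poly_eval \<psi> (pluecker_coords k n v) = det (mat ?N ?N (\<lambda>(a, b). dot {..n} (v a) (\<xi> b)))" for v
    unfolding \<psi>(2) expand by (intro sum.cong refl arg_cong2[of _ _ _ _ "(*)"] g(2))
  with \<psi>(1) show ?thesis by blast
qed

lemma pluecker_coords_combination:
  assumes w: "\<And>a i. a < k + 1 \<Longrightarrow> w a i = (\<Sum>b<k+1. M a b * u b i)"
  shows "pluecker_coords k n w = (\<lambda>J. det (mat (k+1) (k+1) (\<lambda>(a, b). M a b)) * pluecker_coords k n u J)"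
proof
  fix J :: "nat set"
  let ?N = "k + 1" and ?ls = "sorted_list_of_set J"
  let ?M = "mat ?N ?N (\<lambda>(a, b). M a b)" and ?U = "mat ?N ?N (\<lambda>(a, b). u a (?ls ! b))"
  have "mat ?N ?N (\<lambda>(a, b). w a (?ls ! b)) = ?M * ?U"
    by (intro eq_matI) (simp_all add: w[simplified] scalar_prod_def lessThan_atLeast0)
  then have "det (mat ?N ?N (\<lambda>(a, b). w a (?ls ! b))) = det ?M * det ?U"
    using det_mult[of ?M ?N ?U] by simp
  then show "pluecker_coords k n w J = det ?M * pluecker_coords k n u J"
    by (simp add: pluecker_coords_def)
qed

lemma pluecker_span:
  assumes W: "W = cvec.span (u ` {..<k+1})"
  shows "pluecker k n W = cvec.span {pluecker_coords k n u}"
proof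
  have uW: "u a \<in> W" if "a \<le> k" for a using that unfolding W by (intro cvec.span_base) auto
  show "pluecker k n W \<subseteq> cvec.span {pluecker_coords k n u}"
    unfolding pluecker_def
  proof (rule cvec.span_minimal)
    show "{pluecker_coords k n w | w. \<forall>a\<le>k. w a \<in> W} \<subseteq> cvec.span {pluecker_coords k n u}"
    proof clarify
      fix w :: "nat \<Rightarrow> nat \<Rightarrow> complex" assume w: "\<forall>a\<le>k. w a \<in> W"
      have "\<forall>a. \<exists>c. a < k + 1 \<longrightarrow> w a = (\<Sum>b<k+1. (\<lambda>i. c b * u b i))"
      proof (intro allI)
        fix a
        show "\<exists>c. a < k + 1 \<longrightarrow> w a = (\<Sum>b<k+1. (\<lambda>i. c b * u b i))"
        proof (cases "a < k + 1")
          case True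
          then have "w a \<in> cvec.span (u ` {..<k+1})" using w W by simp
          then obtain c where "w a = (\<Sum>b<k+1. (\<lambda>i. c b * u b i))" by (rule cvec.in_span_familyE) simp
          then show ?thesis by (intro exI[of _ c] impI)
        qed simp
      qed
      from choice[OF this] obtain M
        where M: "\<forall>a. a < k + 1 \<longrightarrow> w a = (\<Sum>b<k+1. (\<lambda>i. M a b * u b i))" ..
      have "w a i = (\<Sum>b<k+1. M a b * u b i)" if "a < k + 1" for a i
        using M[rule_format, OF that] by (simp only: sum_fun_apply)
      then have "pluecker_coords k n w = (\<lambda>J. det (mat (k+1) (k+1) (\<lambda>(a, b). M a b)) * pluecker_coords k n u J)"
        by (rule pluecker_coords_combination)
      then show "pluecker_coords k n w \<in> cvec.span {pluecker_coords k n u}"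
        unfolding cvec.span_singleton by (rule range_eqI)
    qed
  qed simp
  have "pluecker_coords k n u \<in> {pluecker_coords k n w | w. \<forall>a\<le>k. w a \<in> W}" using uW by blast
  then show "cvec.span {pluecker_coords k n u} \<subseteq> pluecker k n W"
    unfolding pluecker_def by (intro cvec.span_mono) blast
qed

lemma dual_coordinates:
  fixes w :: "'a \<Rightarrow> 'v \<Rightarrow> complex"
  assumes "finite I" "cvec.indep_on A w" "finite A" "w ` A \<subseteq> coord_space I"
  obtains \<xi> where "\<And>a b. a \<in> A \<Longrightarrow> b \<in> A \<Longrightarrow> dot I (w a) (\<xi> b) = (if a = b then 1 else 0)"
proof -
  interpret quadratic_space "\<lambda>(c::complex) (v::'v \<Rightarrow> complex) i. c * v i" "dot I" "coord_space I" "unit_vec ` I"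
    using assms(1) by (rule quadratic_space_dot)
  show thesis by (rule dual_family_L[OF assms(3,2,4)]) (rule that)
qed

text \<open>For \<open>\<xi>\<close> dual to \<open>u\<close>, the linear form of Cauchy and Binet takes the value 1.\<close>

lemma pluecker_coords_nonzero:
  assumes "cvec.indep_on {..<k+1} u" "u ` {..<k+1} \<subseteq> coord_space {..n}"
  shows "pluecker_coords k n u \<noteq> 0"
proof
  assume z: "pluecker_coords k n u = 0"
  obtain \<xi> where \<xi>: "\<And>a b. a \<in> {..<k+1} \<Longrightarrow> b \<in> {..<k+1} \<Longrightarrow> dot {..n} (u a) (\<xi> b) = (if a = b then 1 else 0)"
    by (rule dual_coordinates[OF finite_atMost assms(1) finite_lessThan assms(2)]) blast
  obtain \<psi> where \<psi>: "is_form (pluecker_index k n) 1 \<psi>"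
    "\<And>v. poly_eval \<psi> (pluecker_coords k n v) = det (mat (k+1) (k+1) (\<lambda>(a, b). dot {..n} (v a) (\<xi> b)))"
    using cauchy_binet_form[of k n \<xi>] by blast
  have "mat (k+1) (k+1) (\<lambda>(a, b). dot {..n} (u a) (\<xi> b)) = 1\<^sub>m (k+1)"
    by (intro eq_matI) (auto simp: \<xi>[simplified])
  then have "poly_eval \<psi> (pluecker_coords k n u) = 1" using \<psi>(2)[of u] by simp
  moreover have "poly_eval \<psi> 0 = 0"
    using poly_eval_scale[OF \<psi>(1), of 0 0] by (simp add: zero_fun_def)
  ultimately show False using z by simp
qed

lemma grassmannian_basis:
  assumes "W \<in> grassmannian k n"
  obtains u where "cvec.indep_on {..<k+1} u" "u ` {..<k+1} \<subseteq> coord_space {..n}"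
    "cvec.span (u ` {..<k+1}) = W"
proof -
  have W: "cvec.subspace W" "W \<subseteq> coord_space {..n}" "cvec.dim W = k + 1"
    using assms by (auto simp: grassmannian_def)
  obtain u where u: "cvec.indep_on {..<k+1} u" "cvec.span (u ` {..<k+1}) = W"
    using cvec.basis_family[OF W(1,3)] by auto
  then show thesis using that W(2) cvec.span_superset[of "u ` {..<k+1}"] by blast
qed

lemma pluecker_in_proj_space:
  assumes "W \<in> grassmannian k n"
  shows "pluecker k n W \<in> proj_space (pluecker_index k n)"
proof -
  obtain u where u: "cvec.indep_on {..<k+1} u" "u ` {..<k+1} \<subseteq> coord_space {..n}"
    "cvec.span (u ` {..<k+1}) = W"
    using grassmannian_basis[OF assms] .
  show ?thesis
    unfolding pluecker_span[OF u(3)[symmetric]]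
    by (intro line_in_proj_space pluecker_coords_in pluecker_coords_nonzero u(1,2))
qed

lemma span_in_grassmannian:
  assumes "cvec.indep_on {..<k+1} u" "u ` {..<k+1} \<subseteq> coord_space {..n}"
  shows "cvec.span (u ` {..<k+1}) \<in> grassmannian k n"
  using cvec.dim_span_indep_on[OF _ assms(1)] cvec.span_minimal[OF assms(2) subspace_coord_space]
  by (simp add: grassmannian_def)

lemma det_killed_vector:
  assumes y: "y = (\<lambda>i. \<Sum>a<N. c a * v a i)" "y \<noteq> 0" and "\<And>b. b < N \<Longrightarrow> dot I y (\<xi> b) = 0"
  shows "det (mat N N (\<lambda>(a, b). dot I (v a) (\<xi> b))) = 0"
proof -
  let ?A = "mat N N (\<lambda>(a, b). dot I (v a) (\<xi> b))"
  have "\<exists>a<N. c a \<noteq> 0"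
  proof (rule ccontr)
    assume "\<not> ?thesis"
    then have "y = 0" by (simp add: y(1) fun_eq_iff)
    then show False using y(2) by simp
  qed
  then obtain a0 where a0: "a0 < N" "c a0 \<noteq> 0" by blast
  have "transpose_mat ?A *\<^sub>v vec N c = 0\<^sub>v N"
  proof (rule eq_vecI)
    fix b assume "b < dim_vec (0\<^sub>v N :: complex vec)"
    then have b: "b < N" by simp
    have "(transpose_mat ?A *\<^sub>v vec N c) $ b = (\<Sum>a<N. dot I (v a) (\<xi> b) * c a)"
      using b by (simp add: scalar_prod_def lessThan_atLeast0)
    also have "\<dots> = dot I y (\<xi> b)"
      unfolding y(1) dot_def sum_distrib_right by (subst sum.swap) (simp add: mult_ac)
    finally show "(transpose_mat ?A *\<^sub>v vec N c) $ b = 0\<^sub>v N $ b" using assms(3) b by simp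
  qed simp
  moreover have "vec N c \<noteq> 0\<^sub>v N" using a0 by (metis index_vec index_zero_vec(1))
  ultimately have "\<exists>x. x \<in> carrier_vec N \<and> x \<noteq> 0\<^sub>v N \<and> transpose_mat ?A *\<^sub>v x = 0\<^sub>v N"
    by (intro exI[of _ "vec N c"] conjI vec_carrier)
  moreover have "transpose_mat ?A \<in> carrier_mat N N" by simp
  ultimately have "det (transpose_mat ?A) = 0"
    by (simp only: det_0_iff_vec_prod_zero_field)
  then show ?thesis using det_transpose[of ?A N] by simp
qed

text \<open>A hyperplane in Pluecker space that avoids the span of \<open>u\<close> and contains every subspace that meets
  the common kernel of the \<open>\<xi> b\<close>. It separates points and describes opposite subspaces.\<close>

lemma separating_pluecker_form:
  assumes u: "cvec.indep_on {..<k+1} u" "u ` {..<k+1} \<subseteq> coord_space {..n}"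
    and \<xi>: "\<forall>a<k+1. \<forall>b<k+1. dot {..n} (u a) (\<xi> b) = (if a = b then 1 else 0)"
  shows "\<exists>\<psi>. is_form (pluecker_index k n) 1 \<psi> \<and>
    pluecker k n (cvec.span (u ` {..<k+1})) \<notin> zero_locus (pluecker_index k n) {\<psi>} \<and>
    (\<forall>V\<in>grassmannian k n. \<forall>y\<in>V. y \<noteq> 0 \<longrightarrow> (\<forall>b<k+1. dot {..n} y (\<xi> b) = 0)
      \<longrightarrow> pluecker k n V \<in> zero_locus (pluecker_index k n) {\<psi>})"
proof -
  obtain \<psi> where \<psi>: "is_form (pluecker_index k n) 1 \<psi>"
    "\<And>v. poly_eval \<psi> (pluecker_coords k n v) = det (mat (k+1) (k+1) (\<lambda>(a, b). dot {..n} (v a) (\<xi> b)))"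
    using cauchy_binet_form[of k n \<xi>] by blast
  have iff: "pluecker k n (cvec.span (v ` {..<k+1})) \<in> zero_locus (pluecker_index k n) {\<psi>} \<longleftrightarrow>
      det (mat (k+1) (k+1) (\<lambda>(a, b). dot {..n} (v a) (\<xi> b))) = 0"
    if "cvec.indep_on {..<k+1} v" "v ` {..<k+1} \<subseteq> coord_space {..n}" for v
    unfolding pluecker_span[OF refl] \<psi>(2)[symmetric]
    by (intro in_zero_locus_line[OF \<psi>(1)] pluecker_coords_in pluecker_coords_nonzero that)
  show ?thesis
  proof (intro exI[of _ \<psi>] conjI ballI impI \<psi>(1))
    have "mat (k+1) (k+1) (\<lambda>(a, b). dot {..n} (u a) (\<xi> b)) = 1\<^sub>m (k+1)"
      using \<xi> by (intro eq_matI) auto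
    then show "pluecker k n (cvec.span (u ` {..<k+1})) \<notin> zero_locus (pluecker_index k n) {\<psi>}"
      unfolding iff[OF u] by simp
  next
    fix V y assume V: "V \<in> grassmannian k n" and y: "y \<in> V" "y \<noteq> 0" and y\<xi>: "\<forall>b<k+1. dot {..n} y (\<xi> b) = 0"
    obtain v where v: "cvec.indep_on {..<k+1} v" "v ` {..<k+1} \<subseteq> coord_space {..n}"
      "cvec.span (v ` {..<k+1}) = V"
      using grassmannian_basis[OF V] .
    have "y \<in> cvec.span (v ` {..<k+1})" using y(1) v(3) by simp
    then obtain c where "y = (\<Sum>a<k+1. (\<lambda>i. c a * v a i))"
      by (rule cvec.in_span_familyE) simp
    then have "y = (\<lambda>i. \<Sum>a<k+1. c a * v a i)" by (simp only: fun_eq_iff sum_fun_apply) simp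
    from det_killed_vector[OF this y(2) y\<xi>[rule_format]] show "pluecker k n V \<in> zero_locus (pluecker_index k n) {\<psi>}"
      using iff[OF v(1,2)] v(3) by simp
  qed
qed

text \<open>Take \<open>y\<close> in \<open>W\<close> but not in \<open>V\<close>, and \<open>\<xi>\<close> dual to a basis of \<open>V\<close> and vanishing on \<open>y\<close>.\<close>

lemma pluecker_injective:
  assumes V: "V \<in> grassmannian k n" and W: "W \<in> grassmannian k n" and "V \<noteq> W"
  shows "pluecker k n V \<noteq> pluecker k n W"
proof -
  obtain u where u: "cvec.indep_on {..<k+1} u" "u ` {..<k+1} \<subseteq> coord_space {..n}"
    "cvec.span (u ` {..<k+1}) = V"
    using grassmannian_basis[OF V] .
  obtain w where w: "cvec.indep_on {..<k+1} w" "w ` {..<k+1} \<subseteq> coord_space {..n}"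
    "cvec.span (w ` {..<k+1}) = W"
    using grassmannian_basis[OF W] .
  have "\<not> W \<subseteq> V"
  proof
    assume "W \<subseteq> V"
    then have "cvec.span (w ` {..<k+1}) = V"
      using w V cvec.span_superset[of "w ` {..<k+1}"] coord_space_span[of "{..n}"]
      by (intro cvec.span_eq_of_indep_on[where T = "unit_vec ` {..n}"]) (auto simp: grassmannian_def)
    then show False using w(3) \<open>V \<noteq> W\<close> by simp
  qed
  then obtain y where y: "y \<in> W" "y \<notin> V" by blast
  define u' where "u' a = (if a < k + 1 then u a else y)" for a
  have "cvec.indep_on {..<k+2} u'"
  proof -
    have "cvec.independent (u ` {..<k+1})" "inj_on u {..<k+1}"
      using u(1) by (simp_all add: cvec.indep_on_iff)
    then have "cvec.independent (insert y (u ` {..<k+1}))"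
      using y(2) u(3) by (intro cvec.independent_insertI) simp_all
    moreover have "u' ` {..<k+2} = insert y (u ` {..<k+1})"
      by (auto simp: u'_def image_iff lessThan_Suc)
    moreover have "inj_on u' {..<k+2}"
    proof (rule inj_onI)
      have ny: "u a \<noteq> y" if "a < k + 1" for a
        using y(2) u(3) cvec.span_base[of "u a" "u ` {..<k+1}"] that by auto
      fix a b assume "a \<in> {..<k+2}" "b \<in> {..<k+2}" "u' a = u' b"
      then show "a = b"
        using \<open>inj_on u {..<k+1}\<close> ny[of a] ny[of b]
        by (auto simp: u'_def inj_on_def split: if_splits)
    qed
    ultimately show ?thesis by (simp add: cvec.indep_on_iff)
  qed
  note ind = this
  have sub: "u' ` {..<k+2} \<subseteq> coord_space {..n}"
    using u(2) y(1) W by (auto simp: u'_def grassmannian_def)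
  obtain \<xi> where \<xi>: "\<And>a b. a \<in> {..<k+2} \<Longrightarrow> b \<in> {..<k+2} \<Longrightarrow> dot {..n} (u' a) (\<xi> b) = (if a = b then 1 else 0)"
    by (rule dual_coordinates[OF finite_atMost ind finite_lessThan sub]) blast
  have \<xi>u: "\<forall>a<k+1. \<forall>b<k+1. dot {..n} (u a) (\<xi> b) = (if a = b then 1 else 0)"
  proof (intro allI impI)
    fix a b assume "a < k + 1" "b < k + 1"
    then show "dot {..n} (u a) (\<xi> b) = (if a = b then 1 else 0)"
      using \<xi>[of a b] by (simp add: u'_def)
  qed
  have \<xi>y: "dot {..n} y (\<xi> b) = 0" if "b < k + 1" for b
    using \<xi>[of "k+1" b] that by (simp add: u'_def)
  have "y \<noteq> 0" using y(2) cvec.subspace_0[of V] V by (auto simp: grassmannian_def)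
  from separating_pluecker_form[OF u(1,2) \<xi>u, unfolded u(3)]
  obtain \<psi> where "pluecker k n V \<notin> zero_locus (pluecker_index k n) {\<psi>}"
    and meet: "\<forall>V\<in>grassmannian k n. \<forall>y\<in>V. y \<noteq> 0 \<longrightarrow> (\<forall>b<k+1. dot {..n} y (\<xi> b) = 0)
      \<longrightarrow> pluecker k n V \<in> zero_locus (pluecker_index k n) {\<psi>}"
    by (elim exE conjE)
  moreover have "pluecker k n W \<in> zero_locus (pluecker_index k n) {\<psi>}"
    using meet[rule_format, OF W y(1) \<open>y \<noteq> 0\<close> \<xi>y] .
  ultimately show ?thesis by metis
qed

section \<open>Polynomial paths in the Grassmannian\<close>

lemma pluecker_coords_det:
  "J \<in> pluecker_index k n \<Longrightarrow> pluecker_coords k n w J =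
    (\<Sum>p\<in>{p. p permutes {0..<k+1}}. signof p * (\<Prod>a\<in>{0..<k+1}. w a (sorted_list_of_set J ! p a)))"
  using permutes_in_image
  by (auto simp: pluecker_coords_def det_def intro!: sum.cong prod.cong)

text \<open>Irreducibility is tested along the affine line: on a path with polynomial coordinates, a nonempty
  open condition holds at all but finitely many parameters.\<close>

definition polynomial_path :: "(complex \<Rightarrow> nat \<Rightarrow> nat \<Rightarrow> complex) \<Rightarrow> bool" where
  "polynomial_path u \<longleftrightarrow> (\<exists>q. \<forall>\<tau> a i. u \<tau> a i = poly (q a i) \<tau>)"

lemma polynomial_path_pluecker:
  assumes "polynomial_path u"
  shows "\<exists>Q. \<forall>\<tau>. poly_eval p (pluecker_coords k n (u \<tau>)) = poly Q \<tau>"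
proof -
  obtain q where q: "\<And>\<tau> a i. u \<tau> a i = poly (q a i) \<tau>"
    using assms unfolding polynomial_path_def by blast
  define P where "P J = (if J \<in> pluecker_index k n then
    (\<Sum>p\<in>{p. p permutes {0..<k+1}}. smult (signof p) (\<Prod>a\<in>{0..<k+1}. q a (sorted_list_of_set J ! p a))) else 0)" for J
  have "pluecker_coords k n (u \<tau>) = (\<lambda>J. poly (P J) \<tau>)" for \<tau>
  proof
    fix J
    show "pluecker_coords k n (u \<tau>) J = poly (P J) \<tau>"
    proof (cases "J \<in> pluecker_index k n")
      case True
      then show ?thesis
        by (simp only: pluecker_coords_det P_def if_True q poly_sum poly_smult poly_prod)
    next
      case False
      then show ?thesis by (simp add: pluecker_coords_def P_def)
    qed
  qed
  then show ?thesis using poly_eval_polynomial_path[of p P] by simp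
qed

lemma topspace_grassmannian: "topspace (grassmannian_topology k n) = grassmannian k n"
  using pluecker_in_proj_space
  by (auto simp: grassmannian_topology_def topspace_pullback_topology topspace_zariski)

text \<open>The property passes from the basic open sets, where it says that a nonzero polynomial has finitely
  many roots, to finite intersections and arbitrary unions.\<close>

lemma polynomial_path_generic:
  assumes path: "polynomial_path u"
    and u: "\<And>\<tau>. cvec.indep_on {..<k+1} (u \<tau>)" "\<And>\<tau>. u \<tau> ` {..<k+1} \<subseteq> coord_space {..n}"
    and U: "openin (grassmannian_topology k n) U" "cvec.span (u \<tau>0 ` {..<k+1}) \<in> U"
  shows "finite {\<tau>. cvec.span (u \<tau> ` {..<k+1}) \<notin> U}"
proof -
  let ?g = "\<lambda>\<tau>. cvec.span (u \<tau> ` {..<k+1})" and ?I = "pluecker_index k n"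
  have g: "?g \<tau> \<in> grassmannian k n" for \<tau> by (rule span_in_grassmannian[OF u])
  obtain O' where O': "openin (zariski ?I) O'" "U = pluecker k n -` O' \<inter> grassmannian k n"
    using U(1) unfolding grassmannian_topology_def openin_pullback_topology by blast
  have "generate_topology_on {proj_space ?I - zero_locus ?I {p} | p d. is_form ?I d p} O'"
    using O'(1) unfolding zariski_def by (rule openin_topology_generated_by)
  then have "(\<exists>\<tau>. pluecker k n (?g \<tau>) \<in> O') \<longrightarrow> finite {\<tau>. pluecker k n (?g \<tau>) \<notin> O'}"
  proof induction
    case Empty
    then show ?case by simp
  next
    case (Int a b)
    have "{\<tau>. pluecker k n (?g \<tau>) \<notin> a \<inter> b} = {\<tau>. pluecker k n (?g \<tau>) \<notin> a} \<union> {\<tau>. pluecker k n (?g \<tau>) \<notin> b}"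
      by blast
    then show ?case using Int.IH by auto
  next
    case (UN K)
    show ?case
    proof
      assume "\<exists>\<tau>. pluecker k n (?g \<tau>) \<in> \<Union>K"
      then obtain a where a: "a \<in> K" "\<exists>\<tau>. pluecker k n (?g \<tau>) \<in> a" by blast
      then have "finite {\<tau>. pluecker k n (?g \<tau>) \<notin> a}" using UN.IH by blast
      then show "finite {\<tau>. pluecker k n (?g \<tau>) \<notin> \<Union>K}"
        by (rule finite_subset[rotated]) (use a(1) in blast)
    qed
  next
    case (Basis s)
    then obtain p d where p: "is_form ?I d p" and s: "s = proj_space ?I - zero_locus ?I {p}" by blast
    obtain Q where Q: "\<And>\<tau>. poly_eval p (pluecker_coords k n (u \<tau>)) = poly Q \<tau>"
      using polynomial_path_pluecker[OF path] by blast
    have iff: "pluecker k n (?g \<tau>) \<notin> s \<longleftrightarrow> poly Q \<tau> = 0" for \<tau>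
    proof -
      have "pluecker k n (?g \<tau>) \<in> zero_locus ?I {p} \<longleftrightarrow> poly Q \<tau> = 0"
        unfolding pluecker_span[OF refl] Q[symmetric]
        by (intro in_zero_locus_line[OF p] pluecker_coords_in pluecker_coords_nonzero u)
      then show ?thesis using pluecker_in_proj_space[OF g] by (simp add: s)
    qed
    show ?case
    proof
      assume "\<exists>\<tau>. pluecker k n (?g \<tau>) \<in> s"
      then have "Q \<noteq> 0" using iff by fastforce
      then show "finite {\<tau>. pluecker k n (?g \<tau>) \<notin> s}" unfolding iff by (rule poly_roots_finite)
    qed
  qed
  moreover have "pluecker k n (?g \<tau>0) \<in> O'" using U(2) O'(2) by blast
  ultimately have "finite {\<tau>. pluecker k n (?g \<tau>) \<notin> O'}" by blast
  moreover have "{\<tau>. ?g \<tau> \<notin> U} = {\<tau>. pluecker k n (?g \<tau>) \<notin> O'}"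
    using g by (auto simp: O'(2))
  ultimately show ?thesis by simp
qed

lemma polynomial_path_opens_meet:
  assumes "polynomial_path u"
    and "\<And>\<tau>. cvec.indep_on {..<k+1} (u \<tau>)" "\<And>\<tau>. u \<tau> ` {..<k+1} \<subseteq> coord_space {..n}"
    and "openin (grassmannian_topology k n) U" "cvec.span (u \<tau>0 ` {..<k+1}) \<in> U"
    and "openin (grassmannian_topology k n) V" "cvec.span (u \<tau>1 ` {..<k+1}) \<in> V"
  obtains \<tau> where "cvec.span (u \<tau> ` {..<k+1}) \<in> U" "cvec.span (u \<tau> ` {..<k+1}) \<in> V"
proof -
  have "finite ({\<tau>. cvec.span (u \<tau> ` {..<k+1}) \<notin> U} \<union> {\<tau>. cvec.span (u \<tau> ` {..<k+1}) \<notin> V})"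
    using polynomial_path_generic[OF assms(1-5)] polynomial_path_generic[OF assms(1-3,6,7)] by simp
  from ex_new_if_finite[OF infinite_UNIV_char_0 this]
  obtain \<tau> where "\<tau> \<notin> {\<tau>. cvec.span (u \<tau> ` {..<k+1}) \<notin> U} \<union> {\<tau>. cvec.span (u \<tau> ` {..<k+1}) \<notin> V}" ..
  then show thesis by (intro that[of \<tau>]) simp_all
qed

section \<open>Rational curves from binary forms\<close>

lemma segre_in_proj_space:
  assumes "p \<in> proj_space I" "q \<in> proj_space J"
  shows "segre (p, q) \<in> proj_space (I \<times> J)"
proof -
  obtain x where x: "x \<noteq> 0" "x \<in> coord_space I" "p = cvec.span {x}"
    by (rule proj_space_nonzero[OF assms(1)]) blast
  obtain y where y: "y \<noteq> 0" "y \<in> coord_space J" "q = cvec.span {y}"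
    by (rule proj_space_nonzero[OF assms(2)]) blast
  let ?z = "\<lambda>(i, j). x i * y j"
  have "segre (p, q) = cvec.span {?z}"
  proof
    show "segre (p, q) \<subseteq> cvec.span {?z}"
      unfolding segre_def prod.case
    proof (rule cvec.span_minimal)
      show "{\<lambda>(i, j). v i * w j | v w. v \<in> p \<and> w \<in> q} \<subseteq> cvec.span {?z}"
      proof clarify
        fix v w assume "v \<in> p" "w \<in> q"
        then obtain a b where "v = (\<lambda>i. a * x i)" "w = (\<lambda>j. b * y j)"
          unfolding x(3) y(3) cvec.span_singleton by blast
        then have "(\<lambda>(i, j). v i * w j) = (\<lambda>l. (a * b) * ?z l)" by (auto simp: fun_eq_iff)
        then show "(\<lambda>(i, j). v i * w j) \<in> cvec.span {?z}"
          unfolding cvec.span_singleton by (rule range_eqI)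
      qed
    qed simp
    have "x \<in> p" "y \<in> q" unfolding x(3) y(3) by (auto intro: cvec.span_base)
    then show "cvec.span {?z} \<subseteq> segre (p, q)"
      unfolding segre_def prod.case by (intro cvec.span_mono) blast
  qed
  moreover have "?z \<in> coord_space (I \<times> J)" using x(2) y(2) by (auto simp: coord_space_def)
  moreover have "?z \<noteq> 0"
  proof -
    obtain i j where "x i \<noteq> 0" "y j \<noteq> 0" using x(1) y(1) by (auto simp: fun_eq_iff)
    then have "?z (i, j) \<noteq> 0" by simp
    then show ?thesis by (metis zero_fun_apply)
  qed
  ultimately show ?thesis using line_in_proj_space by metis
qed

text \<open>All of \<open>Z \<times> Z\<close> is open and dense in itself.\<close>

lemma rationally_connectedI:
  assumes "Z \<subseteq> proj_space I"
    and "\<And>p q. p \<in> Z \<Longrightarrow> q \<in> Z \<Longrightarrow> \<exists>C. rational_curve I C \<and> C \<subseteq> Z \<and> p \<in> C \<and> q \<in> C"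
  shows "rationally_connected I Z"
proof -
  have top: "topspace (subtopology (product_zariski I I) (Z \<times> Z)) = Z \<times> Z"
    using assms(1)
    by (auto simp: product_zariski_def topspace_pullback_topology topspace_zariski
        intro!: segre_in_proj_space dest: subsetD)
  show ?thesis
    unfolding rationally_connected_def
    using assms(2) closure_of_topspace[of "subtopology (product_zariski I I) (Z \<times> Z)"]
      openin_topspace[of "subtopology (product_zariski I I) (Z \<times> Z)"]
    unfolding top by blast
qed

lemma span_rescaled_family:
  assumes "finite A" "\<And>a. a \<in> A \<Longrightarrow> c a \<noteq> 0" "\<And>a. a \<in> A \<Longrightarrow> w' a = (\<lambda>i. c a * w a i)"
  shows "cvec.span (w' ` A) = cvec.span (w ` A)"
proof -
  have "w a = (\<lambda>i. (1 / c a) * w' a i)" if "a \<in> A" for a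
    using assms(2,3)[OF that] by simp
  then have "w a \<in> cvec.span (w' ` A)" if "a \<in> A" for a
    using that cvec.span_scale[OF cvec.span_base, of "w' a" "w' ` A" "1 / c a"] by simp
  moreover have "w' a \<in> cvec.span (w ` A)" if "a \<in> A" for a
    using that cvec.span_scale[OF cvec.span_base, of "w a" "w ` A" "c a"] by (simp add: assms(3))
  ultimately show ?thesis unfolding cvec.span_eq by blast
qed

text \<open>The coordinates of a \<open>pencil\<close> of vectors.\<close>

definition binary_family :: "(nat \<Rightarrow> nat) \<Rightarrow> (nat \<Rightarrow> nat \<Rightarrow> nat \<Rightarrow> complex) \<Rightarrow> complex \<Rightarrow> complex \<Rightarrow> nat \<Rightarrow> nat \<Rightarrow> complex" where
  "binary_family \<delta> A s t a = (\<lambda>i. \<Sum>j\<le>\<delta> a. s ^ (\<delta> a - j) * t ^ j * A a j i)"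

abbreviation binary_plane where
  "binary_plane k \<delta> A s t \<equiv> cvec.span (binary_family \<delta> A s t ` {..<k+1})"

lemma binary_family_scale:
  "binary_family \<delta> A (c * s) (c * t) a = (\<lambda>i. c ^ \<delta> a * binary_family \<delta> A s t a i)"
proof
  fix i
  have pw: "(c * s) ^ (\<delta> a - j) * (c * t) ^ j = c ^ \<delta> a * (s ^ (\<delta> a - j) * t ^ j)" if "j \<le> \<delta> a" for j
    using that power_add[of c "\<delta> a - j" j] by (simp add: power_mult_distrib)
  have "(c * s) ^ (\<delta> a - j) * (c * t) ^ j * A a j i = c ^ \<delta> a * (s ^ (\<delta> a - j) * t ^ j * A a j i)"
    if "j \<le> \<delta> a" for j
    unfolding pw[OF that] by (simp only: mult.assoc)
  then show "binary_family \<delta> A (c * s) (c * t) a i = c ^ \<delta> a * binary_family \<delta> A s t a i"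
    unfolding binary_family_def sum_distrib_left by (intro sum.cong refl) simp
qed

lemma binary_family_span_scale:
  assumes "c \<noteq> 0"
  shows "cvec.span (binary_family \<delta> A (c * s) (c * t) ` {..<N}) = cvec.span (binary_family \<delta> A s t ` {..<N})"
  using assms by (intro span_rescaled_family[where c = "\<lambda>a. c ^ \<delta> a"]) (auto simp: binary_family_scale)

lemma polynomial_path_binary_family:
  "polynomial_path (\<lambda>\<tau>. binary_family \<delta> A (s0 + \<tau> * s1) (t0 + \<tau> * t1))"
  unfolding polynomial_path_def
proof (intro exI allI)
  fix \<tau> a i
  show "binary_family \<delta> A (s0 + \<tau> * s1) (t0 + \<tau> * t1) a i =
      poly (\<Sum>j\<le>\<delta> a. [:s0, s1:] ^ (\<delta> a - j) * [:t0, t1:] ^ j * [:A a j i:]) \<tau>"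
    by (simp add: binary_family_def poly_sum mult_ac)
qed

lemma binary_family_form:
  assumes "J \<in> pluecker_index k n"
  shows "form_fun {..1::nat} (\<Sum>a\<in>{0..<k+1}. \<delta> a) (\<lambda>v. pluecker_coords k n (binary_family \<delta> A (v 0) (v 1)) J)"
  unfolding pluecker_coords_det[OF assms]
proof (intro form_fun_sum form_fun_scale form_fun_prod)
  fix p :: "nat \<Rightarrow> nat" and a :: nat
  let ?i = "sorted_list_of_set J ! p a"
  have "form_fun {..1::nat} (\<delta> a) (\<lambda>v. v 0 ^ (\<delta> a - j) * v 1 ^ j * A a j ?i)" if "j \<in> {..\<delta> a}" for j
  proof -
    have "form_fun {..1::nat} (((\<delta> a - j) * 1 + j * 1) + 0) (\<lambda>v. v 0 ^ (\<delta> a - j) * v 1 ^ j * A a j ?i)"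
      by (intro form_fun_mult form_fun_power form_fun_var form_fun_const) auto
    then show ?thesis using that by simp
  qed
  then show "form_fun {..1::nat} (\<delta> a) (\<lambda>v. binary_family \<delta> A (v 0) (v 1) a ?i)"
    unfolding binary_family_def by (rule form_fun_sum)
qed simp

text \<open>A point of the projective line determines \<open>(s, t)\<close> up to a factor, which rescales the members of the
  family and does not change their span. In Pluecker coordinates the map is given by minors, which
  are binary forms of the same degree, the sum of the \<open>\<delta> a\<close>, and have no common zero because the
  family is independent. The ends are distinct, so the map is not constant.\<close>

lemma rational_curve_of_binary_family:
  assumes ind: "\<And>s t. (s, t) \<noteq> (0, 0) \<Longrightarrow> cvec.indep_on {..<k+1} (binary_family \<delta> A s t)"
    and A: "\<And>s t. (s, t) \<noteq> (0, 0) \<Longrightarrow> binary_family \<delta> A s t ` {..<k+1} \<subseteq> coord_space {..n}"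
    and S: "\<And>s t. (s, t) \<noteq> (0, 0) \<Longrightarrow> binary_plane k \<delta> A s t \<in> S"
    and V: "binary_plane k \<delta> A 1 0 = V"
    and W: "binary_plane k \<delta> A 0 1 = W" and "V \<noteq> W"
  shows "\<exists>C. rational_curve (pluecker_index k n) C \<and> C \<subseteq> pluecker k n ` S \<and>
    pluecker k n V \<in> C \<and> pluecker k n W \<in> C"
proof -
  let ?I = "pluecker_index k n"
  define \<gamma> where "\<gamma> s t = binary_plane k \<delta> A s t" for s t
  define \<phi> where "\<phi> q = (let x = SOME x. x \<in> q \<and> x \<noteq> 0 in pluecker k n (\<gamma> (x 0) (x 1)))"
    for q :: "(nat \<Rightarrow> complex) set"
  have nz: "(v 0, v 1) \<noteq> (0, 0)" if "q \<in> proj_space {..1::nat}" "v \<in> q" "v \<noteq> 0" for q v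
  proof
    assume v: "(v 0, v 1) = (0, 0)"
    have "v i = 0" for i
    proof (cases "i \<le> 1")
      case True
      then show ?thesis using v by (cases i) auto
    next
      case False
      then show ?thesis using that(1,2) by (auto simp: proj_space_def coord_space_def)
    qed
    then show False using that(3) by (simp add: fun_eq_iff)
  qed
  have \<phi>: "\<phi> q = pluecker k n (\<gamma> (v 0) (v 1))" if q: "q \<in> proj_space {..1}" and v: "v \<in> q" "v \<noteq> 0" for q v
  proof -
    define x where "x = (SOME x. x \<in> q \<and> x \<noteq> 0)"
    have x: "x \<in> q" "x \<noteq> 0" unfolding x_def using someI[of "\<lambda>x. x \<in> q \<and> x \<noteq> 0" v] v by auto
    obtain c where c: "v = (\<lambda>i. c * x i)"
      using proj_space_line[OF q x] v(1) by (auto simp: cvec.span_singleton)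
    then have "c \<noteq> 0" using v(2) by (auto simp: fun_eq_iff)
    from binary_family_span_scale[OF this] have "\<gamma> (v 0) (v 1) = \<gamma> (x 0) (x 1)"
      unfolding \<gamma>_def c by this
    then show ?thesis unfolding \<phi>_def x_def Let_def by (rule arg_cong[OF sym])
  qed
  have \<phi>_line: "\<phi> q = cvec.span {pluecker_coords k n (binary_family \<delta> A (v 0) (v 1))}"
    if "q \<in> proj_space {..1}" "v \<in> q" "v \<noteq> 0" for q v
    unfolding \<phi>[OF that] \<gamma>_def by (rule pluecker_span[OF refl])
  have "\<forall>J. \<exists>p. J \<in> ?I \<longrightarrow> is_form {..1::nat} (\<Sum>a\<in>{0..<k+1}. \<delta> a) p \<and>
      (\<forall>v. poly_eval p v = pluecker_coords k n (binary_family \<delta> A (v 0) (v 1)) J)"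
    using binary_family_form unfolding form_fun_def by blast
  from choice[OF this] obtain F where F: "\<And>J. J \<in> ?I \<Longrightarrow> is_form {..1::nat} (\<Sum>a\<in>{0..<k+1}. \<delta> a) (F J)"
    "\<And>J v. J \<in> ?I \<Longrightarrow> poly_eval (F J) v = pluecker_coords k n (binary_family \<delta> A (v 0) (v 1)) J"
    by blast
  have reg: "regular_map {..1} (proj_space {..1}) ?I \<phi>"
    unfolding regular_map_def
  proof (intro conjI ballI)
    show "\<phi> \<in> proj_space {..1} \<rightarrow> proj_space ?I"
    proof
      fix q :: "(nat \<Rightarrow> complex) set" assume q: "q \<in> proj_space {..1}"
      obtain v where v: "v \<in> q" "v \<noteq> 0" by (rule proj_space_nonzero[OF q]) blast
      show "\<phi> q \<in> proj_space ?I"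
        unfolding \<phi>[OF q v] \<gamma>_def using nz[OF q v]
        by (intro pluecker_in_proj_space span_in_grassmannian ind A)
    qed
    fix p :: "(nat \<Rightarrow> complex) set" assume p: "p \<in> proj_space {..1}"
    have "openin (subtopology (zariski {..1::nat}) (proj_space {..1})) (proj_space {..1})"
      using openin_topspace[of "subtopology (zariski {..1::nat}) (proj_space {..1})"]
      by (simp add: topspace_zariski)
    moreover have "(\<lambda>j. if j \<in> ?I then poly_eval (F j) v else 0) \<in> \<phi> q - {0}"
      if q: "q \<in> proj_space {..1}" and v: "v \<in> q" "v \<noteq> 0" for q v
    proof -
      have "(\<lambda>j. if j \<in> ?I then poly_eval (F j) v else 0) = pluecker_coords k n (binary_family \<delta> A (v 0) (v 1))"
        by (auto simp: fun_eq_iff F(2) pluecker_coords_def)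
      moreover have "pluecker_coords k n (binary_family \<delta> A (v 0) (v 1)) \<noteq> 0"
        using nz[OF q v] by (intro pluecker_coords_nonzero ind A)
      ultimately show ?thesis unfolding \<phi>_line[OF q v] by (auto intro: cvec.span_base)
    qed
    ultimately show "\<exists>U d F. openin (subtopology (zariski {..1}) (proj_space {..1})) U \<and> p \<in> U \<and>
        (\<forall>j\<in>?I. is_form {..1} d (F j)) \<and>
        (\<forall>q\<in>U. \<forall>v\<in>q. v \<noteq> 0 \<longrightarrow> (\<lambda>j. if j \<in> ?I then poly_eval (F j) v else 0) \<in> \<phi> q - {0})"
      using p F(1) by (intro exI[of _ "proj_space {..1}"] exI[of _ "\<Sum>a\<in>{0..<k+1}. \<delta> a"] exI[of _ F]) blast
  qed
  have e: "cvec.span {unit_vec i} \<in> proj_space {..1}" "unit_vec i \<in> cvec.span {unit_vec i}" "unit_vec i \<noteq> 0"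
    if "i \<le> 1" for i :: nat
  proof -
    show nz: "unit_vec i \<noteq> 0" by (auto simp: unit_vec_def fun_eq_iff)
    have "unit_vec i \<in> coord_space {..1}" using that by (auto simp: unit_vec_def coord_space_def)
    then show "cvec.span {unit_vec i} \<in> proj_space {..1}" using nz by (rule line_in_proj_space)
    show "unit_vec i \<in> cvec.span {unit_vec i}" by (intro cvec.span_base) simp
  qed
  have ends: "\<phi> (cvec.span {unit_vec 0}) = pluecker k n V" "\<phi> (cvec.span {unit_vec 1}) = pluecker k n W"
    using \<phi>[OF e[of 0]] \<phi>[OF e[of 1]] V W by (simp_all add: unit_vec_def \<gamma>_def)
  have "V \<in> grassmannian k n" "W \<in> grassmannian k n"
    using span_in_grassmannian[OF ind A, of 1 0] span_in_grassmannian[OF ind A, of 0 1] V W by auto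
  then have ne: "pluecker k n V \<noteq> pluecker k n W" using \<open>V \<noteq> W\<close> by (rule pluecker_injective)
  let ?C = "\<phi> ` proj_space {..1}"
  have in_C: "pluecker k n V \<in> ?C" "pluecker k n W \<in> ?C"
    using ends e(1)[of 0] e(1)[of 1] by (metis imageI zero_le_one, metis imageI order_refl)
  have "rational_curve ?I ?C"
    unfolding rational_curve_def
  proof (intro exI[of _ \<phi>] conjI refl notI reg)
    assume "\<exists>c. ?C = {c}"
    then obtain c where "?C = {c}" ..
    then show False using in_C ne by simp
  qed
  moreover have "?C \<subseteq> pluecker k n ` S"
  proof
    fix y assume "y \<in> ?C"
    then obtain q where q: "q \<in> proj_space {..1}" "y = \<phi> q" by blast
    obtain v where v: "v \<in> q" "v \<noteq> 0" by (rule proj_space_nonzero[OF q(1)]) blast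
    show "y \<in> pluecker k n ` S"
      unfolding q(2) \<phi>[OF q(1) v] \<gamma>_def using S[OF nz[OF q(1) v]] by (rule imageI)
  qed
  ultimately show ?thesis using in_C by blast
qed

section \<open>The isotropic Grassmannian\<close>

text \<open>\<open>g y\<close> is the vector of coefficients of the linear functional \<open>B _ y\<close>.\<close>

locale coordinate_quadric = quadratic_space "\<lambda>(c::complex) (v::nat \<Rightarrow> complex) i. c * v i" B L T
  for B :: "(nat \<Rightarrow> complex) \<Rightarrow> (nat \<Rightarrow> complex) \<Rightarrow> complex" and L T +
  fixes n :: nat and g :: "(nat \<Rightarrow> complex) \<Rightarrow> nat \<Rightarrow> complex"
  assumes L_coord: "L \<subseteq> coord_space {..n}" and B_dot: "B x y = dot {..n} x (g y)"
begin

definition isotropic_grassmannian :: "nat \<Rightarrow> (nat \<Rightarrow> complex) set set" where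
  "isotropic_grassmannian k = {W. isotropic W \<and> cvec.dim W = k + 1}"

lemma isotropic_grassmannian_subset: "isotropic_grassmannian k \<subseteq> grassmannian k n"
  using L_coord by (auto simp: isotropic_grassmannian_def grassmannian_def isotropic_def)

lemma pencil_eq: "pencil \<delta> A s t = binary_family \<delta> A s t"
  by (intro ext) (simp add: pencil_def binary_family_def sum_fun_apply)

lemma isotropic_curveD:
  assumes "isotropic_curve (k + 1) \<delta> A" "(s, t) \<noteq> (0, 0)"
  shows "cvec.indep_on {..<k+1} (binary_family \<delta> A s t)"
    and "binary_plane k \<delta> A s t \<in> isotropic_grassmannian k"
    and "binary_family \<delta> A s t ` {..<k+1} \<subseteq> coord_space {..n}"
proof -
  show ind: "cvec.indep_on {..<k+1} (binary_family \<delta> A s t)"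
    and iso: "binary_plane k \<delta> A s t \<in> isotropic_grassmannian k"
    using assms cvec.dim_span_indep_on[of "{..<k+1}" "binary_family \<delta> A s t"]
    by (auto simp: isotropic_curve_def pencil_eq isotropic_grassmannian_def)
  show "binary_family \<delta> A s t ` {..<k+1} \<subseteq> coord_space {..n}"
    using iso isotropicD(2) L_coord cvec.span_superset[of "binary_family \<delta> A s t ` {..<k+1}"]
    unfolding isotropic_grassmannian_def by blast
qed

text \<open>The affine line through \<open>(1, 0)\<close> and \<open>(s, t)\<close> misses the origin unless \<open>t = 0\<close>, and in this case
  both parameters give the same subspace.\<close>

lemma isotropic_curve_opens_meet:
  assumes A: "isotropic_curve (k + 1) \<delta> A" and st: "(s, t) \<noteq> (0, 0)"
    and U: "openin (grassmannian_topology k n) U" "binary_plane k \<delta> A 1 0 \<in> U"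
    and V: "openin (grassmannian_topology k n) V" "binary_plane k \<delta> A s t \<in> V"
  shows "\<exists>s t. (s, t) \<noteq> (0, 0) \<and> binary_plane k \<delta> A s t \<in> U \<inter> V"
proof (cases "t = 0")
  case True
  then have "s \<noteq> 0" using st by simp
  from binary_family_span_scale[OF this, of \<delta> A 1 0 "k + 1"]
  have "binary_plane k \<delta> A s t = binary_plane k \<delta> A 1 0"
    using True by simp
  then have "binary_plane k \<delta> A s t \<in> U \<inter> V" using U(2) V(2) by simp
  with st show ?thesis by blast
next
  case False
  define u where "u \<tau> = binary_family \<delta> A (1 + \<tau> * (s - 1)) (0 + \<tau> * t)" for \<tau>
  have nz: "(1 + \<tau> * (s - 1), 0 + \<tau> * t) \<noteq> (0, 0)" for \<tau> using False by auto
  have path: "polynomial_path u" unfolding u_def by (rule polynomial_path_binary_family)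
  have u01: "u 0 = binary_family \<delta> A 1 0" "u 1 = binary_family \<delta> A s t" by (simp_all add: u_def)
  obtain \<tau> where "cvec.span (u \<tau> ` {..<k+1}) \<in> U" "cvec.span (u \<tau> ` {..<k+1}) \<in> V"
  proof (rule polynomial_path_opens_meet[OF path])
    show "cvec.indep_on {..<k+1} (u \<tau>)" for \<tau> unfolding u_def by (rule isotropic_curveD(1)[OF A nz])
    show "u \<tau> ` {..<k+1} \<subseteq> coord_space {..n}" for \<tau> unfolding u_def by (rule isotropic_curveD(3)[OF A nz])
    show "cvec.span (u 0 ` {..<k+1}) \<in> U" using U(2) by (simp only: u01)
    show "cvec.span (u 1 ` {..<k+1}) \<in> V" using V(2) by (simp only: u01)
  qed (use U V in blast)+
  then have "binary_plane k \<delta> A (1 + \<tau> * (s - 1)) (0 + \<tau> * t) \<in> U \<inter> V"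
    unfolding u_def by (rule IntI)
  with nz show ?thesis by blast
qed

abbreviation isotropic_topology :: "nat \<Rightarrow> (nat \<Rightarrow> complex) set topology" where
  "isotropic_topology k \<equiv> subtopology (grassmannian_topology k n) (isotropic_grassmannian k)"

lemma topspace_isotropic: "topspace (isotropic_topology k) = isotropic_grassmannian k"
  using isotropic_grassmannian_subset by (auto simp: topspace_grassmannian)

definition curve_within :: "nat \<Rightarrow> (nat \<Rightarrow> complex) set set \<Rightarrow> (nat \<Rightarrow> complex) set \<Rightarrow> (nat \<Rightarrow> complex) set \<Rightarrow> bool" where
  "curve_within k S V W \<longleftrightarrow> (\<exists>\<delta> A. isotropic_curve (k + 1) \<delta> A \<and>
     binary_plane k \<delta> A 1 0 = V \<and> binary_plane k \<delta> A 0 1 = W \<and>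
     (\<forall>s t. (s, t) \<noteq> (0, 0) \<longrightarrow> binary_plane k \<delta> A s t \<in> S))"

lemma curve_withinE:
  assumes "curve_within k S V W"
  obtains \<delta> A where "isotropic_curve (k + 1) \<delta> A"
    "binary_plane k \<delta> A 1 0 = V" "binary_plane k \<delta> A 0 1 = W"
    "\<And>s t. (s, t) \<noteq> (0, 0) \<Longrightarrow> binary_plane k \<delta> A s t \<in> S"
proof -
  from assms obtain \<delta> A where "isotropic_curve (k + 1) \<delta> A \<and>
     binary_plane k \<delta> A 1 0 = V \<and> binary_plane k \<delta> A 0 1 = W \<and>
     (\<forall>s t. (s, t) \<noteq> (0, 0) \<longrightarrow> binary_plane k \<delta> A s t \<in> S)"
    unfolding curve_within_def by (elim exE)
  then show thesis by (intro that[of \<delta> A]) simp_all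
qed

text \<open>If \<open>S\<close> were covered by two closed sets, with \<open>V\<close> outside the first and \<open>W\<close> outside the second, then
  some point of a curve from \<open>V\<close> to \<open>W\<close> would lie outside both.\<close>

lemma irreducible_if_curve_within:
  assumes S: "S \<subseteq> isotropic_grassmannian k" "S \<noteq> {}"
    and curves: "\<And>V W. V \<in> S \<Longrightarrow> W \<in> S \<Longrightarrow> curve_within k S V W"
  shows "irreducible_in (isotropic_topology k) S"
  unfolding irreducible_in_def topspace_isotropic
proof (intro conjI allI impI)
  fix C D assume CD: "closedin (isotropic_topology k) C \<and> closedin (isotropic_topology k) D \<and> S \<subseteq> C \<union> D"
  show "S \<subseteq> C \<or> S \<subseteq> D"
  proof (rule ccontr)
    assume "\<not> ?thesis"
    then obtain V W where VW: "V \<in> S" "V \<notin> C" "W \<in> S" "W \<notin> D" by blast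
    have "openin (isotropic_topology k) (isotropic_grassmannian k - E)" if "closedin (isotropic_topology k) E" for E
      using that unfolding closedin_def topspace_isotropic by blast
    then have "\<exists>O'. openin (grassmannian_topology k n) O' \<and> isotropic_grassmannian k - E = O' \<inter> isotropic_grassmannian k"
      if "closedin (isotropic_topology k) E" for E
      using that by (simp add: openin_subtopology)
    then obtain O1 O2 where O1: "openin (grassmannian_topology k n) O1" "isotropic_grassmannian k - C = O1 \<inter> isotropic_grassmannian k"
      and O2: "openin (grassmannian_topology k n) O2" "isotropic_grassmannian k - D = O2 \<inter> isotropic_grassmannian k"
      using CD by metis
    obtain \<delta> A where A: "isotropic_curve (k + 1) \<delta> A"
      "binary_plane k \<delta> A 1 0 = V" "binary_plane k \<delta> A 0 1 = W"
      "\<And>s t. (s, t) \<noteq> (0, 0) \<Longrightarrow> binary_plane k \<delta> A s t \<in> S"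
      by (rule curve_withinE[OF curves[OF VW(1,3)]]) (rule that)
    have "V \<in> O1" "W \<in> O2" using VW O1(2) O2(2) S(1) by blast+
    then have "\<exists>s t. (s, t) \<noteq> (0, 0) \<and> binary_plane k \<delta> A s t \<in> O1 \<inter> O2"
      using A(2,3) by (intro isotropic_curve_opens_meet[OF A(1) _ O1(1) _ O2(1), of 0 1]) simp_all
    then obtain s t where st: "(s, t) \<noteq> (0, 0)" "binary_plane k \<delta> A s t \<in> O1 \<inter> O2"
      by (elim exE conjE)
    have "binary_plane k \<delta> A s t \<in> S" by (rule A(4)[OF st(1)])
    then show False using st(2) CD O1(2) O2(2) S(1) by blast
  qed
qed (use S in auto)

lemma rationally_connected_if_curve_within:
  assumes S: "S \<subseteq> isotropic_grassmannian k"
    and curves: "\<And>V W. V \<in> S \<Longrightarrow> W \<in> S \<Longrightarrow> curve_within k S V W"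
    and other: "\<And>V. V \<in> S \<Longrightarrow> \<exists>W\<in>S. W \<noteq> V"
  shows "rationally_connected (pluecker_index k n) (pluecker k n ` S)"
proof (rule rationally_connectedI)
  show "pluecker k n ` S \<subseteq> proj_space (pluecker_index k n)"
    using S isotropic_grassmannian_subset pluecker_in_proj_space by blast
  have ne: "\<exists>C. rational_curve (pluecker_index k n) C \<and> C \<subseteq> pluecker k n ` S \<and>
      pluecker k n V \<in> C \<and> pluecker k n W \<in> C" if VW: "V \<in> S" "W \<in> S" "V \<noteq> W" for V W
  proof -
    obtain \<delta> A where A: "isotropic_curve (k + 1) \<delta> A"
      "binary_plane k \<delta> A 1 0 = V" "binary_plane k \<delta> A 0 1 = W"
      "\<And>s t. (s, t) \<noteq> (0, 0) \<Longrightarrow> binary_plane k \<delta> A s t \<in> S"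
      by (rule curve_withinE[OF curves[OF VW(1,2)]]) (rule that)
    show ?thesis
      by (rule rational_curve_of_binary_family[OF isotropic_curveD(1)[OF A(1)] isotropic_curveD(3)[OF A(1)] A(4,2,3) VW(3)])
  qed
  fix p q assume "p \<in> pluecker k n ` S" "q \<in> pluecker k n ` S"
  then obtain V W where VW: "V \<in> S" "W \<in> S" "p = pluecker k n V" "q = pluecker k n W" by blast
  show "\<exists>C. rational_curve (pluecker_index k n) C \<and> C \<subseteq> pluecker k n ` S \<and> p \<in> C \<and> q \<in> C"
  proof (cases "V = W")
    case True
    obtain W' where "W' \<in> S" "W' \<noteq> V" using other[OF VW(1)] by blast
    then show ?thesis using ne[OF VW(1), of W'] VW True by metis
  next
    case False
    then show ?thesis using ne[OF VW(1,2)] VW by metis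
  qed
qed

text \<open>Choose \<open>V'\<close> isotropic of the same dimension and dual to \<open>V\<close>. The subspaces with \<open>V' \<inter> W = 0\<close> form
  an open neighbourhood of \<open>V\<close>, and by the parity theorem for \<open>V'\<close>, \<open>V\<close>, \<open>W\<close> they have the parity of
  \<open>V\<close>.\<close>

lemma opposite_neighbourhood:
  assumes V: "V \<in> isotropic_grassmannian k" and max: "2 * (k + 1) = cvec.dim L"
  obtains U where "openin (grassmannian_topology k n) U" "V \<in> U"
    "\<And>W. W \<in> U \<Longrightarrow> W \<in> isotropic_grassmannian k \<Longrightarrow> even (k + 1 - cvec.dim (V \<inter> W))"
proof -
  have iso: "isotropic V" "cvec.dim V = k + 1" using V by (auto simp: isotropic_grassmannian_def)
  obtain w x where w: "cvec.indep_on {..<k+1} w" "cvec.span (w ` {..<k+1}) = V"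
    and x: "isotropic (cvec.span (x ` {..<k+1}))" "cvec.dim (cvec.span (x ` {..<k+1})) = k + 1"
    and wx: "\<And>a b. a < k + 1 \<Longrightarrow> b < k + 1 \<Longrightarrow> B (w a) (x b) = (if a = b then 1 else 0)"
    by (rule isotropic_opposite[OF iso]) (simp, blast)
  let ?V' = "cvec.span (x ` {..<k+1})" and ?I = "pluecker_index k n"
  have wc: "w ` {..<k+1} \<subseteq> coord_space {..n}"
    using w(2) cvec.span_superset[of "w ` {..<k+1}"] isotropicD(2)[OF iso(1)] L_coord by blast
  have wg: "\<forall>a<k+1. \<forall>b<k+1. dot {..n} (w a) (g (x b)) = (if a = b then 1 else 0)"
    using wx by (simp add: B_dot)
  from separating_pluecker_form[OF w(1) wc wg]
  obtain \<psi> where \<psi>: "is_form ?I 1 \<psi>"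
    "pluecker k n (cvec.span (w ` {..<k+1})) \<notin> zero_locus ?I {\<psi>}"
    and meet: "\<forall>W\<in>grassmannian k n. \<forall>y\<in>W. y \<noteq> 0 \<longrightarrow> (\<forall>b<k+1. dot {..n} y (g (x b)) = 0)
      \<longrightarrow> pluecker k n W \<in> zero_locus ?I {\<psi>}"
    by (elim exE conjE)
  define U where "U = pluecker k n -` (proj_space ?I - zero_locus ?I {\<psi>}) \<inter> grassmannian k n"
  have open_U: "openin (grassmannian_topology k n) U"
    unfolding grassmannian_topology_def openin_pullback_topology U_def
    using openin_zariski_basic[OF \<psi>(1)] by blast
  have VG: "V \<in> grassmannian k n" using V isotropic_grassmannian_subset by blast
  have VU: "V \<in> U" using \<psi>(2) VG pluecker_in_proj_space[OF VG] unfolding w(2) U_def by simp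
  have trivial: "cvec.dim (?V' \<inter> W) = 0" if "W \<in> U" for W
  proof -
    have "y = 0" if y: "y \<in> ?V' \<inter> W" for y
    proof (rule ccontr)
      assume "y \<noteq> 0"
      have yx: "dot {..n} y (g (x b)) = 0" if "b < k + 1" for b
      proof -
        have "x b \<in> ?V'" using that by (intro cvec.span_base) simp
        then show ?thesis using isotropicD(3)[OF x(1), of y "x b"] y by (simp add: B_dot)
      qed
      have "W \<in> grassmannian k n" "y \<in> W" using \<open>W \<in> U\<close> y by (simp_all add: U_def)
      then have "pluecker k n W \<in> zero_locus ?I {\<psi>}"
        using yx \<open>y \<noteq> 0\<close> by (intro meet[rule_format])
      then show False using \<open>W \<in> U\<close> by (simp add: U_def)
    qed
    then have "?V' \<inter> W \<subseteq> cvec.span {}" unfolding cvec.span_empty by blast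
    from cvec.dim_le_card[OF this finite.emptyI] show ?thesis unfolding card.empty by (rule le_0_eq[THEN iffD1])
  qed
  show thesis
  proof (rule that[OF open_U VU])
    fix W assume W: "W \<in> U" "W \<in> isotropic_grassmannian k"
    have "isotropic W" "cvec.dim W = k + 1" using W(2) by (auto simp: isotropic_grassmannian_def)
    from isotropic_parity[OF x(1,2) iso this max]
    show "even (k + 1 - cvec.dim (V \<inter> W))" using trivial[OF VU] trivial[OF W(1)] by simp
  qed
qed

text \<open>What will be the irreducible component of \<open>V\<close>: all isotropic subspaces if they are not maximal, and
  one of the two rulings if they are.\<close>

definition isotropic_family :: "nat \<Rightarrow> (nat \<Rightarrow> complex) set \<Rightarrow> (nat \<Rightarrow> complex) set set" where
  "isotropic_family k V = {W \<in> isotropic_grassmannian k. 2 * (k + 1) < cvec.dim L \<or> even (k + 1 - cvec.dim (V \<inter> W))}"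

lemma isotropic_family_equivalence:
  assumes V: "V \<in> isotropic_grassmannian k" and W: "W \<in> isotropic_family k V"
  shows "isotropic_family k W = isotropic_family k V"
proof (cases "2 * (k + 1) < cvec.dim L")
  case True
  then show ?thesis by (simp add: isotropic_family_def)
next
  case False
  have V': "isotropic V" "cvec.dim V = k + 1" and W': "isotropic W" "cvec.dim W = k + 1"
    and p: "even (k + 1 - cvec.dim (V \<inter> W))"
    using V W False by (auto simp: isotropic_grassmannian_def isotropic_family_def)
  have max: "2 * (k + 1) = cvec.dim L" using dim_isotropic_le[OF V'(1)] V'(2) False by simp
  have le: "cvec.dim (X \<inter> Y) \<le> k + 1" if X: "X \<in> isotropic_grassmannian k" for X Y
  proof -
    have X': "isotropic X" "cvec.dim X = k + 1" using X by (auto simp: isotropic_grassmannian_def)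
    obtain u where "cvec.span (u ` {..<k+1}) = X"
    proof (rule isotropic_basis[OF X'])
      fix u assume "cvec.span (u ` {..<k+1}) = X"
      then show thesis by (rule that)
    qed simp
    then have "cvec.dim (X \<inter> Y) \<le> card (u ` {..<k+1})" by (intro cvec.dim_le_card) auto
    also have "\<dots> \<le> k + 1" using card_image_le[of "{..<k+1}" u] by simp
    finally show ?thesis .
  qed
  have "even (k + 1 - cvec.dim (W \<inter> X)) \<longleftrightarrow> even (k + 1 - cvec.dim (V \<inter> X))"
    if X: "X \<in> isotropic_grassmannian k" for X
  proof -
    have X': "isotropic X" "cvec.dim X = k + 1" using X by (auto simp: isotropic_grassmannian_def)
    have "even (cvec.dim (X \<inter> V) + cvec.dim (X \<inter> W) + (k + 1 - cvec.dim (V \<inter> W)))"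
      by (rule isotropic_parity[OF X' V' W' max]) simp
    then have "even (cvec.dim (X \<inter> V)) \<longleftrightarrow> even (cvec.dim (X \<inter> W))" using p by simp
    moreover have "cvec.dim (X \<inter> V) \<le> k + 1" "cvec.dim (X \<inter> W) \<le> k + 1" using le[OF X] by auto
    ultimately show ?thesis by (simp add: Int_commute[of _ X])
  qed
  then show ?thesis by (auto simp: isotropic_family_def)
qed

lemma isotropic_family_refl:
  "V \<in> isotropic_grassmannian k \<Longrightarrow> V \<in> isotropic_family k V"
  by (simp add: isotropic_family_def isotropic_grassmannian_def)

lemma isotropic_family_neighbourhood:
  assumes V: "V \<in> isotropic_grassmannian k"
  obtains U where "openin (isotropic_topology k) U" "V \<in> U" "U \<subseteq> isotropic_family k V"
proof (cases "2 * (k + 1) < cvec.dim L")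
  case True
  then have "isotropic_family k V = isotropic_grassmannian k"
    by (simp add: isotropic_family_def)
  moreover have "openin (isotropic_topology k) (isotropic_grassmannian k)"
    using openin_topspace[of "isotropic_topology k"] unfolding topspace_isotropic .
  ultimately show ?thesis using that[of "isotropic_grassmannian k"] V by simp
next
  case False
  have "2 * (k + 1) = cvec.dim L"
    using False dim_isotropic_le[of V] V by (auto simp: isotropic_grassmannian_def)
  then obtain U where U: "openin (grassmannian_topology k n) U" "V \<in> U"
    "\<And>W. W \<in> U \<Longrightarrow> W \<in> isotropic_grassmannian k \<Longrightarrow> even (k + 1 - cvec.dim (V \<inter> W))"
    using opposite_neighbourhood[OF V] by metis
  show ?thesis
  proof (rule that[of "U \<inter> isotropic_grassmannian k"])
    show "openin (isotropic_topology k) (U \<inter> isotropic_grassmannian k)"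
      unfolding openin_subtopology using U(1) by (intro exI[of _ U] conjI refl)
    show "U \<inter> isotropic_grassmannian k \<subseteq> isotropic_family k V"
      using U(3) by (auto simp: isotropic_family_def)
  qed (use U(2) V in blast)
qed

lemma isotropic_family_clopen:
  assumes V: "V \<in> isotropic_grassmannian k"
  shows "openin (isotropic_topology k) (isotropic_family k V)"
    and "openin (isotropic_topology k) (isotropic_grassmannian k - isotropic_family k V)"
proof -
  show "openin (isotropic_topology k) (isotropic_family k V)"
  proof (subst openin_subopen, intro ballI)
    fix W assume W: "W \<in> isotropic_family k V"
    then have "W \<in> isotropic_grassmannian k" by (simp add: isotropic_family_def)
    then obtain U where "openin (isotropic_topology k) U" "W \<in> U" "U \<subseteq> isotropic_family k W"
      by (rule isotropic_family_neighbourhood)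
    then show "\<exists>U. openin (isotropic_topology k) U \<and> W \<in> U \<and> U \<subseteq> isotropic_family k V"
      using isotropic_family_equivalence[OF V W] by auto
  qed
  show "openin (isotropic_topology k) (isotropic_grassmannian k - isotropic_family k V)"
  proof (subst openin_subopen, intro ballI)
    fix W assume W: "W \<in> isotropic_grassmannian k - isotropic_family k V"
    then obtain U where U: "openin (isotropic_topology k) U" "W \<in> U" "U \<subseteq> isotropic_family k W"
      using isotropic_family_neighbourhood[of W k] by auto
    have "U \<inter> isotropic_family k V = {}"
    proof (rule ccontr)
      assume "U \<inter> isotropic_family k V \<noteq> {}"
      then obtain X where X: "X \<in> isotropic_family k W" "X \<in> isotropic_family k V" using U(3) by blast
      then have "isotropic_family k W = isotropic_family k V"
        using isotropic_family_equivalence[OF V X(2)] isotropic_family_equivalence[of W k X] W by auto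
      then show False using W isotropic_family_refl[of W k] by auto
    qed
    moreover have "U \<subseteq> isotropic_grassmannian k" using U(3) by (auto simp: isotropic_family_def)
    ultimately show "\<exists>U. openin (isotropic_topology k) U \<and> W \<in> U \<and> U \<subseteq> isotropic_grassmannian k - isotropic_family k V"
      using U by (intro exI[of _ U]) blast
  qed
qed

text \<open>The curve starts in the family, which is open and closed, so it cannot leave it.\<close>

lemma curve_within_family:
  assumes X: "X \<in> isotropic_grassmannian k" and V: "V \<in> isotropic_family k X" and W: "W \<in> isotropic_family k X"
  shows "curve_within k (isotropic_family k X) V W"
proof -
  have VW: "isotropic V" "cvec.dim V = k + 1" "isotropic W" "cvec.dim W = k + 1"
    using V W by (auto simp: isotropic_family_def isotropic_grassmannian_def)
  have "W \<in> isotropic_family k V" using isotropic_family_equivalence[OF X V] W by simp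
  then have "2 * (k + 1) < cvec.dim L \<or> even (k + 1 - cvec.dim (V \<inter> W))"
    by (simp add: isotropic_family_def)
  then have "joined (k + 1) V W" by (intro isotropic_joined VW) simp_all
  then obtain \<delta> A where A: "isotropic_curve (k + 1) \<delta> A"
    "binary_plane k \<delta> A 1 0 = V" "binary_plane k \<delta> A 0 1 = W"
    unfolding joined_def pencil_eq by (elim exE conjE)
  have "binary_plane k \<delta> A s t \<in> isotropic_family k X" (is "?G \<in> _")
    if st: "(s, t) \<noteq> (0, 0)" for s t
  proof (rule ccontr)
    assume "?G \<notin> isotropic_family k X"
    then have G: "?G \<in> isotropic_grassmannian k - isotropic_family k X"
      using isotropic_curveD(2)[OF A(1) st] by blast
    obtain O1 where O1: "openin (grassmannian_topology k n) O1" "isotropic_family k X = O1 \<inter> isotropic_grassmannian k"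
      using isotropic_family_clopen(1)[OF X] unfolding openin_subtopology by blast
    obtain O2 where O2: "openin (grassmannian_topology k n) O2"
      "isotropic_grassmannian k - isotropic_family k X = O2 \<inter> isotropic_grassmannian k"
      using isotropic_family_clopen(2)[OF X] unfolding openin_subtopology by blast
    have "V \<in> O1" "?G \<in> O2" using V G O1(2) O2(2) by blast+
    then have "\<exists>s t. (s, t) \<noteq> (0, 0) \<and> binary_plane k \<delta> A s t \<in> O1 \<inter> O2"
      using A(2) by (intro isotropic_curve_opens_meet[OF A(1) st O1(1) _ O2(1)]) simp_all
    then obtain s' t' where st': "(s', t') \<noteq> (0, 0)" "binary_plane k \<delta> A s' t' \<in> O1 \<inter> O2"
      by (elim exE conjE)
    show False using isotropic_curveD(2)[OF A(1) st'(1)] st'(2) O1(2) O2(2) by blast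
  qed
  then show ?thesis unfolding curve_within_def using A
    by (intro exI[of _ \<delta>] exI[of _ A] conjI allI impI)
qed

theorem component_rationally_connected:
  assumes Z: "Z \<in> irreducible_components (isotropic_topology k)" and k: "1 \<le> k"
  shows "rationally_connected (pluecker_index k n) (pluecker k n ` Z)"
proof -
  have irr: "irreducible_in (isotropic_topology k) Z"
    and maxZ: "\<And>Z'. irreducible_in (isotropic_topology k) Z' \<Longrightarrow> Z \<subseteq> Z' \<Longrightarrow> Z' = Z"
    using Z unfolding irreducible_components_def by blast+
  have ZF: "Z \<subseteq> isotropic_grassmannian k" "Z \<noteq> {}"
    using irr unfolding irreducible_in_def topspace_isotropic by blast+
  then obtain X where X: "X \<in> Z" "X \<in> isotropic_grassmannian k" by blast
  let ?S = "isotropic_family k X"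
  have XS: "X \<in> ?S" using isotropic_family_refl[OF X(2)] .
  have SF: "?S \<subseteq> isotropic_grassmannian k" by (auto simp: isotropic_family_def)
  have "closedin (isotropic_topology k) ?S" "closedin (isotropic_topology k) (isotropic_grassmannian k - ?S)"
    using isotropic_family_clopen[OF X(2)] SF unfolding closedin_def topspace_isotropic
    by (simp_all only: double_diff[OF SF order_refl] Diff_subset)
  then have "Z \<subseteq> ?S \<or> Z \<subseteq> isotropic_grassmannian k - ?S"
    using irr ZF(1) unfolding irreducible_in_def by blast
  then have "Z \<subseteq> ?S" using X(1) XS by blast
  moreover have "irreducible_in (isotropic_topology k) ?S"
    using SF XS curve_within_family[OF X(2)] by (intro irreducible_if_curve_within) auto
  ultimately have "Z = ?S" using maxZ by blast
  moreover have "rationally_connected (pluecker_index k n) (pluecker k n ` ?S)"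
  proof (rule rationally_connected_if_curve_within[OF SF curve_within_family[OF X(2)]])
    fix V assume V: "V \<in> ?S"
    then have V': "isotropic V" "cvec.dim V = k + 1" using SF by (auto simp: isotropic_grassmannian_def)
    have "2 \<le> k + 1" using k by simp
    then obtain W where W: "isotropic W" "cvec.dim W = k + 1" "W \<noteq> V" "even (k + 1 - cvec.dim (V \<inter> W))"
      by (rule isotropic_partner[OF V'])
    then have "W \<in> isotropic_family k V"
      by (simp add: isotropic_family_def isotropic_grassmannian_def)
    then show "\<exists>W\<in>?S. W \<noteq> V" using isotropic_family_equivalence[OF X(2) V] W(3) by auto
  qed
  ultimately show ?thesis by simp
qed

end

section \<open>Smooth complete intersections of degree two\<close>

text \<open>Some degree is not 1; it divides 2, hence is 2, and the others have product 1.\<close>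

lemma degrees_with_product_two:
  fixes d :: "'i \<Rightarrow> nat"
  assumes "finite I" "(\<Prod>i\<in>I. d i) = 2"
  shows "\<exists>i\<in>I. d i = 2 \<and> (\<forall>j\<in>I. j \<noteq> i \<longrightarrow> d j = 1)"
proof -
  have "\<exists>i\<in>I. d i \<noteq> 1"
  proof (rule ccontr)
    assume "\<not> ?thesis"
    then have "(\<Prod>i\<in>I. d i) = 1" by (intro prod.neutral) simp
    then show False using assms(2) by simp
  qed
  then obtain i where i: "i \<in> I" "d i \<noteq> 1" by blast
  have split: "d i * (\<Prod>j\<in>I - {i}. d j) = 2"
    using prod.remove[OF assms(1) i(1), of d] assms(2) by simp
  then have "d i dvd 2" by (metis dvd_triv_left)
  then have "d i \<le> 2" by (rule dvd_imp_le) simp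
  moreover have "d i \<noteq> 0" using split by (metis mult_0 zero_neq_numeral)
  ultimately have "d i = 2" using i(2) by linarith
  then have "(\<Prod>j\<in>I - {i}. d j) = 1" using split by simp
  then have "d j = 1" if "j \<in> I" "j \<noteq> i" for j
    using that assms(1) dvd_prodI[of "I - {i}" j d] by simp
  then show ?thesis using i(1) \<open>d i = 2\<close> by blast
qed

text \<open>On the linear equations the gradient is constant, and on the quadric it is the polar form. A
  vector \<open>x\<close> of \<open>L\<close> orthogonal to \<open>L\<close> is isotropic, so it lies on the cone over \<open>X\<close>; but then the
  gradient of the quadric at \<open>x\<close> vanishes on the common kernel of the linear equations and is a
  combination of them, against the Jacobian criterion. The same criterion at any point of \<open>X\<close> makes the
  linear equations independent, which bounds the dimension of \<open>L\<close>.\<close>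

lemma coordinate_quadric_of_complete_intersection:
  fixes f :: "nat \<Rightarrow> nat cpoly"
  assumes i0: "i0 \<in> {1..s}" "d i0 = 2" "\<forall>j\<in>{1..s}. j \<noteq> i0 \<longrightarrow> d j = 1"
    and smooth: "smooth_complete_intersection n s d f"
  defines "B \<equiv> \<lambda>x y. dot {..n} (gradient {..n} (f i0) x) y"
    and "L \<equiv> {v \<in> coord_space {..n}. \<forall>j\<in>{1..s} - {i0}. poly_eval (f j) v = 0}"
  shows "coordinate_quadric B L (unit_vec ` {..n}) n (gradient {..n} (f i0))" (is ?quadric)
    and "fano k n (zero_locus {..n} (f ` {1..s})) =
      {W. cvec.subspace W \<and> W \<subseteq> L \<and> (\<forall>x\<in>W. \<forall>y\<in>W. B x y = 0) \<and> cvec.dim W = k + 1}" (is ?fano)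
    and "x \<in> L \<Longrightarrow> x \<noteq> 0 \<Longrightarrow> B x x = 0 \<Longrightarrow> cvec.dim L + (s - 1) \<le> n + 1"
proof -
  let ?g = "gradient {..n} (f i0)" and ?J = "{1..s} - {i0}" and ?X = "zero_locus {..n} (f ` {1..s})"
  have form: "is_form {..n} (d i) (f i)" if "i \<in> {1..s}" for i
    using smooth that unfolding smooth_complete_intersection_def complete_intersection_def by blast
  define l where "l j = gradient {..n} (f j) 0" for j
  have lin: "gradient {..n} (f j) x = l j" "poly_eval (f j) x = dot {..n} (l j) x" if "j \<in> ?J" for j x
  proof -
    have "is_form {..n} 1 (f j)" using form[of j] i0(3) that by simp
    from linear_form[OF this] show "gradient {..n} (f j) x = l j" "poly_eval (f j) x = dot {..n} (l j) x"
      unfolding l_def dot_def by blast+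
  qed
  have "is_form {..n} 2 (f i0)" using form[OF i0(1)] i0(2) by simp
  then obtain \<alpha> \<beta> where q:
    "\<And>x y. (\<Sum>i\<in>{..n}. gradient {..n} (f i0) x i * y i) = (\<Sum>m\<in>Poly_Mapping.keys (f i0). Poly_Mapping.lookup (f i0) m *
       (x (\<beta> m) * y (\<alpha> m) + x (\<alpha> m) * y (\<beta> m)))"
    "\<And>v. poly_eval (f i0) v = (\<Sum>m\<in>Poly_Mapping.keys (f i0). Poly_Mapping.lookup (f i0) m * (v (\<alpha> m) * v (\<beta> m)))"
    by (rule quadratic_form[OF _ finite_atMost]) (rule that)
  have B_eq: "B x y = (\<Sum>m\<in>Poly_Mapping.keys (f i0). Poly_Mapping.lookup (f i0) m *
       (x (\<beta> m) * y (\<alpha> m) + x (\<alpha> m) * y (\<beta> m)))" for x y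
    unfolding B_def dot_def by (rule q(1))
  have B_add: "B (x + y) z = B x z + B y z" and B_scale: "B (\<lambda>i. c * x i) z = c * B x z" for x y z c
    unfolding B_eq by (simp_all add: algebra_simps sum.distrib sum_distrib_left)
  have B_sym: "B x y = B y x" for x y unfolding B_eq by (simp add: mult_ac add_ac)
  have Q: "B v v = 2 * poly_eval (f i0) v" for v
    unfolding B_eq q(2) by (simp add: sum_distrib_left algebra_simps)
  interpret D: quadratic_space "\<lambda>(c::complex) (v::nat \<Rightarrow> complex) i. c * v i" "dot {..n}" "coord_space {..n}" "unit_vec ` {..n}"
    by (rule quadratic_space_dot) simp
  have sub_L: "cvec.subspace L"
  proof (rule cvec.subspaceI)
    show "0 \<in> L" by (simp add: L_def lin(2) coord_space_def)
    show "x + y \<in> L" if "x \<in> L" "y \<in> L" for x y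
      using that by (auto simp: L_def lin(2) coord_space_def D.B_add_right)
    show "(\<lambda>i. c * x i) \<in> L" if "x \<in> L" for c x
      using that by (auto simp: L_def lin(2) coord_space_def D.B_scale_right)
  qed
  have L_coord: "L \<subseteq> coord_space {..n}" by (auto simp: L_def)
  \<comment> \<open>the affine cone over \<open>X\<close> is the set of isotropic vectors of \<open>L\<close>\<close>
  have cone: "(\<forall>i\<in>{1..s}. poly_eval (f i) v = 0) \<and> v \<in> coord_space {..n} \<longleftrightarrow> v \<in> L \<and> B v v = 0" for v
    using i0(1) by (auto simp: L_def Q)
  have line: "cvec.span {v} \<in> ?X" if "v \<in> L" "B v v = 0" "v \<noteq> 0" for v
  proof -
    have v: "\<forall>i\<in>{1..s}. poly_eval (f i) v = 0" "v \<in> coord_space {..n}" using cone[of v] that by auto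
    have "poly_eval (f i) (\<lambda>j. c * v j) = 0" if "i \<in> {1..s}" for i c
      using poly_eval_scale[OF form[OF that], of c v] v(1) that by simp
    then show ?thesis
      using line_in_proj_space[OF v(2) that(3)] by (auto simp: zero_locus_def cvec.span_singleton)
  qed
  have indep: "cvec.indep_on {1..s} (\<lambda>i. gradient {..n} (f i) v)" if v: "v \<in> L" "B v v = 0" "v \<noteq> 0" for v
  proof (rule cvec.indep_on_if_dim)
    have "v \<in> cvec.span {v}" by (intro cvec.span_base) simp
    then show "cvec.dim ((\<lambda>i. gradient {..n} (f i) v) ` {1..s}) = card {1..s}"
      using smooth line[OF v] v(3) unfolding smooth_complete_intersection_def by simp
  qed simp
  have indep_l: "cvec.indep_on ?J l" if v: "v \<in> L" "B v v = 0" "v \<noteq> 0" for v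
  proof -
    have "cvec.indep_on ?J (\<lambda>i. gradient {..n} (f i) v)"
      using indep[OF v] by (rule cvec.indep_on_subset) auto
    moreover have "cvec.indep_on ?J (\<lambda>i. gradient {..n} (f i) v) \<longleftrightarrow> cvec.indep_on ?J l"
      by (rule cvec.indep_on_cong) (rule lin(1))
    ultimately show ?thesis by simp
  qed
  have lc: "l ` ?J \<subseteq> coord_space {..n}" and gc: "?g x \<in> coord_space {..n}" for x
    by (auto simp: l_def gradient_def coord_space_def)
  have nondeg: "\<exists>y\<in>L. B x y \<noteq> 0" if x: "x \<in> L" "x \<noteq> 0" for x
  proof (rule ccontr)
    assume n: "\<not> ?thesis"
    then have "B x x = 0" using x(1) by blast
    have "?g x \<notin> cvec.span ((\<lambda>i. gradient {..n} (f i) x) ` ?J)"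
      using i0(1) by (intro cvec.indep_on_notin_span[OF indep[OF x(1) \<open>B x x = 0\<close> x(2)]]) auto
    moreover have "(\<lambda>i. gradient {..n} (f i) x) ` ?J = l ` ?J" using lin(1) by (intro image_cong) auto
    ultimately have "?g x \<notin> cvec.span (l ` ?J)" by simp
    from D.separate_point[OF lc gc this]
    obtain z where z: "z \<in> coord_space {..n}" "\<And>v. v \<in> cvec.span (l ` ?J) \<Longrightarrow> dot {..n} v z = 0" "dot {..n} (?g x) z = 1"
      by blast
    have "poly_eval (f j) z = 0" if "j \<in> ?J" for j
      unfolding lin(2)[OF that] using that by (intro z(2) cvec.span_base imageI)
    then have "z \<in> L" using z(1) by (simp add: L_def)
    then show False using n z(3) by (auto simp: B_def)
  qed
  have LT: "L \<subseteq> cvec.span (unit_vec ` {..n})" using L_coord D.L_span by blast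
  show ?quadric
  proof
    show "B x y = dot {..n} x (?g y)" for x y
    proof -
      have "B x y = B y x" by (rule B_sym)
      also have "\<dots> = dot {..n} x (?g y)" unfolding B_def by (rule D.B_sym)
      finally show ?thesis .
    qed
  qed (fact B_add B_scale B_sym sub_L LT nondeg L_coord | simp)+
  show ?fano
  proof (intro equalityI subsetI CollectI)
    fix W assume W: "W \<in> fano k n ?X"
    then have W': "cvec.subspace W" "W \<subseteq> coord_space {..n}" "cvec.dim W = k + 1"
      and WX: "\<And>l. l \<in> proj_space {..n} \<Longrightarrow> l \<subseteq> W \<Longrightarrow> l \<in> ?X"
      by (auto simp: fano_def grassmannian_def)
    have zero: "v \<in> L \<and> B v v = 0" if v: "v \<in> W" for v
    proof (cases "v = 0")
      case True
      then show ?thesis using cvec.subspace_0[OF sub_L] B_scale[of 0 0 0] by (simp add: zero_fun_def)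
    next
      case False
      have "cvec.span {v} \<subseteq> W" using v W'(1) by (intro cvec.span_minimal) auto
      moreover have "cvec.span {v} \<in> proj_space {..n}" using v W'(2) False by (intro line_in_proj_space) auto
      ultimately have "cvec.span {v} \<in> ?X" by (intro WX)
      moreover have "v \<in> cvec.span {v}" by (intro cvec.span_base) simp
      ultimately have "\<forall>i\<in>{1..s}. poly_eval (f i) v = 0" by (auto simp: zero_locus_def)
      then show ?thesis using cone[of v] v W'(2) by blast
    qed
    have "B x y = 0" if "x \<in> W" "y \<in> W" for x y
    proof -
      have "B (x + y) (x + y) = 0" using zero cvec.subspace_add[OF W'(1) that] by blast
      moreover have "B (x + y) (x + y) = B x x + B y x + (B x y + B y y)"
        unfolding B_add B_sym[of x "x + y"] B_sym[of y "x + y"] by (rule refl)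
      moreover have "B x x = 0" "B y y = 0" "B y x = B x y" using zero that B_sym[of y x] by auto
      ultimately show ?thesis by simp
    qed
    then show "cvec.subspace W \<and> W \<subseteq> L \<and> (\<forall>x\<in>W. \<forall>y\<in>W. B x y = 0) \<and> cvec.dim W = k + 1"
      using zero W' by blast
  next
    fix W assume "W \<in> {W. cvec.subspace W \<and> W \<subseteq> L \<and> (\<forall>x\<in>W. \<forall>y\<in>W. B x y = 0) \<and> cvec.dim W = k + 1}"
    then have W: "cvec.subspace W" "W \<subseteq> L" "\<And>x y. x \<in> W \<Longrightarrow> y \<in> W \<Longrightarrow> B x y = 0" "cvec.dim W = k + 1"
      by auto
    have "q \<in> ?X" if q: "q \<in> proj_space {..n}" "q \<subseteq> W" for q
    proof -
      obtain v where v: "v \<in> q" "v \<noteq> 0" "q = cvec.span {v}" by (rule proj_space_nonzero[OF q(1)]) blast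
      then have "v \<in> W" using q(2) by blast
      then show ?thesis unfolding v(3) using v(2) W(2,3) by (intro line) auto
    qed
    then show "W \<in> fano k n ?X" using W L_coord by (auto simp: fano_def grassmannian_def)
  qed
  assume x: "x \<in> L" "x \<noteq> 0" "B x x = 0"
  have "\<exists>C. C \<subseteq> L \<and> cvec.independent C \<and> L \<subseteq> cvec.span C \<and> card C = cvec.dim L"
    by (rule cvec.basis_exists) blast
  then obtain C where C: "C \<subseteq> L" "cvec.independent C" "card C = cvec.dim L" by blast
  have fC: "finite C"
    using cvec.independent_span_bound[OF _ C(2), of "unit_vec ` {..n}"] C(1) LT by auto
  have "card ?J + card C \<le> cvec.dim (coord_space {..n})"
  proof (rule D.card_orthogonal_le[OF _ fC indep_l[OF x(1,3,2)] _ lc])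
    show "cvec.indep_on C (\<lambda>v. v)" using C(2) fC by (simp add: cvec.indep_on_iff)
    show "(\<lambda>v. v) ` C \<subseteq> coord_space {..n}" using C(1) L_coord by auto
    show "dot {..n} (l a) b = 0" if "a \<in> ?J" "b \<in> C" for a b
      using that C(1) lin(2)[OF that(1), of b] by (auto simp: L_def)
  qed simp
  moreover have "cvec.dim (coord_space {..n}) \<le> card (unit_vec ` {..n})"
    using D.L_span by (intro cvec.dim_le_card) auto
  moreover have "card (unit_vec ` {..n}) \<le> n + 1" using card_image_le[of "{..n}" unit_vec] by simp
  ultimately show "cvec.dim L + (s - 1) \<le> n + 1" using C(3) i0(1) by simp
qed

theorem theorem4p1:
  fixes n s k :: nat and d :: "nat \<Rightarrow> nat" and f :: "nat \<Rightarrow> nat cpoly"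
    and X :: "(nat \<Rightarrow> complex) set set"
  assumes "1 \<le> s" and "s \<le> n - 2"
    and "\<forall>i\<in>{1..s}. 1 \<le> d i" and "(\<Prod>i=1..s. d i) = 2"
    and "1 \<le> k" and "k \<le> n - s - 1"
    and "smooth_complete_intersection n s d f"
    and "X = zero_locus {..n} (f ` {1..s})"
  shows "((n - s) div 2 < k \<and> k \<le> n - s - 1 \<longrightarrow> fano k n X = {}) \<and>
    (1 \<le> k \<and> k \<le> (n - s) div 2 \<longrightarrow>
      (\<forall>Z \<in> irreducible_components (subtopology (grassmannian_topology k n) (fano k n X)).
         rationally_connected (pluecker_index k n) (pluecker k n ` Z)))"
proof -
  obtain i0 where i0: "i0 \<in> {1..s}" "d i0 = 2" "\<forall>j\<in>{1..s}. j \<noteq> i0 \<longrightarrow> d j = 1"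
    using degrees_with_product_two[OF finite_atLeastAtMost assms(4)] by blast
  define B where "B x y = dot {..n} (gradient {..n} (f i0) x) y" for x y
  define L where "L = {v \<in> coord_space {..n}. \<forall>j\<in>{1..s} - {i0}. poly_eval (f j) v = 0}"
  note quadric = coordinate_quadric_of_complete_intersection[OF i0 assms(7),
    folded B_def[abs_def] B_def L_def assms(8)]
  interpret coordinate_quadric B L "unit_vec ` {..n}" n "gradient {..n} (f i0)"
    by (rule quadric(1))
  have fano: "fano k n X = isotropic_grassmannian k"
    unfolding quadric(2) isotropic_grassmannian_def isotropic_def by blast
  have "k \<le> (n - s) div 2" if W: "W \<in> isotropic_grassmannian k" for W
  proof -
    have W': "isotropic W" "cvec.dim W = k + 1" using W by (auto simp: isotropic_grassmannian_def)
    obtain w where w: "cvec.indep_on {..<k+1} w" "w 0 \<in> W"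
    proof (rule isotropic_basis[OF W'])
      fix w :: "nat \<Rightarrow> nat \<Rightarrow> complex"
      assume "cvec.indep_on {..<k+1} w" "\<And>a. a < k + 1 \<Longrightarrow> w a \<in> W"
      then show thesis by (intro that[of w]) simp_all
    qed simp
    have "w 0 \<noteq> 0"
    proof
      assume "w 0 = 0"
      then have "(0 :: nat \<Rightarrow> complex) \<in> w ` {..<k+1}" by (intro image_eqI[of _ _ 0]) auto
      from cvec.dependent_zero[OF this] show False using w(1) by (simp add: cvec.indep_on_iff)
    qed
    moreover have "w 0 \<in> L" "B (w 0) (w 0) = 0" using isotropicD(2,3)[OF W'(1)] w(2) by auto
    ultimately have "cvec.dim L + (s - 1) \<le> n + 1" by (intro quadric(3))
    moreover have "2 * (k + 1) \<le> cvec.dim L" using dim_isotropic_le[OF W'(1)] W'(2) by simp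
    ultimately have "2 * (k + 1) + (s - 1) \<le> n + 1" by linarith
    then have "2 * k \<le> n - s" using assms(1) by simp
    from div_le_mono[OF this, of 2] show ?thesis by simp
  qed
  then have empty: "fano k n X = {}" if "(n - s) div 2 < k" using that unfolding fano by fastforce
  show ?thesis
  proof (intro conjI impI ballI)
    show "fano k n X = {}" if "(n - s) div 2 < k \<and> k \<le> n - s - 1"
      using that empty by blast
    fix Z assume "Z \<in> irreducible_components (subtopology (grassmannian_topology k n) (fano k n X))"
    then have "Z \<in> irreducible_components (isotropic_topology k)" unfolding fano .
    then show "rationally_connected (pluecker_index k n) (pluecker k n ` Z)"
      using assms(5) by (rule component_rationally_connected)
  qed
qed

end
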